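(* Let $p>1$, let $\{T_m\}_{m\ge 0}$ be the $\mathsf{GN}$ process with attachment kernel $f(x)=(x+1)^p$, and let $T_\infty=\bigcup_{m\ge0}T_m$ be its increasing limit. Let $k=k_p$ be the smallest positive integer for which $p>1+\frac1k$. Then the set of values (up to isomorphism of rooted trees) that $T_\infty$ attains with positive probability is precisely the set of all trees of the form $\mathrm{Glue}(T,v,k)$, where $T$ is a finite rooted tree and $v$ is a vertex of $T$.
   Context: All trees are rooted with edges directed towards the root. If $(a,b)$ is an oriented edge, $a$ is a child of $b$. The (in-)degree $\mathrm d_T(b)$ of a node $b$ in a tree $T$ is the number of its children. Isomorphism means isomorphism of rooted (oriented) trees. The $\mathsf{GN}$ process with attachment kernel $f:\mathbb N\cup\{0\}\to(0,\infty)$ is the following Markov chain of random finite trees $T_m=(V_m,E_m)$, $m=0,1,2,\dots$. $T_0$ consists of a single root node and no edges. At each time $m\ge 1$, a new node $v_m$ is added together with a single new edge from $v_m$ to $w_m\in V_{m-1}$ (so $v_m$ becomes a child of $w_m$), where $$\mathbb P(w_m=w\mid T_{m-1})=\frac{f(\mathrm d_{T_{m-1}}(w))}{\sum_{v\in V_{m-1}}f(\mathrm d_{T_{m-1}}(v))}\qquad (w\in V_{m-1}).$$ $T_\infty$ is the infinite rooted tree with node set $\bigcup_m V_m$ and edge set $\bigcup_m E_m$. Given a finite rooted tree $T$, a distinguished node $v$ of $T$ and an integer $k\ge1$, $\mathrm{Glue}(T,v,k)$ is the following infinite rooted tree. For each (isomorphism class of) finite rooted tree $S$ on $k$ or fewer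 nodes take countably infinitely many disjoint copies $\{S_i\}_{i\ge1}$ of $S$; then $\mathrm{Glue}(T,v,k)$ is the disjoint union of $T$ with all of these copies (for all such $S$), together with an additional edge from the root of each copy $S_i$ to $v$ (so each of these roots becomes a child of $v$). Its root is the root of $T$. *)

theory Defs
  imports "HOL-Probability.Probability"
begin

text \<open>
  An edge \<open>(a, b)\<close> points from the child \<open>a\<close> to its parent \<open>b\<close>, that is, towards the root.
\<close>

record 'a rtree =
  nodes :: "'a set"
  edges :: "('a \<times> 'a) set"
  root :: 'a

definition rooted_tree :: "'a rtree \<Rightarrow> bool" where
  "rooted_tree T \<longleftrightarrow>
     root T \<in> nodes T \<and>
     edges T \<subseteq> nodes T \<times> nodes T \<and>
     (\<forall>y. (root T, y) \<notin> edges T) \<and>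
     (\<forall>x\<in>nodes T - {root T}. \<exists>!y. (x, y) \<in> edges T) \<and>
     (\<forall>x\<in>nodes T. (x, root T) \<in> (edges T)\<^sup>*)"

definition finite_rooted_tree :: "'a rtree \<Rightarrow> bool" where
  "finite_rooted_tree T \<longleftrightarrow> rooted_tree T \<and> finite (nodes T)"

definition in_deg :: "'a rtree \<Rightarrow> 'a \<Rightarrow> nat" where
  "in_deg T b = card {a. (a, b) \<in> edges T}"

definition rtree_iso :: "'a rtree \<Rightarrow> 'b rtree \<Rightarrow> bool" where
  "rtree_iso S T \<longleftrightarrow>
     (\<exists>\<phi>. bij_betw \<phi> (nodes S) (nodes T) \<and>
          \<phi> (root S) = root T \<and>
          (\<forall>a\<in>nodes S. \<forall>b\<in>nodes S. (a, b) \<in> edges S \<longleftrightarrow> (\<phi> a, \<phi> b) \<in> edges T))"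

text \<open>
  Only countable trees occur, so isomorphism classes are taken among trees whose nodes are
  natural numbers; the tree \<open>T\<close> itself may have nodes of another (sufficiently small) kind.
\<close>

definition iso_class :: "'a rtree \<Rightarrow> nat rtree set" where
  "iso_class T = {S. rooted_tree S \<and> rtree_iso S T}"

definition iso_classes :: "nat rtree set set" where
  "iso_classes = {iso_class T | T :: nat rtree. rooted_tree T}"

definition small_classes :: "nat \<Rightarrow> nat rtree set set" where
  "small_classes k =
     {iso_class S | S :: nat rtree. finite_rooted_tree S \<and> card (nodes S) \<le> k}"

definition representative :: "nat rtree set \<Rightarrow> nat rtree" where
  "representative C = (SOME S. S \<in> C)"

text \<open>
  \<open>Inl a\<close> is the node \<open>a\<close> of \<open>T\<close>, and \<open>Inr (C, i, x)\<close> is the node \<open>x\<close> of the \<open>i\<close>-th copy of the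
  chosen member of the isomorphism class \<open>C\<close>, with one copy for every natural number \<open>i\<close>.
\<close>

definition Glue :: "'a rtree \<Rightarrow> 'a \<Rightarrow> nat \<Rightarrow> ('a + nat rtree set \<times> nat \<times> nat) rtree" where
  "Glue T v k =
     \<lparr> nodes = {Inl a | a. a \<in> nodes T} \<union>
               {Inr (C, i, x) | C i x. C \<in> small_classes k \<and> x \<in> nodes (representative C)},
       edges = {(Inl a, Inl b) | a b. (a, b) \<in> edges T} \<union>
               {(Inr (C, i, x), Inr (C, i, y)) | C i x y.
                  C \<in> small_classes k \<and> (x, y) \<in> edges (representative C)} \<union>
               {(Inr (C, i, root (representative C)), Inl v) | C i. C \<in> small_classes k},
       root = Inl (root T) \<rparr>"

definition add_leaf :: "'a rtree \<Rightarrow> 'a \<Rightarrow> 'a \<Rightarrow> 'a rtree" where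
  "add_leaf T v w =
     \<lparr> nodes = insert v (nodes T), edges = insert (v, w) (edges T), root = root T \<rparr>"

text \<open>
  The node added at time \<open>m\<close> is named \<open>m\<close>, the initial root being \<open>0\<close>; \<open>w m\<close> is the node it is
  attached to (\<open>w 0\<close> plays no role). The attachment probabilities are conditional on the whole
  history of the chain, which expresses the Markov property together with the transition law.
\<close>

locale GN_process = prob_space M for M :: "'w measure" +
  fixes f :: "nat \<Rightarrow> real"
    and w :: "nat \<Rightarrow> 'w \<Rightarrow> nat"
    and T :: "nat \<Rightarrow> 'w \<Rightarrow> nat rtree"
  assumes kernel_pos: "\<And>d. 0 < f d"
    and w_measurable: "\<And>m. random_variable (count_space UNIV) (w (Suc m))"
    and T_0: "\<And>\<omega>. \<omega> \<in> space M \<Longrightarrow> T 0 \<omega> = \<lparr> nodes = {0}, edges = {}, root = 0 \<rparr>"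
    and w_in_nodes: "\<And>m \<omega>. \<omega> \<in> space M \<Longrightarrow> w (Suc m) \<omega> \<in> nodes (T m \<omega>)"
    and T_Suc: "\<And>m \<omega>. \<omega> \<in> space M \<Longrightarrow> T (Suc m) \<omega> = add_leaf (T m \<omega>) (Suc m) (w (Suc m) \<omega>)"
    and attachment: "\<And>m h x. \<lbrakk> \<P>(\<omega> in M. \<forall>j\<le>m. T j \<omega> = h j) > 0; x \<in> nodes (h m) \<rbrakk> \<Longrightarrow>
           \<P>(\<omega> in M. w (Suc m) \<omega> = x \<bar> \<forall>j\<le>m. T j \<omega> = h j)
             = f (in_deg (h m) x) / (\<Sum>v\<in>nodes (h m). f (in_deg (h m) v))"

definition limit_tree :: "(nat \<Rightarrow> 'a rtree) \<Rightarrow> 'a rtree" where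
  "limit_tree t =
     \<lparr> nodes = (\<Union>m. nodes (t m)), edges = (\<Union>m. edges (t m)), root = root (t 0) \<rparr>"

end

theory Submission
  imports Defs "HOL-Real_Asymp.Real_Asymp"
begin

text \<open>
  Let \<open>g d\<close> be comparable to the tail \<open>\<Sum>i\<ge>d. 1 / f i\<close>. Whenever a node of degree \<open>d\<close> is hit, which has
  probability \<open>f d / W\<close> for the total weight \<open>W\<close>, its value \<open>g\<close> drops by at least \<open>1 / f d\<close>; so \<open>g\<close> of the
  maximal degree pays for any event of rate \<open>R / W\<close>. Hence a subtree that starts when the maximal degree
  is \<open>d\<close> ever gains \<open>s\<close> further nodes with probability at most \<open>(R * g d) ^ s\<close>. As the \<open>i\<close>-th child of a
  node is born at maximal degree at least \<open>i\<close> and \<open>g i\<close> is of order \<open>i\<close> to the power \<open>1 - p\<close>, Borel--Cantelli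
  leaves each node only finitely many children with subtrees of more than \<open>k\<close> nodes. The maximal degree
  grows at least like a power of time, so that all but finitely many subtrees have bounded size; thus
  some node has infinite degree. It is unique: for two nodes \<open>u, v\<close> the product of
  \<open>\<Prod>i<deg u. 1 + \<i> \<theta> / f i\<close> and \<open>\<Prod>i<deg v. 1 - \<i> \<theta> / f i\<close> is a martingale whose limit, if both degrees are
  infinite, exceeds all other values by an unbounded factor as \<open>\<theta> \<rightarrow> \<infinity>\<close>.

  Conversely, since \<open>(k - 1) * (p - 1) \<le> 1\<close> and \<open>W\<close> is at most \<open>(2 * m + 1)\<close> to the power \<open>p\<close> at time \<open>m\<close>,
  the child of the hub born at time \<open>m\<close> grows into a prescribed tree with at most \<open>k\<close> nodes with chance at
  least of order \<open>1 / m\<close>; these chances have a divergent sum, and an exponential supermartingale replaces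
  the missing independence. Every \<open>Glue S v k\<close> has positive probability because after building \<open>S\<close> and
  many children of \<open>v\<close> in a row the above bounds make all later deviations improbable.
\<close>

text \<open>The total weight \<open>W\<close> is random and hard to control while it is not known
  which node wins. The upper bounds never estimate it: the rate of the event to be excluded and the
  rate at which the maximal degree rises carry the same factor \<open>1 / W\<close>, which cancels
  in a one-step inequality. This is the race of the continuous-time embedding, where a node of high
  degree is likely to explode before a bounded family grows, carried out without leaving discrete
  time.

  Borel-Cantelli along the children of one node says nothing uniform over all nodes. For that, any
  positive power of time as a lower bound for the maximal degree is enough, because the size
  \<open>K\<close> in the uniform statement is arbitrary; the sharp size \<open>k\<close> matters
  only at the children of the hub. For the converse, chances of order \<open>1 / m\<close> have to
  be summed over the birth times of the hub's children alone. The sum diverges because these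
  children have positive density among all nodes, and this is read off the structure already proved:
  outside a finite set every node lies in a branch of at most \<open>k\<close> nodes below a child
  of the hub.\<close>

section \<open>Histories of the process\<close>

text \<open>A recursive tree on \<open>nat\<close> is given by its parent function \<open>x\<close>; the value \<open>x 0\<close> at the root is junk.\<close>

definition parent_fun :: "(nat \<Rightarrow> nat) \<Rightarrow> bool" where
  "parent_fun x \<longleftrightarrow> (\<forall>j. x (Suc j) \<le> j)"

definition deg :: "(nat \<Rightarrow> nat) \<Rightarrow> nat \<Rightarrow> nat \<Rightarrow> nat" where
  "deg x m v = card {j \<in> {1..m}. x j = v}"

text \<open>Adaptedness to the history up to time \<open>m\<close>, stated pointwise for functions
  of the whole parent sequence. No filtration or conditional expectation is set up; being determined
  at a finite time gives measurability and integrability at once.\<close>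

definition determined :: "nat \<Rightarrow> ((nat \<Rightarrow> nat) \<Rightarrow> 'b) \<Rightarrow> bool" where
  "determined m G \<longleftrightarrow> (\<forall>x y. (\<forall>j\<in>{1..m}. x j = y j) \<longrightarrow> G x = G y)"

definition tree_upto :: "(nat \<Rightarrow> nat) \<Rightarrow> nat \<Rightarrow> nat rtree" where
  "tree_upto x m = \<lparr> nodes = {..m}, edges = {(j, x j) | j. j \<in> {1..m}}, root = 0 \<rparr>"

text \<open>One canonical sequence for each possible history, padded by 0, so that the events
  \<open>hist m h\<close> with \<open>h\<close> in this finite set partition the space.\<close>

definition histories :: "nat \<Rightarrow> (nat \<Rightarrow> nat) set" where
  "histories m = {h. (\<forall>j\<in>{1..m}. h j < j) \<and> (\<forall>j. j \<notin> {1..m} \<longrightarrow> h j = 0)}"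

lemma parent_funD: "parent_fun x \<Longrightarrow> 0 < j \<Longrightarrow> x j < j"
  unfolding parent_fun_def by (cases j) (auto simp: less_Suc_eq_le)

lemma determinedI: "(\<And>x y. (\<And>j. 1 \<le> j \<Longrightarrow> j \<le> m \<Longrightarrow> x j = y j) \<Longrightarrow> G x = G y) \<Longrightarrow> determined m G"
  unfolding determined_def by (meson atLeastAtMost_iff)

lemma determinedD:
  assumes "determined m G" and "\<And>j. 1 \<le> j \<Longrightarrow> j \<le> m \<Longrightarrow> x j = y j"
  shows "G x = G y"
  using assms unfolding determined_def by (metis atLeastAtMost_iff)

lemma determined_mono: "determined m G \<Longrightarrow> m \<le> n \<Longrightarrow> determined n G"
  unfolding determined_def by auto

lemma determined_const [simp]: "determined m (\<lambda>x. c)"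
  unfolding determined_def by auto

lemma determined_comp: "determined m G \<Longrightarrow> determined m (\<lambda>x. F (G x))"
  unfolding determined_def by metis

lemma determined_comp2: "determined m G \<Longrightarrow> determined m H \<Longrightarrow> determined m (\<lambda>x. F (G x) (H x))"
  unfolding determined_def by metis

lemma deg_Suc: "deg x (Suc m) v = deg x m v + (if x (Suc m) = v then 1 else 0)"
proof -
  have "{j \<in> {1..Suc m}. x j = v} =
    (if x (Suc m) = v then insert (Suc m) {j \<in> {1..m}. x j = v} else {j \<in> {1..m}. x j = v})"
    by (auto simp: le_Suc_eq)
  then show ?thesis unfolding deg_def by auto
qed

lemma deg_0 [simp]: "deg x 0 v = 0"
  unfolding deg_def by auto

lemma determined_deg: "determined m (\<lambda>x. deg x m)"
proof (rule determinedI)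
  fix x y :: "nat \<Rightarrow> nat" assume "\<And>j. 1 \<le> j \<Longrightarrow> j \<le> m \<Longrightarrow> x j = y j"
  then have "{j \<in> {1..m}. x j = v} = {j \<in> {1..m}. y j = v}" for v by auto
  then show "deg x m = deg y m" unfolding deg_def by auto
qed

lemma deg_upd: "deg (x(Suc m := y)) (Suc m) v = deg x m v + (if v = y then 1 else 0)"
proof -
  have "deg (x(Suc m := y)) m = deg x m"
    by (rule determinedD[OF determined_deg]) auto
  then show ?thesis by (simp add: deg_Suc)
qed

lemma deg_mono: "m \<le> n \<Longrightarrow> deg x m v \<le> deg x n v"
  by (induction n rule: dec_induct) (auto simp: deg_Suc)

lemma deg_le: "deg x m v \<le> m"
  by (induction m) (auto simp: deg_Suc)

lemma deg_unborn: assumes "parent_fun x" shows "m \<le> v \<Longrightarrow> deg x m v = 0"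
proof (induction m)
  case (Suc m)
  have "x (Suc m) \<le> m" using assms unfolding parent_fun_def by auto
  then show ?case using Suc by (auto simp: deg_Suc)
qed simp

lemma sum_deg: assumes "parent_fun x" shows "(\<Sum>v\<le>m. deg x m v) = m"
proof (induction m)
  case (Suc m)
  have le: "x (Suc m) \<le> m" using assms unfolding parent_fun_def by auto
  have "(\<Sum>v\<le>Suc m. deg x (Suc m) v) = (\<Sum>v\<le>m. deg x (Suc m) v)"
    using deg_unborn[OF assms, of "Suc m" "Suc m"] by simp
  also have "\<dots> = (\<Sum>v\<le>m. deg x m v) + (\<Sum>v\<le>m. if x (Suc m) = v then 1 else 0)"
    by (simp add: deg_Suc sum.distrib)
  also have "\<dots> = Suc m" using Suc le by (simp add: sum.delta)
  finally show ?case .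
qed simp

lemma in_deg_tree_upto: "in_deg (tree_upto x m) v = deg x m v"
proof -
  have "{a. (a, v) \<in> edges (tree_upto x m)} = {j \<in> {1..m}. x j = v}"
    by (auto simp: tree_upto_def)
  then show ?thesis by (simp add: in_deg_def deg_def)
qed

lemma histories_0: "histories 0 = {\<lambda>_. 0}"
  unfolding histories_def by auto

lemma histories_Suc:
  "histories (Suc m) = (\<lambda>(h, y). h(Suc m := y)) ` (histories m \<times> {..m})"
proof (intro equalityI subsetI)
  fix h assume h: "h \<in> histories (Suc m)"
  have "h(Suc m := 0) \<in> histories m" using h unfolding histories_def by auto
  moreover have "h (Suc m) < Suc m"
    using h[unfolded histories_def, THEN CollectD, THEN conjunct1] by (rule bspec) simp
  then have "h (Suc m) \<le> m" by simp
  ultimately show "h \<in> (\<lambda>(h, y). h(Suc m := y)) ` (histories m \<times> {..m})"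
    by (intro image_eqI[where x = "(h(Suc m := 0), h (Suc m))"]) auto
qed (auto simp: histories_def)

lemma inj_on_histories: "inj_on (\<lambda>(h, y). h(Suc m := y)) (histories m \<times> {..m})"
proof (rule inj_onI, clarsimp)
  fix h y h' y' assume h: "h \<in> histories m" "h' \<in> histories m" and eq: "h(Suc m := y) = h'(Suc m := y')"
  have "h (Suc m) = 0" "h' (Suc m) = 0" using h by (auto simp: histories_def)
  then have "h = (h(Suc m := y))(Suc m := 0)" "h' = (h'(Suc m := y'))(Suc m := 0)" by auto
  moreover have "y = y'" using fun_cong[OF eq, of "Suc m"] by simp
  ultimately show "h = h' \<and> y = y'" using eq by metis
qed

lemma finite_histories: "finite (histories m)"
  by (induction m) (auto simp: histories_0 histories_Suc)

locale GN_parents = GN_process M f w T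
  for M :: "'w measure" and f w T
begin

text \<open>The entry at 0 is fixed by hand because \<open>w 0\<close> is unconstrained and need not
  be measurable.\<close>

definition X :: "'w \<Rightarrow> nat \<Rightarrow> nat" where
  "X \<omega> j = (if j = 0 then 0 else w j \<omega>)"

definition wt :: "(nat \<Rightarrow> nat) \<Rightarrow> nat \<Rightarrow> real" where
  "wt x m = (\<Sum>v\<le>m. f (deg x m v))"

definition pr :: "(nat \<Rightarrow> nat) \<Rightarrow> nat \<Rightarrow> nat \<Rightarrow> real" where
  "pr x m y = f (deg x m y) / wt x m"

lemma wt_pos: "0 < wt x m"
  unfolding wt_def by (intro sum_pos) (auto simp: kernel_pos)

lemma pr_nonneg: "0 \<le> pr x m y"
  unfolding pr_def using wt_pos kernel_pos by (simp add: less_imp_le)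

lemma sum_pr: "(\<Sum>y\<le>m. pr x m y) = 1"
  unfolding pr_def sum_divide_distrib[symmetric] using wt_pos[of x m] by (simp add: wt_def)

lemma determined_pr: "determined m (\<lambda>x. pr x m)"
proof (rule determinedI)
  fix x y :: "nat \<Rightarrow> nat" assume "\<And>j. 1 \<le> j \<Longrightarrow> j \<le> m \<Longrightarrow> x j = y j"
  then have "deg x m = deg y m" by (rule determinedD[OF determined_deg])
  then show "pr x m = pr y m" by (auto simp: pr_def wt_def)
qed

lemma T_parent:
  assumes "\<omega> \<in> space M"
  shows "T m \<omega> = tree_upto (X \<omega>) m"
proof (induction m)
  case (Suc m)
  have "{(j, X \<omega> j) | j. j \<in> {1..Suc m}} = insert (Suc m, w (Suc m) \<omega>) {(j, X \<omega> j) | j. j \<in> {1..m}}"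
    by (auto simp: X_def le_Suc_eq)
  then show ?case using Suc T_Suc[OF assms, of m] by (auto simp: add_leaf_def tree_upto_def)
qed (use assms in \<open>auto simp: T_0 tree_upto_def\<close>)

lemma parent_fun_X:
  assumes "\<omega> \<in> space M"
  shows "parent_fun (X \<omega>)"
  using w_in_nodes[OF assms] T_parent[OF assms]
  by (auto simp: parent_fun_def X_def tree_upto_def)

lemma limit_tree_X:
  assumes "\<omega> \<in> space M"
  shows "limit_tree (\<lambda>m. T m \<omega>) = \<lparr> nodes = UNIV, edges = {(j, X \<omega> j) | j. 0 < j}, root = 0 \<rparr>"
proof -
  have "(\<Union>m. {..m}) = (UNIV :: nat set)" by auto
  moreover have "(\<Union>m. {(j, X \<omega> j) | j. j \<in> {1..m}}) = {(j, X \<omega> j) | j. 0 < j}" by force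
  ultimately show ?thesis by (simp add: limit_tree_def T_parent[OF assms] tree_upto_def)
qed

lemma X_measurable [measurable]: "(\<lambda>\<omega>. X \<omega> j) \<in> measurable M (count_space UNIV)"
  by (cases j) (auto simp: X_def w_measurable)

definition hist :: "nat \<Rightarrow> (nat \<Rightarrow> nat) \<Rightarrow> 'w set" where
  "hist m h = {\<omega>\<in>space M. \<forall>j\<in>{1..m}. X \<omega> j = h j}"

lemma hist_sets [measurable]: "hist m h \<in> sets M"
  unfolding hist_def by measurable

lemma determined_hist:
  assumes "determined m G" and "\<omega> \<in> hist m h"
  shows "G (X \<omega>) = G h"
  using assms by (auto simp: hist_def intro!: determinedD[OF assms(1)])

lemma tree_upto_eq_iff: "tree_upto x m = tree_upto y m \<longleftrightarrow> (\<forall>j\<in>{1..m}. x j = y j)"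
proof
  assume eq: "tree_upto x m = tree_upto y m"
  show "\<forall>j\<in>{1..m}. x j = y j"
  proof
    fix j assume "j \<in> {1..m}"
    then have "(j, x j) \<in> edges (tree_upto x m)" by (auto simp: tree_upto_def)
    then have "(j, x j) \<in> edges (tree_upto y m)" using eq by simp
    then show "x j = y j" by (auto simp: tree_upto_def)
  qed
qed (auto simp: tree_upto_def)

text \<open>The attachment law is only given on histories of positive probability; on a null history
  both sides vanish, so the product formula holds without exception.\<close>

lemma prob_hist_Suc:
  assumes y: "y \<le> m"
  shows "prob (hist (Suc m) (h(Suc m := y))) = prob (hist m h) * pr h m y"
proof -
  have split: "hist (Suc m) (h(Suc m := y)) = {\<omega>\<in>space M. w (Suc m) \<omega> = y \<and> \<omega> \<in> hist m h}"
    by (auto simp: hist_def X_def le_Suc_eq)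
  have T: "hist m h = {\<omega>\<in>space M. \<forall>j\<le>m. T j \<omega> = tree_upto h j}"
    by (auto simp: hist_def T_parent tree_upto_eq_iff)
  show ?thesis
  proof (cases "prob (hist m h) = 0")
    case True
    have "prob (hist (Suc m) (h(Suc m := y))) \<le> prob (hist m h)"
      by (rule finite_measure_mono) (auto simp: split)
    then show ?thesis using True by (simp add: measure_le_0_iff)
  next
    case False
    then have pos: "\<P>(\<omega> in M. \<forall>j\<le>m. T j \<omega> = tree_upto h j) > 0"
      using T by (simp add: zero_less_measure_iff)
    have "\<P>(\<omega> in M. w (Suc m) \<omega> = y \<bar> \<forall>j\<le>m. T j \<omega> = tree_upto h j) = pr h m y"
      using attachment[OF pos, of y] y
      by (simp add: tree_upto_def[of h m, THEN arg_cong[of _ _ nodes]] in_deg_tree_upto pr_def wt_def)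
    moreover have "{\<omega>\<in>space M. w (Suc m) \<omega> = y \<and> (\<forall>j\<le>m. T j \<omega> = tree_upto h j)}
        = hist (Suc m) (h(Suc m := y))" using T split by auto
    ultimately show ?thesis using False T by (simp add: cond_prob_def field_simps)
  qed
qed

lemma hist_history:
  assumes "\<omega> \<in> space M"
  shows "\<exists>!h. h \<in> histories m \<and> \<omega> \<in> hist m h"
proof (rule ex1I)
  let ?h = "\<lambda>j. if j \<in> {1..m} then X \<omega> j else 0"
  show "?h \<in> histories m \<and> \<omega> \<in> hist m ?h"
    using assms parent_funD[OF parent_fun_X[OF assms]] by (auto simp: histories_def hist_def)
  fix h assume "h \<in> histories m \<and> \<omega> \<in> hist m h"
  then show "h = ?h" by (auto simp: fun_eq_iff histories_def hist_def)
qed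

text \<open>An adapted quantity takes finitely many values, one for each history, so its integral is
  a finite sum and no boundedness has to be checked.\<close>

lemma determined_expand:
  fixes G :: "(nat \<Rightarrow> nat) \<Rightarrow> 'b::{banach, second_countable_topology}"
  assumes "determined m G" "\<omega> \<in> space M"
  shows "G (X \<omega>) = (\<Sum>h\<in>histories m. indicator (hist m h) \<omega> *\<^sub>R G h)"
proof -
  obtain h where h: "h \<in> histories m" "\<omega> \<in> hist m h"
    and uniq: "\<And>h'. h' \<in> histories m \<Longrightarrow> \<omega> \<in> hist m h' \<Longrightarrow> h' = h"
    using hist_history[OF assms(2), of m] by blast
  have "(\<Sum>h'\<in>histories m. indicator (hist m h') \<omega> *\<^sub>R G h')
      = (\<Sum>h'\<in>histories m. if h' = h then G h else 0)"
  proof (rule sum.cong[OF refl])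
    fix h' assume "h' \<in> histories m"
    then show "indicator (hist m h') \<omega> *\<^sub>R G h' = (if h' = h then G h else 0)"
      using uniq[of h'] h(2) by (cases "\<omega> \<in> hist m h'") auto
  qed
  also have "\<dots> = G h" using h(1) by (simp add: finite_histories)
  also have "\<dots> = G (X \<omega>)" by (rule determined_hist[OF assms(1) h(2), symmetric])
  finally show ?thesis ..
qed

lemma
  fixes G :: "(nat \<Rightarrow> nat) \<Rightarrow> 'b::{banach, second_countable_topology}"
  assumes G: "determined m G"
  shows integrable_determined: "integrable M (\<lambda>\<omega>. G (X \<omega>))"
    and integral_determined: "(\<integral>\<omega>. G (X \<omega>) \<partial>M) = (\<Sum>h\<in>histories m. prob (hist m h) *\<^sub>R G h)"
proof -
  have ind: "integrable M (\<lambda>\<omega>. indicator (hist m h) \<omega> *\<^sub>R G h)" for h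
    by (intro integrable_scaleR_left integrable_real_indicator hist_sets) (simp add: less_top[symmetric])
  then have int: "integrable M (\<lambda>\<omega>. \<Sum>h\<in>histories m. indicator (hist m h) \<omega> *\<^sub>R G h)"
    by (rule Bochner_Integration.integrable_sum)
  show "integrable M (\<lambda>\<omega>. G (X \<omega>))"
    by (rule Bochner_Integration.integrable_cong[OF refl determined_expand[OF G], THEN iffD2, OF _ int])
  have "(\<integral>\<omega>. G (X \<omega>) \<partial>M) = (\<integral>\<omega>. (\<Sum>h\<in>histories m. indicator (hist m h) \<omega> *\<^sub>R G h) \<partial>M)"
    by (rule Bochner_Integration.integral_cong[OF refl determined_expand[OF G]])
  also have "\<dots> = (\<Sum>h\<in>histories m. (\<integral>\<omega>. indicator (hist m h) \<omega> *\<^sub>R G h \<partial>M))"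
    by (rule Bochner_Integration.integral_sum) (rule ind)
  also have "\<dots> = (\<Sum>h\<in>histories m. prob (hist m h) *\<^sub>R G h)"
  proof (intro sum.cong refl)
    fix h
    have "integrable M (indicator (hist m h) :: 'w \<Rightarrow> real)"
      by (intro integrable_real_indicator) (auto simp: less_top[symmetric])
    then show "(\<integral>\<omega>. indicator (hist m h) \<omega> *\<^sub>R G h \<partial>M) = prob (hist m h) *\<^sub>R G h"
      by (simp add: Int_absorb2 sets.sets_into_space)
  qed
  finally show "(\<integral>\<omega>. G (X \<omega>) \<partial>M) = (\<Sum>h\<in>histories m. prob (hist m h) *\<^sub>R G h)" .
qed

lemma determined_sets:
  assumes "determined m P"
  shows "{\<omega>\<in>space M. P (X \<omega>)} \<in> sets M"
proof -
  have "{\<omega>\<in>space M. P (X \<omega>)} = (\<Union>h\<in>{h\<in>histories m. P h}. hist m h)"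
  proof (intro equalityI subsetI)
    fix \<omega> assume \<omega>: "\<omega> \<in> {\<omega>\<in>space M. P (X \<omega>)}"
    then obtain h where h: "h \<in> histories m" "\<omega> \<in> hist m h"
      using hist_history[of \<omega> m, THEN ex1_implies_ex] by auto
    have "P h" using \<omega> determined_hist[OF assms h(2)] by simp
    then show "\<omega> \<in> (\<Union>h\<in>{h\<in>histories m. P h}. hist m h)" using h by auto
  next
    fix \<omega> assume "\<omega> \<in> (\<Union>h\<in>{h\<in>histories m. P h}. hist m h)"
    then obtain h where h: "P h" "\<omega> \<in> hist m h" by auto
    then have "P (X \<omega>)" using determined_hist[OF assms h(2)] by simp
    then show "\<omega> \<in> {\<omega>\<in>space M. P (X \<omega>)}" using h(2) by (simp add: hist_def)
  qed
  then show ?thesis using finite_histories by auto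
qed

lemma determined_step:
  fixes G :: "(nat \<Rightarrow> nat) \<Rightarrow> 'b::real_normed_vector"
  assumes "determined (Suc m) G"
  shows "determined m (\<lambda>x. \<Sum>y\<le>m. pr x m y *\<^sub>R G (x(Suc m := y)))"
proof (rule determinedI)
  fix x x' :: "nat \<Rightarrow> nat" assume eq: "\<And>j. 1 \<le> j \<Longrightarrow> j \<le> m \<Longrightarrow> x j = x' j"
  have "pr x m = pr x' m" by (rule determinedD[OF determined_pr]) (use eq in auto)
  moreover have "G (x(Suc m := y)) = G (x'(Suc m := y))" for y
    by (rule determinedD[OF assms]) (use eq in \<open>auto simp: le_Suc_eq\<close>)
  ultimately show "(\<Sum>y\<le>m. pr x m y *\<^sub>R G (x(Suc m := y))) = (\<Sum>y\<le>m. pr x' m y *\<^sub>R G (x'(Suc m := y)))"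
    by simp
qed

text \<open>The transition law as an identity of expectations. It replaces conditioning on the
  history: the next parent \<open>y\<close> is averaged explicitly by overwriting entry
  \<open>Suc m\<close>.\<close>

lemma one_step:
  fixes G :: "(nat \<Rightarrow> nat) \<Rightarrow> 'b::{banach, second_countable_topology}"
  assumes "determined (Suc m) G"
  shows "(\<integral>\<omega>. G (X \<omega>) \<partial>M) = (\<integral>\<omega>. (\<Sum>y\<le>m. pr (X \<omega>) m y *\<^sub>R G ((X \<omega>)(Suc m := y))) \<partial>M)"
proof -
  have "(\<integral>\<omega>. G (X \<omega>) \<partial>M) = (\<Sum>h\<in>histories (Suc m). prob (hist (Suc m) h) *\<^sub>R G h)"
    by (rule integral_determined[OF assms])
  also have "\<dots> = (\<Sum>(h, y)\<in>histories m \<times> {..m}. prob (hist (Suc m) (h(Suc m := y))) *\<^sub>R G (h(Suc m := y)))"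
    unfolding histories_Suc by (subst sum.reindex[OF inj_on_histories]) (simp add: case_prod_unfold)
  also have "\<dots> = (\<Sum>h\<in>histories m. \<Sum>y\<le>m. prob (hist (Suc m) (h(Suc m := y))) *\<^sub>R G (h(Suc m := y)))"
    by (rule sum.cartesian_product[symmetric])
  also have "\<dots> = (\<Sum>h\<in>histories m. prob (hist m h) *\<^sub>R (\<Sum>y\<le>m. pr h m y *\<^sub>R G (h(Suc m := y))))"
    by (simp add: prob_hist_Suc scaleR_sum_right)
  also have "\<dots> = (\<integral>\<omega>. (\<Sum>y\<le>m. pr (X \<omega>) m y *\<^sub>R G ((X \<omega>)(Suc m := y))) \<partial>M)"
    by (rule integral_determined[OF determined_step[OF assms], symmetric])
  finally show ?thesis .
qed

lemma supermartingale_step: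
  fixes V V' :: "(nat \<Rightarrow> nat) \<Rightarrow> real"
  assumes V': "determined (Suc m) V'" and V: "determined m V"
    and step: "\<And>x. parent_fun x \<Longrightarrow> (\<Sum>y\<le>m. pr x m y * V' (x(Suc m := y))) \<le> V x"
  shows "(\<integral>\<omega>. V' (X \<omega>) \<partial>M) \<le> (\<integral>\<omega>. V (X \<omega>) \<partial>M)"
proof -
  have "(\<integral>\<omega>. V' (X \<omega>) \<partial>M) = (\<integral>\<omega>. (\<Sum>y\<le>m. pr (X \<omega>) m y *\<^sub>R V' ((X \<omega>)(Suc m := y))) \<partial>M)"
    by (rule one_step[OF V'])
  also have "\<dots> \<le> (\<integral>\<omega>. V (X \<omega>) \<partial>M)"
    by (intro integral_mono integrable_determined[OF determined_step[OF V']] integrable_determined[OF V])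
       (use step parent_fun_X in auto)
  finally show ?thesis .
qed

text \<open>The event \<open>H\<close>, decided at the starting time, makes this an inequality conditional on the history.\<close>

lemma supermartingale:
  fixes V :: "nat \<Rightarrow> (nat \<Rightarrow> nat) \<Rightarrow> real"
  assumes V: "\<And>n. m \<le> n \<Longrightarrow> determined n (V n)" and H: "determined m H"
    and step: "\<And>n x. m \<le> n \<Longrightarrow> parent_fun x \<Longrightarrow> H x \<Longrightarrow> (\<Sum>y\<le>n. pr x n y * V (Suc n) (x(Suc n := y))) \<le> V n x"
    and n: "m \<le> n"
  shows "(\<integral>\<omega>. of_bool (H (X \<omega>)) * V n (X \<omega>) \<partial>M) \<le> (\<integral>\<omega>. of_bool (H (X \<omega>)) * V m (X \<omega>) \<partial>M)"
  using n
proof (induction n rule: dec_induct)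
  case (step n)
  have HV: "determined k (\<lambda>x. of_bool (H x) * V k x)" if "m \<le> k" for k
    using determined_mono[OF H that] V[OF that]
    by (rule determined_comp2)
  have "(\<integral>\<omega>. of_bool (H (X \<omega>)) * V (Suc n) (X \<omega>) \<partial>M) \<le> (\<integral>\<omega>. of_bool (H (X \<omega>)) * V n (X \<omega>) \<partial>M)"
  proof (rule supermartingale_step[where m = n and V' = "\<lambda>x. of_bool (H x) * V (Suc n) x"])
    fix x assume x: "parent_fun x"
    have "H (x(Suc n := y)) = H x" for y
      using step by (intro determinedD[OF H]) auto
    then show "(\<Sum>y\<le>n. pr x n y * (of_bool (H (x(Suc n := y))) * V (Suc n) (x(Suc n := y)))) \<le> of_bool (H x) * V n x"
      using assms(3)[of n x] step x by (cases "H x") auto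
  qed (use step HV in auto)
  then show ?case using step by simp
qed simp

end

section \<open>Counting events against the maximal degree\<close>

locale superlinear_GN = GN_parents M "\<lambda>d. (real d + 1) powr p" w T
  for M :: "'w measure" and w T and p :: real +
  assumes p: "1 < p"
begin

abbreviation f :: "nat \<Rightarrow> real" where
  "f d \<equiv> (real d + 1) powr p"

definition mx :: "(nat \<Rightarrow> nat) \<Rightarrow> nat \<Rightarrow> nat" where
  "mx x m = Max (deg x m ` {..m})"

text \<open>Up to a constant factor, \<open>g d\<close> is the tail \<open>\<Sum>i\<ge>d. 1 / f i\<close>, the expected time to explosion of a
  node of degree \<open>d\<close> in the continuous-time embedding.\<close>

definition g :: "nat \<Rightarrow> real" where
  "g d = 2 powr p / (p - 1) * (real d + 1) powr (1 - p)"

lemma g_pos: "0 < g d"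
  using p by (simp add: g_def)

text \<open>By the mean value theorem the difference is \<open>2 powr p * z powr (- p)\<close> with
  \<open>z\<close> below \<open>?a + 1\<close>, hence below \<open>2 * ?a\<close>. The factor
  \<open>2 powr p\<close> in \<open>g\<close> absorbs exactly this loss.\<close>

lemma g_diff: "1 / f d \<le> g d - g (Suc d)"
proof -
  let ?a = "real d + 1"
  have der: "((\<lambda>t. t powr (1 - p)) has_real_derivative (1 - p) * t powr (- p)) (at t)" if "?a \<le> t" for t
    using has_real_derivative_powr[of t "1 - p"] that by simp
  obtain z where z: "?a < z" "z < ?a + 1" 
    and eq: "(?a + 1) powr (1 - p) - ?a powr (1 - p) = (?a + 1 - ?a) * ((1 - p) * z powr (- p))"
    using MVT2[of ?a "?a + 1" "\<lambda>t. t powr (1 - p)" "\<lambda>t. (1 - p) * t powr (- p)"] der by force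
  have "(2 * ?a) powr (- p) \<le> z powr (- p)"
    using z p by (intro powr_mono2') auto
  then have "2 powr (- p) * ?a powr (- p) \<le> z powr (- p)" by (metis powr_mult)
  then have "?a powr (- p) \<le> 2 powr p * z powr (- p)"
    by (simp add: powr_minus field_simps)
  moreover have "g d - g (Suc d) = 2 powr p / (p - 1) * (?a powr (1 - p) - (?a + 1) powr (1 - p))"
    by (simp add: g_def algebra_simps)
  moreover have "?a powr (1 - p) - (?a + 1) powr (1 - p) = (p - 1) * z powr (- p)"
    using eq by (simp add: algebra_simps)
  ultimately have "g d - g (Suc d) = 2 powr p * z powr (- p)" using p by simp
  with \<open>?a powr (- p) \<le> 2 powr p * z powr (- p)\<close> show ?thesis
    by (simp add: powr_minus_divide)
qed

lemma g_antimono: "d \<le> e \<Longrightarrow> g e \<le> g d"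
  unfolding g_def using p by (intro mult_left_mono powr_mono2') auto

lemma deg_le_mx: "parent_fun x \<Longrightarrow> deg x m v \<le> mx x m"
  unfolding mx_def by (cases "v \<le> m") (auto simp: deg_unborn)

lemma mx_attained: obtains v where "v \<le> m" "deg x m v = mx x m"
  using Max_in[of "deg x m ` {..m}"] unfolding mx_def by fastforce

lemma mx_upd:
  assumes x: "parent_fun x" and y: "y \<le> m"
  shows "mx (x(Suc m := y)) (Suc m) = (if deg x m y = mx x m then Suc (mx x m) else mx x m)"
    (is "_ = ?r")
  unfolding mx_def[of "x(Suc m := y)"]
proof (rule Max_eqI)
  fix d assume "d \<in> deg (x(Suc m := y)) (Suc m) ` {..Suc m}"
  then obtain v where "d = deg x m v + (if v = y then 1 else 0)" by (auto simp: deg_upd)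
  then show "d \<le> ?r" using deg_le_mx[OF x, of m v] by (auto simp: le_less)
next
  obtain v where v: "v \<le> m" "deg x m v = mx x m" by (rule mx_attained)
  show "?r \<in> deg (x(Suc m := y)) (Suc m) ` {..Suc m}"
  proof (cases "deg x m y = mx x m")
    case True
    then show ?thesis using y by (intro image_eqI[where x = y]) (auto simp: deg_upd)
  next
    case False
    then show ?thesis using v by (intro image_eqI[where x = v]) (auto simp: deg_upd)
  qed
qed simp

lemma mx_mono: 
  assumes "parent_fun x" "m \<le> n" shows "mx x m \<le> mx x n"
  using assms(2)
proof (induction n rule: dec_induct)
  case (step n)
  have "mx x n \<le> mx (x(Suc n := x (Suc n))) (Suc n)"
    using assms(1) by (subst mx_upd) (auto simp: parent_fun_def)
  then show ?case using step by simp
qed simp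

lemma determined_mx: "determined m (\<lambda>x. mx x m)"
  unfolding mx_def using determined_deg by (rule determined_comp)

text \<open>Each weight loses its power \<open>p - 1\<close> to the maximal degree; the remaining
  linear weights add up to \<open>m\<close> edges plus \<open>m + 1\<close> nodes. Against
  \<open>f (mx x m)\<close> this leaves a rate of order \<open>mx x m / m\<close> for raising the
  maximal degree.\<close>

lemma wt_le:
  assumes x: "parent_fun x"
  shows "wt x m \<le> (real (mx x m) + 1) powr (p - 1) * (2 * real m + 1)"
proof -
  have "wt x m \<le> (\<Sum>v\<le>m. (real (mx x m) + 1) powr (p - 1) * (real (deg x m v) + 1))"
    unfolding wt_def
  proof (rule sum_mono)
    fix v
    have "f (deg x m v) = (real (deg x m v) + 1) powr (p - 1) * (real (deg x m v) + 1)"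
      by (simp add: powr_diff)
    also have "\<dots> \<le> (real (mx x m) + 1) powr (p - 1) * (real (deg x m v) + 1)"
      using deg_le_mx[OF x, of m v] p by (intro mult_right_mono powr_mono2) auto
    finally show "f (deg x m v) \<le> (real (mx x m) + 1) powr (p - 1) * (real (deg x m v) + 1)" .
  qed
  also have "\<dots> = (real (mx x m) + 1) powr (p - 1) * (real (\<Sum>v\<le>m. deg x m v) + (real m + 1))"
    by (simp add: sum_distrib_left[symmetric] sum.distrib)
  finally show ?thesis using sum_deg[OF x, of m] by (simp add: algebra_simps)
qed

lemma mx_le: "mx x m \<le> m"
  unfolding mx_def by (auto simp: deg_le)

lemma wt_le_powr: "parent_fun x \<Longrightarrow> wt x m \<le> (2 * real m + 1) powr p"
proof -
  assume x: "parent_fun x"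
  have "wt x m \<le> (real (mx x m) + 1) powr (p - 1) * (2 * real m + 1)" by (rule wt_le[OF x])
  also have "\<dots> \<le> (2 * real m + 1) powr (p - 1) * (2 * real m + 1)"
    using mx_le[of x m] p by (intro mult_right_mono powr_mono2) auto
  also have "\<dots> = (2 * real m + 1) powr p" by (simp add: powr_diff)
  finally show ?thesis .
qed

lemma sum_pr_mx: "f (mx x m) / wt x m \<le> (\<Sum>y\<le>m. pr x m y * of_bool (deg x m y = mx x m))"
proof -
  obtain v where v: "v \<le> m" "deg x m v = mx x m" by (rule mx_attained)
  have "pr x m v * of_bool (deg x m v = mx x m) \<le> (\<Sum>y\<le>m. pr x m y * of_bool (deg x m y = mx x m))"
    by (rule member_le_sum) (use v pr_nonneg in auto)
  then show ?thesis using v by (simp only: pr_def) simp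
qed

lemma power_diff_ge:
  fixes a b :: real
  assumes "0 \<le> b" "b \<le> a" 
  shows "a ^ e * (a - b) \<le> a ^ Suc e - b ^ Suc e"
proof -
  have "b * b ^ e \<le> b * a ^ e" using assms by (intro mult_left_mono power_mono) auto
  then show ?thesis by (simp add: algebra_simps)
qed

text \<open>While the counter is below \<open>s\<close>, it increases at a rate at most \<open>R\<close> times the rate \<open>1 / wt\<close>, at
  which the maximal degree lowers \<open>g\<close> by its own increase; so \<open>(R * g mx) ^ (s - c)\<close> is a supermartingale.\<close>

lemma counter_bound:
  fixes c :: "nat \<Rightarrow> (nat \<Rightarrow> nat) \<Rightarrow> nat" and B :: "nat \<Rightarrow> (nat \<Rightarrow> nat) \<Rightarrow> nat set"
  assumes c: "\<And>n. m \<le> n \<Longrightarrow> determined n (c n)"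
    and mono: "\<And>n x y. m \<le> n \<Longrightarrow> parent_fun x \<Longrightarrow> y \<le> n \<Longrightarrow> c n x \<le> c (Suc n) (x(Suc n := y))"
    and incr: "\<And>n x y. m \<le> n \<Longrightarrow> parent_fun x \<Longrightarrow> y \<le> n \<Longrightarrow>
      c (Suc n) (x(Suc n := y)) \<le> c n x + of_bool (y \<in> B n x)"
    and R: "\<And>n x. m \<le> n \<Longrightarrow> parent_fun x \<Longrightarrow> c n x < s \<Longrightarrow> (\<Sum>y\<in>{..n} \<inter> B n x. f (deg x n y)) \<le> R"
    and R0: "0 \<le> R"
    and H: "determined m H" 
    and start: "\<And>x. parent_fun x \<Longrightarrow> H x \<Longrightarrow> c m x = 0 \<and> g (mx x m) \<le> \<gamma>"
  shows "prob {\<omega>\<in>space M. H (X \<omega>) \<and> (\<exists>n\<ge>m. s \<le> c n (X \<omega>))}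
    \<le> prob {\<omega>\<in>space M. H (X \<omega>)} * (R * \<gamma>) ^ s"
proof -
  \<comment> \<open>Truncated subtraction freezes \<open>V\<close> at 1 once the counter has reached
    \<open>s\<close>; thus \<open>V\<close> dominates the indicator of that event.\<close>
  define V where "V n x = (R * g (mx x n)) ^ (s - c n x)" for n x
  have V: "determined n (V n)" if "m \<le> n" for n
    unfolding V_def using determined_mx c[OF that] by (rule determined_comp2)
  have step: "(\<Sum>y\<le>n. pr x n y * V (Suc n) (x(Suc n := y))) \<le> V n x"
    if n: "m \<le> n" and x: "parent_fun x" for n x
  proof (cases "s \<le> c n x")
    case True
    then have "V (Suc n) (x(Suc n := y)) = 1" if "y \<le> n" for y
      using mono[OF n x that] by (simp add: V_def)
    then have "(\<Sum>y\<le>n. pr x n y * V (Suc n) (x(Suc n := y))) = (\<Sum>y\<le>n. pr x n y)"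
      by (intro sum.cong) auto
    then show ?thesis using True by (simp add: sum_pr V_def)
  next
    case False
    define D where "D = mx x n"
    obtain e where e: "s - c n x = Suc e" using False by (metis Suc_diff_Suc not_le)
    define a where "a = R * g D"
    define b where "b = R * g (Suc D)"
    have ab: "0 \<le> b" "b \<le> a" "R / f D \<le> a - b"
      using g_diff[of D] g_pos[of "Suc D"] g_antimono[of D "Suc D"] mult_left_mono[OF g_diff[of D] R0] R0
      by (auto simp: a_def b_def intro: mult_left_mono simp: algebra_simps)
    \<comment> \<open>A bound linear in the two indicators, so that it can be averaged term by term.
      When the counter moves, the exponent drops to \<open>e\<close>, and \<open>a ^ e\<close> alone
      would do; keeping \<open>a ^ Suc e\<close> as well lets the last term be subtracted in every
      case.\<close>
    have V': "V (Suc n) (x(Suc n := y)) \<le> a ^ Suc e + of_bool (y \<in> B n x) * a ^ e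
        - of_bool (deg x n y = D) * (a ^ Suc e - b ^ Suc e)" if y: "y \<le> n" for y
    proof -
      let ?c = "c (Suc n) (x(Suc n := y))" and ?a = "if deg x n y = D then b else a"
      have V': "V (Suc n) (x(Suc n := y)) = ?a ^ (s - ?c)"
        using mx_upd[OF x y] by (auto simp: V_def D_def a_def b_def)
      have a: "?a ^ Suc e = a ^ Suc e - of_bool (deg x n y = D) * (a ^ Suc e - b ^ Suc e)"
        by simp
      consider "?c = c n x" | "y \<in> B n x" "?c = Suc (c n x)"
        using mono[OF n x y] incr[OF n x y] by (cases "y \<in> B n x") (auto simp: le_Suc_eq)
      then show ?thesis
      proof cases
        case 1
        then have "V (Suc n) (x(Suc n := y)) = ?a ^ Suc e" using V' e by simp
        moreover have "0 \<le> of_bool (y \<in> B n x) * a ^ e" using ab by simp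
        ultimately show ?thesis using a by linarith
      next
        case 2
        then have "s - ?c = e" using e by linarith
        then have "V (Suc n) (x(Suc n := y)) = ?a ^ e" using V' by simp
        moreover have "?a ^ e \<le> a ^ e" using ab by (intro power_mono) auto
        moreover have "0 \<le> ?a ^ Suc e" using ab by (intro zero_le_power) auto
        ultimately show ?thesis using a 2 by simp
      qed
    qed
    have prD: "f D / wt x n \<le> (\<Sum>y\<le>n. pr x n y * of_bool (deg x n y = D))"
      unfolding D_def by (rule sum_pr_mx)
    have "(\<Sum>y\<le>n. pr x n y * of_bool (y \<in> B n x)) = (\<Sum>y\<in>{..n} \<inter> B n x. pr x n y)"
      by (simp add: sum.inter_restrict of_bool_def if_distrib cong: if_cong)
    also have "\<dots> = (\<Sum>y\<in>{..n} \<inter> B n x. f (deg x n y)) / wt x n"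
      by (simp add: pr_def sum_divide_distrib)
    also have "\<dots> \<le> R / wt x n"
      using R[OF n x] False wt_pos[of x n] by (intro divide_right_mono) auto
    finally have prB: "(\<Sum>y\<le>n. pr x n y * of_bool (y \<in> B n x)) \<le> R / wt x n" .
    have "(\<Sum>y\<le>n. pr x n y * V (Suc n) (x(Suc n := y))) \<le>
      (\<Sum>y\<le>n. pr x n y * (a ^ Suc e + of_bool (y \<in> B n x) * a ^ e
        - of_bool (deg x n y = D) * (a ^ Suc e - b ^ Suc e)))"
      using V' pr_nonneg by (intro sum_mono mult_left_mono) auto
    also have "\<dots> = a ^ Suc e * (\<Sum>y\<le>n. pr x n y) + a ^ e * (\<Sum>y\<le>n. pr x n y * of_bool (y \<in> B n x))
      - (a ^ Suc e - b ^ Suc e) * (\<Sum>y\<le>n. pr x n y * of_bool (deg x n y = D))"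
      by (simp add: sum_distrib_left sum.distrib sum_subtractf algebra_simps del: sum_mult_of_bool_eq sum_of_bool_mult_eq)
    \<comment> \<open>Loss \<open>a ^ e\<close> at rate at most \<open>R / wt\<close> against gain
      \<open>a ^ e * (R / f D)\<close> at rate at least \<open>f D / wt\<close>: the two cancel
      whatever the total weight is.\<close>
    also have "\<dots> \<le> a ^ Suc e + a ^ e * (R / wt x n) - (a ^ e * (R / f D)) * (f D / wt x n)"
    proof -
      have ae: "0 \<le> a ^ e" using ab by simp
      have "a ^ e * (R / f D) \<le> a ^ Suc e - b ^ Suc e"
        using power_diff_ge[OF ab(1,2), of e] mult_left_mono[OF ab(3) ae] by linarith
      moreover have "0 \<le> a ^ Suc e - b ^ Suc e"
        using power_mono[OF ab(2,1), of "Suc e"] by linarith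
      moreover have "0 \<le> f D / wt x n" using wt_pos[of x n] by (intro divide_nonneg_pos) auto
      ultimately have "(a ^ e * (R / f D)) * (f D / wt x n)
          \<le> (a ^ Suc e - b ^ Suc e) * (\<Sum>y\<le>n. pr x n y * of_bool (deg x n y = D))"
        using prD by (intro mult_mono)
      moreover have "a ^ e * (\<Sum>y\<le>n. pr x n y * of_bool (y \<in> B n x)) \<le> a ^ e * (R / wt x n)"
        by (rule mult_left_mono[OF prB ae])
      ultimately show ?thesis unfolding sum_pr by linarith
    qed
    also have "\<dots> = a ^ Suc e"
    proof -
      have cancel: "(A * (R / F)) * (F / W) = A * (R / W)" if "F \<noteq> 0" for A F W :: real
        using that by simp
      show ?thesis by (subst cancel) auto
    qed
    also have "\<dots> = V n x" by (simp only: V_def e a_def D_def)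
    finally show ?thesis .
  qed
  have bound: "prob {\<omega>\<in>space M. H (X \<omega>) \<and> s \<le> c n (X \<omega>)} \<le> prob {\<omega>\<in>space M. H (X \<omega>)} * (R * \<gamma>) ^ s"
    if n: "m \<le> n" for n
  proof -
    have HV: "integrable M (\<lambda>\<omega>. of_bool (H (X \<omega>)) * V k (X \<omega>))" if "m \<le> k" for k
      by (rule integrable_determined[OF determined_comp2[OF determined_mono[OF H that] V[OF that],
            of "\<lambda>h v. of_bool h * v"]])
    have sets: "{\<omega>\<in>space M. H (X \<omega>) \<and> s \<le> c n (X \<omega>)} \<in> sets M"
      by (rule determined_sets[OF determined_comp2[OF determined_mono[OF H n] c[OF n], of "\<lambda>h c. h \<and> s \<le> c"]])
    have setsH: "{\<omega>\<in>space M. H (X \<omega>)} \<in> sets M" by (rule determined_sets[OF H])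
    have "prob {\<omega>\<in>space M. H (X \<omega>) \<and> s \<le> c n (X \<omega>)}
      = (\<integral>\<omega>. indicator {\<omega>\<in>space M. H (X \<omega>) \<and> s \<le> c n (X \<omega>)} \<omega> \<partial>M)"
      using sets by simp
    also have "\<dots> \<le> (\<integral>\<omega>. of_bool (H (X \<omega>)) * V n (X \<omega>) \<partial>M)"
    proof (rule integral_mono[OF integrable_real_indicator[OF sets] HV[OF n]])
      fix \<omega>
      show "indicator {\<omega>\<in>space M. H (X \<omega>) \<and> s \<le> c n (X \<omega>)} \<omega> \<le> of_bool (H (X \<omega>)) * V n (X \<omega>)"
        using R0 g_pos by (auto simp: indicator_def V_def less_imp_le)
    qed (simp add: less_top[symmetric])
    also have "\<dots> \<le> (\<integral>\<omega>. of_bool (H (X \<omega>)) * V m (X \<omega>) \<partial>M)"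
      by (rule supermartingale[OF V H step n])
    also have "\<dots> \<le> (\<integral>\<omega>. indicator {\<omega>\<in>space M. H (X \<omega>)} \<omega> * (R * \<gamma>) ^ s \<partial>M)"
    proof (intro integral_mono HV)
      show "integrable M (\<lambda>\<omega>. indicator {\<omega>\<in>space M. H (X \<omega>)} \<omega> * (R * \<gamma>) ^ s)"
        using setsH by (intro integrable_mult_left integrable_real_indicator) (auto simp: less_top[symmetric])
      fix \<omega> assume "\<omega> \<in> space M"
      then show "of_bool (H (X \<omega>)) * V m (X \<omega>) \<le> indicator {\<omega>\<in>space M. H (X \<omega>)} \<omega> * (R * \<gamma>) ^ s"
        using start[OF parent_fun_X, of \<omega>] R0 g_pos[of "mx (X \<omega>) m"]
        by (auto simp: V_def intro!: power_mono mult_left_mono)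
    qed simp
    finally show ?thesis using setsH by simp
  qed
  \<comment> \<open>The bound holds uniformly in \<open>n\<close>, and the events increase with
    \<open>n\<close> since the counter is monotone; continuity from below gives the event for all
    times.\<close>
  let ?A = "\<lambda>n. {\<omega>\<in>space M. H (X \<omega>) \<and> s \<le> c (m + n) (X \<omega>)}"
  have "incseq ?A"
  proof (rule incseq_SucI, safe)
    fix n \<omega> assume "\<omega> \<in> space M" "s \<le> c (m + n) (X \<omega>)"
    moreover have "c (m + n) (X \<omega>) \<le> c (Suc (m + n)) ((X \<omega>)(Suc (m + n) := X \<omega> (Suc (m + n))))"
      using parent_fun_X[OF \<open>\<omega> \<in> space M\<close>] by (intro mono) (auto simp: parent_fun_def)
    ultimately show "s \<le> c (m + Suc n) (X \<omega>)" by simp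
  qed
  moreover have "?A n \<in> sets M" for n
    by (rule determined_sets[OF determined_comp2[OF determined_mono[OF H, of "m + n"] c[of "m + n"],
          of "\<lambda>h c. h \<and> s \<le> c"]]) auto
  ultimately have "(\<lambda>n. prob (?A n)) \<longlonglongrightarrow> prob (\<Union>n. ?A n)"
    by (intro finite_Lim_measure_incseq) auto
  then have "prob (\<Union>n. ?A n) \<le> prob {\<omega>\<in>space M. H (X \<omega>)} * (R * \<gamma>) ^ s"
    by (rule LIMSEQ_le_const2) (use bound in auto)
  moreover have "(\<Union>n. ?A n) = {\<omega>\<in>space M. H (X \<omega>) \<and> (\<exists>n\<ge>m. s \<le> c n (X \<omega>))}"
    by (auto simp: le_iff_add)
  ultimately show ?thesis by simp
qed

end

section \<open>Descendants of a node\<close>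

text \<open>The descendants of \<open>v\<close> are kept as a list in order of birth, empty before
  \<open>v\<close> is born. Positions in the list name the nodes, which makes shapes comparable with
  codes.\<close>

primrec family :: "(nat \<Rightarrow> nat) \<Rightarrow> nat \<Rightarrow> nat \<Rightarrow> nat list" where
  "family x v 0 = (if v = 0 then [0] else [])"
| "family x v (Suc m) = (if Suc m = v then [v]
     else if x (Suc m) \<in> set (family x v m) then family x v m @ [Suc m] else family x v m)"

definition big :: "nat \<Rightarrow> (nat \<Rightarrow> nat) \<Rightarrow> nat \<Rightarrow> bool" where
  "big k x v \<longleftrightarrow> (\<exists>n. k < length (family x v n))"

lemma determined_family: "determined m (\<lambda>x. family x v m)"
proof (rule determinedI)
  fix x y :: "nat \<Rightarrow> nat" assume "\<And>j. 1 \<le> j \<Longrightarrow> j \<le> m \<Longrightarrow> x j = y j"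
  then show "family x v m = family y v m" by (induction m) auto
qed

lemma family_unborn: "m < v \<Longrightarrow> family x v m = []"
  by (induction m) auto

lemma family_birth: "family x v v = [v]"
  by (cases v) auto

lemma family_range: "set (family x v m) \<subseteq> {v..m}"
proof (induction m)
  case (Suc m)
  show ?case
  proof (cases "m < v")
    case True
    then show ?thesis by (simp add: family_unborn)
  next
    case False
    then show ?thesis using Suc by auto
  qed
qed auto

lemma distinct_family: "distinct (family x v m)"
proof (induction m)
  case (Suc m)
  have "Suc m \<notin> set (family x v m)" using family_range[of x v m] by auto
  then show ?case using Suc by auto
qed auto

lemma family_upd: "family (x(Suc m := y)) v (Suc m) = (if Suc m = v then [v]
     else if y \<in> set (family x v m) then family x v m @ [Suc m] else family x v m)"
proof -
  have "family (x(Suc m := y)) v m = family x v m"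
    by (rule determinedD[OF determined_family]) auto
  then show ?thesis by simp
qed

lemma family_extends: "m \<le> n \<Longrightarrow> v \<le> m \<Longrightarrow> \<exists>ys. family x v n = family x v m @ ys"
  by (induction n rule: dec_induct) auto

lemma length_family_mono: "m \<le> n \<Longrightarrow> length (family x v m) \<le> length (family x v n)"
  using family_extends[of m n v x] family_unborn[of m v x] by (cases "v \<le> m") auto

lemma set_family_mono: "m \<le> n \<Longrightarrow> set (family x v m) \<subseteq> set (family x v n)"
  using family_extends[of m n v x] family_unborn[of m v x] by (cases "v \<le> m") auto

lemma family_hd: "v \<le> m \<Longrightarrow> \<exists>ys. family x v m = v # ys"
  using family_extends[of v m v x] family_birth[of x v] by auto

lemma family_self: "v \<le> m \<Longrightarrow> v \<in> set (family x v m)"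
  using family_hd[of v m x] by auto

lemma family_child:
  assumes x: "parent_fun x" and "1 \<le> j" "j \<le> m" "x j \<in> set (family x v m)"
  shows "j \<in> set (family x v m)"
  using assms(2-)
proof (induction m)
  case (Suc m)
  have lt: "x j < j" using parent_funD[OF x] Suc.prems by simp
  show ?case
  proof (cases "Suc m = v")
    case True
    then show ?thesis using Suc.prems lt by auto
  next
    case False
    then have mem: "x j \<in> set (family x v m)"
      using Suc.prems lt by (auto split: if_splits)
    show ?thesis
    proof (cases "j = Suc m")
      case True
      then show ?thesis using mem False by auto
    next
      case j: False
      then have "j \<in> set (family x v m)" using Suc.IH Suc.prems mem by auto
      then show ?thesis using False by auto
    qed
  qed
qed auto

text \<open>All children of a family member belong to the family, and none of them is its founder
  \<open>v\<close>.\<close>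

lemma deg_family:
  assumes x: "parent_fun x" and y: "y \<in> set (family x v m)"
  shows "deg x m y < length (family x v m)"
proof -
  have y': "v \<le> y" "y \<le> m" using y family_range[of x v m] by auto
  have "{j \<in> {1..m}. x j = y} \<subseteq> set (family x v m) - {v}"
  proof
    fix j assume "j \<in> {j \<in> {1..m}. x j = y}"
    then have j: "1 \<le> j" "j \<le> m" "x j = y" by auto
    then have "y < j" using parent_funD[OF x, of j] by simp
    moreover have "j \<in> set (family x v m)" using family_child[OF x j(1,2)] j(3) y by simp
    ultimately show "j \<in> set (family x v m) - {v}" using y' by simp
  qed
  then have "deg x m y \<le> card (set (family x v m) - {v})"
    unfolding deg_def by (intro card_mono) auto
  also have "\<dots> < card (set (family x v m))"
    using family_self[of v m x] y' by (intro card_Diff1_less) auto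
  also have "\<dots> = length (family x v m)" by (rule distinct_card[OF distinct_family])
  finally show ?thesis .
qed

context GN_parents
begin

lemma determined_measurable:
  fixes G :: "(nat \<Rightarrow> nat) \<Rightarrow> 'c"
  assumes "determined m G"
  shows "(\<lambda>\<omega>. G (X \<omega>)) \<in> measurable M (count_space UNIV)"
proof (rule measurableI)
  fix A :: "'c set"
  have "{\<omega>\<in>space M. G (X \<omega>) \<in> A} \<in> sets M"
    by (rule determined_sets[OF determined_comp[OF assms, of "\<lambda>y. y \<in> A"]])
  then show "(\<lambda>\<omega>. G (X \<omega>)) -` A \<inter> space M \<in> sets M"
    by (simp add: vimage_def Int_def conj_commute)
qed simp

lemma deg_measurable [measurable]: "(\<lambda>\<omega>. deg (X \<omega>) m v) \<in> measurable M (count_space UNIV)"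
  by (rule determined_measurable[OF determined_comp[OF determined_deg, where F = "\<lambda>d. d v"]])

lemma family_measurable [measurable]: "(\<lambda>\<omega>. family (X \<omega>) v m) \<in> measurable M (count_space UNIV)"
  by (rule determined_measurable[OF determined_family])

lemma big_measurable [measurable]: "Measurable.pred M (\<lambda>\<omega>. big k (X \<omega>) v)"
  unfolding big_def by measurable

end

context superlinear_GN
begin

lemma mx_measurable [measurable]: "(\<lambda>\<omega>. mx (X \<omega>) m) \<in> measurable M (count_space UNIV)"
  by (rule determined_measurable[OF determined_mx])

lemma family_weight:
  assumes x: "parent_fun x" and l: "length (family x v n) \<le> K" "0 < K"
  shows "(\<Sum>y\<in>set (family x v n). f (deg x n y)) \<le> real K powr (p + 1)"
proof -
  have "(\<Sum>y\<in>set (family x v n). f (deg x n y)) \<le> (\<Sum>y\<in>set (family x v n). real K powr p)"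
  proof (intro sum_mono powr_mono2)
    fix y assume "y \<in> set (family x v n)"
    from deg_family[OF x this] show "real (deg x n y) + 1 \<le> real K" using l by linarith
  qed (use p in auto)
  also have "\<dots> \<le> real K * real K powr p"
    using card_length[of "family x v n"] l by (auto intro!: mult_right_mono)
  also have "\<dots> = real K powr (p + 1)" using l by (simp add: powr_add)
  finally show ?thesis .
qed

text \<open>The counter is the number of nodes beyond \<open>a\<close>. As long as it is below
  \<open>s\<close>, the family has at most \<open>a + s\<close> nodes of smaller degree, so its
  weight is bounded and \<open>counter_bound\<close> applies.\<close>

lemma family_bound:
  assumes v: "v \<le> m" and H: "determined m H"
    and start: "\<And>x. parent_fun x \<Longrightarrow> H x \<Longrightarrow> length (family x v m) \<le> a \<and> g (mx x m) \<le> \<gamma>"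
  shows "prob {\<omega>\<in>space M. H (X \<omega>) \<and> (\<exists>n\<ge>m. a + s \<le> length (family (X \<omega>) v n))}
    \<le> prob {\<omega>\<in>space M. H (X \<omega>)} * (real (a + s) powr (p + 1) * \<gamma>) ^ s"
proof (cases s)
  \<comment> \<open>Separate because \<open>s \<le> l - a\<close> and \<open>a + s \<le> l\<close>
    differ for \<open>s = 0\<close> under truncated subtraction.\<close>
  case 0
  have "prob {\<omega>\<in>space M. H (X \<omega>) \<and> (\<exists>n\<ge>m. a + s \<le> length (family (X \<omega>) v n))}
    \<le> prob {\<omega>\<in>space M. H (X \<omega>)}"
    by (rule finite_measure_mono) (use determined_sets[OF H] in auto)
  then show ?thesis using 0 by simp
next
  case (Suc s')
  let ?K = "real (a + s)"
  have "prob {\<omega>\<in>space M. H (X \<omega>) \<and> (\<exists>n\<ge>m. s \<le> length (family (X \<omega>) v n) - a)}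
    \<le> prob {\<omega>\<in>space M. H (X \<omega>)} * (?K powr (p + 1) * \<gamma>) ^ s"
  proof (rule counter_bound[where B = "\<lambda>n x. set (family x v n)"])
    fix n
    show "determined n (\<lambda>x. length (family x v n) - a)"
      by (rule determined_comp[OF determined_family])
    fix x assume n: "m \<le> n" and x: "parent_fun x"
    show "length (family x v n) - a \<le> length (family (x(Suc n := y)) v (Suc n)) - a"
      "length (family (x(Suc n := y)) v (Suc n)) - a
         \<le> length (family x v n) - a + of_bool (y \<in> set (family x v n))" for y
      unfolding family_upd using n v by auto
    assume "length (family x v n) - a < s"
    then have l: "length (family x v n) \<le> a + s" by linarith
    have "{..n} \<inter> set (family x v n) = set (family x v n)" using family_range[of x v n] by auto
    then show "(\<Sum>y\<in>{..n} \<inter> set (family x v n). f (deg x n y)) \<le> ?K powr (p + 1)"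
      using family_weight[OF x l] Suc by simp
  next
    fix x assume "parent_fun x" "H x"
    from start[OF this] show "length (family x v m) - a = 0 \<and> g (mx x m) \<le> \<gamma>" by simp
  qed (use H in auto)
  moreover have "s \<le> l - a \<longleftrightarrow> a + s \<le> l" for l using Suc by auto
  ultimately show ?thesis by simp
qed

text \<open>At its birth a family has one node, so exceeding \<open>k\<close> means gaining
  \<open>k\<close> further nodes. This is the origin of the exponent \<open>k\<close>.\<close>

lemma big_birth_bound:
  assumes H: "determined t H"
    and start: "\<And>x. parent_fun x \<Longrightarrow> H x \<Longrightarrow> g (mx x t) \<le> \<gamma>"
  shows "prob {\<omega>\<in>space M. H (X \<omega>) \<and> big k (X \<omega>) t}
    \<le> prob {\<omega>\<in>space M. H (X \<omega>)} * (real (Suc k) powr (p + 1) * \<gamma>) ^ k"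
proof -
  have "big k x t \<longleftrightarrow> (\<exists>n\<ge>t. 1 + k \<le> length (family x t n))" for x
    unfolding big_def using length_family_mono
    by (metis Suc_eq_plus1_left Suc_le_eq family_unborn le_cases list.size(3) not_less_zero linorder_not_le)
  then show ?thesis
    using family_bound[of t t H 1 \<gamma> k] H start by (simp add: family_birth)
qed

text \<open>The child that \<open>u\<close> receives at degree \<open>i\<close> is born at a random
  time \<open>t\<close>. The event is split over \<open>t\<close>; on each piece the maximal degree
  at time \<open>t\<close> is at least \<open>i\<close>, so the bound is the same for all pieces.
  The event \<open>H\<close> is carried along to keep the estimate conditional on an initial
  history.\<close>

lemma big_child_bound:
  assumes H: "determined m H"
  shows "prob {\<omega>\<in>space M. H (X \<omega>) \<and> (\<exists>t. m < t \<and> X \<omega> t = u \<and> deg (X \<omega>) (t - 1) u = i \<and> big k (X \<omega>) t)}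
    \<le> prob {\<omega>\<in>space M. H (X \<omega>)} * (real (Suc k) powr (p + 1) * g i) ^ k" (is "prob ?B \<le> _ * ?q")
proof -
  define H' where "H' t x \<longleftrightarrow> H x \<and> m < t \<and> x t = u \<and> deg x (t - 1) u = i" for t x
  have sH: "Measurable.pred M (\<lambda>\<omega>. H (X \<omega>))" using determined_sets[OF H] by (simp add: pred_def)
  note sH[measurable]
  have det: "determined t (H' t)" for t
  proof (cases "m < t")
    case True
    show ?thesis
    proof (rule determinedI)
      fix x y :: "nat \<Rightarrow> nat" assume eq: "\<And>j. 1 \<le> j \<Longrightarrow> j \<le> t \<Longrightarrow> x j = y j"
      have "H x = H y" by (rule determinedD[OF H]) (use eq True in auto)
      moreover have "deg x (t - 1) = deg y (t - 1)" by (rule determinedD[OF determined_deg]) (use eq in auto)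
      ultimately show "H' t x = H' t y" using eq[of t] True by (simp add: H'_def)
    qed
  qed (simp add: H'_def determined_def)
  let ?A = "\<lambda>t. {\<omega>\<in>space M. H' t (X \<omega>)}"
  have q: "0 \<le> ?q" using g_pos by (simp add: less_imp_le)
  have A: "?A t \<in> sets M" for t by (rule determined_sets[OF det])
  \<comment> \<open>The degree of \<open>u\<close> is larger after \<open>t\<close>, so it equals
    \<open>i\<close> just before at most one attachment to \<open>u\<close>.\<close>
  have "disjoint_family ?A"
  proof -
    have "\<not> (H' t x \<and> H' t' x)" if "t < t'" for t t' x
    proof
      assume *: "H' t x \<and> H' t' x"
      then have "Suc (deg x (t - 1) u) = deg x t u" by (cases t) (auto simp: H'_def deg_Suc)
      also have "\<dots> \<le> deg x (t' - 1) u" using that by (intro deg_mono) auto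
      finally show False using * by (simp add: H'_def)
    qed
    then have "\<not> (H' t x \<and> H' t' x)" if "t \<noteq> t'" for t t' x
      using that by (metis linorder_neqE_nat)
    then show ?thesis by (auto simp: disjoint_family_on_def)
  qed
  then have sums: "(\<lambda>t. prob (?A t)) sums prob (\<Union>t. ?A t)"
    using A by (intro finite_measure_UNION) auto
  have bound: "prob {\<omega>\<in>space M. H' t (X \<omega>) \<and> big k (X \<omega>) t} \<le> prob (?A t) * ?q" for t
  proof (rule big_birth_bound[OF det])
    fix x assume x: "parent_fun x" and "H' t x"
    then have t: "t = Suc (t - 1)" and H': "x t = u" "deg x (t - 1) u = i" by (auto simp: H'_def)
    have "i \<le> deg x t u" using H' deg_mono[of "t - 1" t x u] by simp
    also have "\<dots> \<le> mx x t" by (rule deg_le_mx[OF x])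
    finally show "g (mx x t) \<le> g i" by (rule g_antimono)
  qed
  have C: "{\<omega>\<in>space M. H' t (X \<omega>) \<and> big k (X \<omega>) t} \<in> sets M" for t
    unfolding H'_def by measurable
  have sums': "(\<lambda>t. prob (?A t) * ?q) sums (prob (\<Union>t. ?A t) * ?q)"
    by (rule sums_mult2[OF sums])
  have sm: "summable (\<lambda>t. prob {\<omega>\<in>space M. H' t (X \<omega>) \<and> big k (X \<omega>) t})"
    by (rule summable_comparison_test'[OF sums_summable[OF sums'], of 0]) (use bound in auto)
  have "?B = (\<Union>t. {\<omega>\<in>space M. H' t (X \<omega>) \<and> big k (X \<omega>) t})" by (auto simp: H'_def)
  then have "prob ?B \<le> (\<Sum>t. prob {\<omega>\<in>space M. H' t (X \<omega>) \<and> big k (X \<omega>) t})"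
    using C sm by (auto intro!: finite_measure_subadditive_countably)
  also have "\<dots> \<le> prob (\<Union>t. ?A t) * ?q"
    using suminf_le[OF bound sm sums_summable[OF sums']] sums_unique[OF sums'] by simp
  also have "\<dots> \<le> prob {\<omega>\<in>space M. H (X \<omega>)} * ?q"
    by (intro mult_right_mono finite_measure_mono q) (auto simp: H'_def)
  finally show ?thesis .
qed

lemma g_power: "(C * g i) ^ k = (C * (2 powr p / (p - 1))) ^ k * (real i + 1) powr (- ((p - 1) * real k))"
proof -
  have "((real i + 1) powr (1 - p)) ^ k = (real i + 1) powr (real k * (1 - p))" by (simp add: powr_power)
  also have "real k * (1 - p) = - ((p - 1) * real k)" by (simp add: algebra_simps)
  finally show ?thesis unfolding g_def mult.assoc[symmetric] by (simp add: power_mult_distrib power_divide)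
qed

lemma summable_shifted_powr: "1 < a \<Longrightarrow> summable (\<lambda>i. (real i + 1) powr (- a))"
  using summable_Suc_iff[of "\<lambda>i. real i powr (- a)"] by (simp add: summable_real_powr_iff add.commute)

lemma summable_g_power: "1 < (p - 1) * real k \<Longrightarrow> summable (\<lambda>i. (C * g i) ^ k)"
  unfolding g_power by (intro summable_mult summable_shifted_powr)

text \<open>Borel-Cantelli over the birth index \<open>i\<close>: the bound is of order
  \<open>i\<close> to the power \<open>- (p - 1) * k\<close>, summable exactly by the hypothesis on
  \<open>k\<close>.\<close>

lemma AE_finite_big_children:
  assumes k: "1 < (p - 1) * real k"
  shows "AE \<omega> in M. \<forall>u. finite {t. 0 < t \<and> X \<omega> t = u \<and> big k (X \<omega>) t}"
  unfolding AE_all_countable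
proof
  fix u
  let ?B = "\<lambda>i. {\<omega>\<in>space M. \<exists>t. 0 < t \<and> X \<omega> t = u \<and> deg (X \<omega>) (t - 1) u = i \<and> big k (X \<omega>) t}"
  have bound: "prob (?B i) \<le> (real (Suc k) powr (p + 1) * g i) ^ k" for i
    using big_child_bound[of 0 "\<lambda>_. True" u i k] by (simp add: prob_space)
  have "AE \<omega> in M. eventually (\<lambda>i. \<omega> \<in> space M - ?B i) sequentially"
  proof (rule borel_cantelli_AE1)
    show "?B i \<in> sets M" for i by measurable
    show "emeasure M (?B i) < \<infinity>" for i by (simp add: emeasure_eq_measure)
    show "summable (\<lambda>i. measure M (?B i))"
      by (rule summable_comparison_test'[OF summable_g_power[OF k, of "real (Suc k) powr (p + 1)"], of 0])
         (use bound in auto)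
  qed
  then show "AE \<omega> in M. finite {t. 0 < t \<and> X \<omega> t = u \<and> big k (X \<omega>) t}"
  proof (rule AE_mp, intro AE_I2 impI)
    fix \<omega> assume "\<omega> \<in> space M" and ev: "eventually (\<lambda>i. \<omega> \<in> space M - ?B i) sequentially"
    let ?S = "{t. 0 < t \<and> X \<omega> t = u \<and> big k (X \<omega>) t}"
    obtain N where N: "\<And>i. N \<le> i \<Longrightarrow> \<omega> \<notin> ?B i" using ev by (auto simp: eventually_sequentially)
    \<comment> \<open>Children of \<open>u\<close> are told apart by their birth index, so finitely
      many indices mean finitely many children.\<close>
    have "deg (X \<omega>) (t - 1) u < deg (X \<omega>) (t' - 1) u" if "t < t'" "t \<in> ?S" for t t'
    proof -
      have "Suc (deg (X \<omega>) (t - 1) u) = deg (X \<omega>) t u" using that by (cases t) (auto simp: deg_Suc)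
      also have "\<dots> \<le> deg (X \<omega>) (t' - 1) u" using that by (intro deg_mono) auto
      finally show ?thesis by simp
    qed
    then have "inj_on (\<lambda>t. deg (X \<omega>) (t - 1) u) ?S"
      by (intro linorder_inj_onI) force+
    moreover have "(\<lambda>t. deg (X \<omega>) (t - 1) u) ` ?S \<subseteq> {..<N}"
      using N \<open>\<omega> \<in> space M\<close> by (force simp: not_less[symmetric])
    ultimately show "finite ?S" using finite_imageD finite_subset by blast
  qed
qed

end

section \<open>Growth of the maximal degree\<close>

definition hub :: "(nat \<Rightarrow> nat) \<Rightarrow> nat \<Rightarrow> bool" where
  "hub x u \<longleftrightarrow> (\<forall>N. \<exists>m. N \<le> deg x m u)"

lemma hub_deg_at_top: "hub x u \<Longrightarrow> filterlim (\<lambda>m. deg x m u) at_top sequentially"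
  unfolding filterlim_at_top eventually_sequentially hub_def by (meson deg_mono order_trans)

lemma not_hub_deg_const: 
  assumes "\<not> hub x u"
  obtains d where "eventually (\<lambda>m. deg x m u = d) sequentially" "\<And>m. deg x m u \<le> d"
proof -
  obtain N where N: "\<And>m. deg x m u < N" using assms by (auto simp: hub_def not_le)
  define d where "d = Max (range (\<lambda>m. deg x m u))"
  have fin: "finite (range (\<lambda>m. deg x m u))" by (rule finite_subset[of _ "{..<N}"]) (use N in auto)
  have le: "deg x m u \<le> d" for m unfolding d_def using fin by auto
  obtain m where "deg x m u = d" using Max_in[OF fin] unfolding d_def by auto
  then have "deg x n u = d" if "m \<le> n" for n using deg_mono[OF that, of x u] le[of n] by simp
  then show ?thesis using that[of d] le by (auto simp: eventually_sequentially)
qed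

context superlinear_GN
begin

text \<open>With \<open>D\<close> the maximal degree plus one, \<open>1 / D\<close> falls by
  \<open>1 / (D * (D + 1))\<close> at rate at least \<open>D / (2 * m + 1)\<close>. Its mean thus
  shrinks by the factor \<open>1 - 1 / (4 * m + 2)\<close> in each step, and the product of these
  factors decays like the power \<open>-1/4\<close> of \<open>m\<close>.\<close>

lemma mx_growth: "(\<integral>\<omega>. 1 / (real (mx (X \<omega>) m) + 1) \<partial>M) \<le> (real m + 1) powr (- (1/4))"
proof (induction m)
  case 0
  have "(\<integral>\<omega>. 1 / (real (mx (X \<omega>) 0) + 1) \<partial>M) = 1" by (simp add: mx_def prob_space)
  then show ?case by simp
next
  case (Suc m)
  define V where "V n x = 1 / (real (mx x n) + 1)" for x :: "nat \<Rightarrow> nat" and n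
  have V: "determined n (V n)" for n unfolding V_def by (rule determined_comp[OF determined_mx])
  define t where "t = 1 / (4 * real m + 2)"
  have t: "0 < t" "t < 1" by (auto simp: t_def field_simps)
  have "(\<integral>\<omega>. V (Suc m) (X \<omega>) \<partial>M) \<le> (\<integral>\<omega>. (1 - t) * V m (X \<omega>) \<partial>M)"
  proof (rule supermartingale_step[OF V determined_comp[OF V]])
    fix x assume x: "parent_fun x"
    define D where "D = real (mx x m) + 1"
    have D: "1 \<le> D" by (simp add: D_def)
    let ?s = "\<Sum>y\<le>m. pr x m y * of_bool (deg x m y = mx x m)"
    have "D / (2 * real m + 1) = D powr p / (D powr (p - 1) * (2 * real m + 1))"
      using D by (simp add: powr_diff)
    also have "\<dots> \<le> D powr p / wt x m"
      using wt_le[OF x, of m] wt_pos[of x m] D unfolding D_def by (intro divide_left_mono) auto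
    also have "\<dots> \<le> ?s"
      using sum_pr_mx[of x m] by (simp add: D_def)
    finally have s: "D / (2 * real m + 1) \<le> ?s" .
    have "(\<Sum>y\<le>m. pr x m y * V (Suc m) (x(Suc m := y)))
      = (\<Sum>y\<le>m. pr x m y * (1 / D - of_bool (deg x m y = mx x m) * (1 / D - 1 / (D + 1))))"
      by (intro sum.cong refl) (auto simp: V_def mx_upd[OF x] D_def)
    also have "\<dots> = (\<Sum>y\<le>m. pr x m y * (1 / D) - pr x m y * of_bool (deg x m y = mx x m) * (1 / D - 1 / (D + 1)))"
      by (intro sum.cong refl) (simp only: right_diff_distrib mult.assoc)
    also have "\<dots> = (\<Sum>y\<le>m. pr x m y) * (1 / D) - ?s * (1 / D - 1 / (D + 1))"
      unfolding sum_subtractf sum_distrib_right ..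
    also have "\<dots> \<le> 1 / D - D / (2 * real m + 1) * (1 / D - 1 / (D + 1))"
    proof -
      have "0 \<le> 1 / D - 1 / (D + 1)" using D by (simp add: field_simps)
      from mult_right_mono[OF s this] show ?thesis by (simp add: sum_pr)
    qed
    also have "D / (2 * real m + 1) * (1 / D - 1 / (D + 1)) = 1 / (2 * real m + 1) * (1 / (D + 1))"
      using D by (simp add: divide_simps)
    also have "1 / D - 1 / (2 * real m + 1) * (1 / (D + 1)) \<le> (1 - t) * (1 / D)"
    proof -
      have "1 / (2 * D) \<le> 1 / (D + 1)" using D by (intro divide_left_mono) auto
      then have "1 / (2 * real m + 1) * (1 / (2 * D)) \<le> 1 / (2 * real m + 1) * (1 / (D + 1))"
        by (rule mult_left_mono) auto
      moreover have "1 / (2 * real m + 1) * (1 / (2 * D)) = t * (1 / D)"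
        by (simp add: t_def algebra_simps)
      moreover have "(1 - t) * (1 / D) = 1 / D - t * (1 / D)" by (simp only: left_diff_distrib mult_1)
      ultimately show ?thesis by linarith
    qed
    finally show "(\<Sum>y\<le>m. pr x m y * V (Suc m) (x(Suc m := y))) \<le> (1 - t) * V m x" by (simp only: V_def[of m x] D_def)
  qed
  also have "\<dots> = (1 - t) * (\<integral>\<omega>. V m (X \<omega>) \<partial>M)" by simp
  also have "\<dots> \<le> (1 - t) * (real m + 1) powr (- (1/4))"
    using Suc t by (intro mult_left_mono) (auto simp: V_def)
  also have "\<dots> \<le> (real (Suc m) + 1) powr (- (1/4))"
  proof -
    have "1 - t \<le> exp (- t)" using exp_ge_add_one_self[of "- t"] by simp
    also have "\<dots> \<le> exp (- (1/4) * ln ((real m + 2) / (real m + 1)))"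
    proof -
      have "ln ((real m + 2) / (real m + 1)) = ln (1 + 1 / (real m + 1))" by (simp add: field_simps)
      also have "\<dots> \<le> 1 / (real m + 1)" by (rule ln_add_one_self_le_self) auto
      also have "\<dots> \<le> 4 * t" by (simp add: t_def field_simps)
      finally show ?thesis by simp
    qed
    also have "\<dots> = ((real m + 2) / (real m + 1)) powr (- (1/4))" by (simp add: powr_def)
    also have "\<dots> = (real m + 2) powr (- (1/4)) / (real m + 1) powr (- (1/4))" by (simp add: powr_divide)
    finally have "1 - t \<le> (real m + 2) powr (- (1/4)) / (real m + 1) powr (- (1/4))" .
    then show ?thesis by (simp add: field_simps)
  qed
  finally show ?case by (simp add: V_def)
qed

text \<open>Moments bound the process one time at a time; the weights
  \<open>(j + 1) powr (- (7/8))\<close> make the expected sum finite, and monotonicity of the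
  maximal degree turns the convergent sum into a bound at every time. The remaining power
  \<open>1/8\<close> is \<open>1 - 7/8\<close>. The constant is a natural number so that later only
  countably many have to be treated.\<close>

lemma AE_mx_growth: "AE \<omega> in M. \<exists>C::nat. \<forall>n. (real n + 1) powr (1/8) \<le> C * (real (mx (X \<omega>) n) + 1)"
proof -
  define h where "h j \<omega> = (real j + 1) powr (- (7/8)) * (1 / (real (mx (X \<omega>) j) + 1))" for j \<omega>
  have int: "integrable M (h j)" for j
    unfolding h_def
    using integrable_determined[OF determined_comp[OF determined_mx, where F = "\<lambda>d. 1 / (real d + 1)"], of j]
    by (rule integrable_mult_right)
  have E: "(\<integral>\<omega>. h j \<omega> \<partial>M) \<le> (real j + 1) powr (- (9/8))" for j
  proof -
    have "(\<integral>\<omega>. h j \<omega> \<partial>M) \<le> (real j + 1) powr (- (7/8)) * (real j + 1) powr (- (1/4))"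
      unfolding h_def integral_mult_right_zero by (rule mult_left_mono[OF mx_growth]) simp
    also have "\<dots> = (real j + 1) powr (- (9/8))" by (simp add: powr_add[symmetric])
    finally show ?thesis .
  qed
  have hm [measurable]: "h j \<in> borel_measurable M" for j
    using int by (rule borel_measurable_integrable)
  have "(\<integral>\<^sup>+\<omega>. (\<Sum>j. ennreal (h j \<omega>)) \<partial>M) = (\<Sum>j. \<integral>\<^sup>+\<omega>. ennreal (h j \<omega>) \<partial>M)"
    by (rule nn_integral_suminf) measurable
  also have "\<dots> = (\<Sum>j. ennreal (\<integral>\<omega>. h j \<omega> \<partial>M))"
    by (intro suminf_cong nn_integral_eq_integral int) (simp add: h_def)
  also have "\<dots> \<le> (\<Sum>j. ennreal ((real j + 1) powr (- (9/8))))"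
    by (intro suminf_le ennreal_leI E) auto
  also have "\<dots> < \<infinity>"
    by (subst suminf_ennreal2) (auto intro!: summable_shifted_powr)
  finally have "(\<integral>\<^sup>+\<omega>. (\<Sum>j. ennreal (h j \<omega>)) \<partial>M) \<noteq> \<infinity>" by simp
  then have "AE \<omega> in M. (\<Sum>j. ennreal (h j \<omega>)) \<noteq> \<infinity>"
    by (rule nn_integral_PInf_AE[rotated]) measurable
  then show ?thesis
  proof (rule AE_mp, intro AE_I2 impI)
    fix \<omega> assume \<omega>: "\<omega> \<in> space M" and "(\<Sum>j. ennreal (h j \<omega>)) \<noteq> \<infinity>"
    then have sm: "summable (\<lambda>j. h j \<omega>)"
      by (intro summable_suminf_not_top) (auto simp: h_def)
    obtain C :: nat where C: "(\<Sum>j. h j \<omega>) \<le> C" using real_arch_simple by blast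
    have "(real n + 1) powr (1/8) \<le> C * (real (mx (X \<omega>) n) + 1)" for n
    proof -
      have "(real n + 1) powr (1/8) / (real (mx (X \<omega>) n) + 1)
        = real (card {..n}) * ((real n + 1) powr (- (7/8)) * (1 / (real (mx (X \<omega>) n) + 1)))"
      proof -
        have "(real n + 1) powr (1/8) = (real n + 1) powr 1 * (real n + 1) powr (- (7/8))"
          unfolding powr_add[symmetric] by simp
        then show ?thesis by simp
      qed
      also have "\<dots> = (\<Sum>j\<le>n. (real n + 1) powr (- (7/8)) * (1 / (real (mx (X \<omega>) n) + 1)))" by simp
      \<comment> \<open>Both factors of \<open>h j\<close> are decreasing in \<open>j\<close>, so
        each of the \<open>n + 1\<close> terms is at least the last one.\<close>
      also have "\<dots> \<le> (\<Sum>j\<le>n. h j \<omega>)"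
        unfolding h_def using mx_mono[OF parent_fun_X[OF \<omega>]]
        by (intro sum_mono mult_mono powr_mono2' divide_left_mono) auto
      also have "\<dots> \<le> (\<Sum>j. h j \<omega>)" by (intro sum_le_suminf sm) (auto simp: h_def)
      also have "\<dots> \<le> C" by (rule C)
      finally show ?thesis by (simp add: field_simps)
    qed
    then show "\<exists>C::nat. \<forall>n. (real n + 1) powr (1/8) \<le> C * (real (mx (X \<omega>) n) + 1)" by blast
  qed
qed

text \<open>Node \<open>j\<close> is born at time \<open>j\<close>, when the maximal degree is at
  least of order \<open>j powr (1/8)\<close>; its family becomes larger than \<open>K\<close> with
  probability of order \<open>j powr (- ((p - 1) * K / 8))\<close>, summable by the choice of
  \<open>K\<close>.\<close>

lemma AE_finite_big:
  assumes K: "8 < (p - 1) * real K"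
  shows "AE \<omega> in M. finite {v. big K (X \<omega>) v}"
proof -
  \<comment> \<open>The growth bound is imposed only at the single time \<open>j\<close>, which
    makes it an event of the history at birth. \<open>Suc C\<close> avoids division by zero.\<close>
  define H where "H C j x \<longleftrightarrow> (real j + 1) powr (1/8) \<le> real (Suc C) * (real (mx x j) + 1)" for C j x
  have H: "determined j (H C j)" for C j unfolding H_def by (rule determined_comp[OF determined_mx])
  let ?B = "\<lambda>C j. {\<omega>\<in>space M. H C j (X \<omega>) \<and> big K (X \<omega>) j}"
  have B: "?B C j \<in> sets M" for C j unfolding H_def by measurable
  define \<gamma> where "\<gamma> C j = 2 powr p / (p - 1) * real (Suc C) powr (p - 1) * (real j + 1) powr (- ((p - 1) / 8))" for C j
  have bound: "prob (?B C j) \<le> (real (Suc K) powr (p + 1) * \<gamma> C j) ^ K" for C j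
  proof -
    have "0 \<le> (real (Suc K) powr (p + 1) * \<gamma> C j) ^ K" using p by (auto simp: \<gamma>_def)
    then have "prob {\<omega>\<in>space M. H C j (X \<omega>)} * (real (Suc K) powr (p + 1) * \<gamma> C j) ^ K
      \<le> 1 * (real (Suc K) powr (p + 1) * \<gamma> C j) ^ K" by (rule mult_right_mono[OF prob_le_1])
    moreover have "prob (?B C j) \<le> prob {\<omega>\<in>space M. H C j (X \<omega>)} * (real (Suc K) powr (p + 1) * \<gamma> C j) ^ K"
    proof (rule big_birth_bound[OF H])
      fix x assume "H C j x"
      then have "(real j + 1) powr (1/8) / real (Suc C) \<le> real (mx x j) + 1"
        unfolding H_def by (simp add: field_simps del: of_nat_Suc)
      then have "(real (mx x j) + 1) powr (1 - p) \<le> ((real j + 1) powr (1/8) / real (Suc C)) powr (1 - p)"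
        using p by (intro powr_mono2') auto
      also have "\<dots> = (real j + 1) powr (1/8 * (1 - p)) / real (Suc C) powr (1 - p)"
        by (simp add: powr_divide powr_powr)
      also have "real (Suc C) powr (1 - p) = 1 / real (Suc C) powr (p - 1)"
        by (simp only: powr_minus_divide[symmetric]) simp
      finally have *: "(real (mx x j) + 1) powr (1 - p) \<le> real (Suc C) powr (p - 1) * (real j + 1) powr (- ((p - 1) / 8))"
        by (simp add: algebra_simps diff_divide_distrib)
      have "g (mx x j) \<le> 2 powr p / (p - 1) * (real (Suc C) powr (p - 1) * (real j + 1) powr (- ((p - 1) / 8)))"
        unfolding g_def by (rule mult_left_mono[OF *]) (use p in auto)
      then show "g (mx x j) \<le> \<gamma> C j" unfolding \<gamma>_def by (simp only: mult.assoc)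
    qed
    ultimately show ?thesis by linarith
  qed
  have sm: "summable (\<lambda>j. (real (Suc K) powr (p + 1) * \<gamma> C j) ^ K)" for C
  proof -
    have "(real (Suc K) powr (p + 1) * \<gamma> C j) ^ K
      = (real (Suc K) powr (p + 1) * (2 powr p / (p - 1) * real (Suc C) powr (p - 1))) ^ K
        * (real j + 1) powr (- ((p - 1) * real K / 8))" for j
    proof -
      have "((real j + 1) powr (- ((p - 1) / 8))) ^ K = (real j + 1) powr (real K * (- ((p - 1) / 8)))"
        by (simp add: powr_power)
      also have "real K * (- ((p - 1) / 8)) = - ((p - 1) * real K / 8)" by simp
      finally show ?thesis unfolding \<gamma>_def by (simp only: power_mult_distrib mult.assoc)
    qed
    then show ?thesis using K by (simp only:) (intro summable_mult summable_shifted_powr, simp)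
  qed
  have "AE \<omega> in M. \<forall>C. eventually (\<lambda>j. \<omega> \<in> space M - ?B C j) sequentially"
    unfolding AE_all_countable
  proof
    fix C show "AE \<omega> in M. eventually (\<lambda>j. \<omega> \<in> space M - ?B C j) sequentially"
    proof (rule borel_cantelli_AE1)
      show "emeasure M (?B C j) < \<infinity>" for j by (simp add: emeasure_eq_measure)
      show "summable (\<lambda>j. measure M (?B C j))"
        by (rule summable_comparison_test'[OF sm[of C], of 0]) (use bound[of C] in auto)
    qed (rule B)
  qed
  then show ?thesis using AE_mx_growth
  proof eventually_elim
    case (elim \<omega>)
    then obtain C :: nat where C: "\<And>n. (real n + 1) powr (1/8) \<le> real C * (real (mx (X \<omega>) n) + 1)" by blast
    have "H C n (X \<omega>)" for n
      unfolding H_def by (rule order_trans[OF C]) (auto intro!: mult_right_mono)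
    moreover obtain N where "\<And>j. N \<le> j \<Longrightarrow> \<omega> \<in> space M - ?B C j"
      using elim(1) unfolding eventually_sequentially by blast
    ultimately have "{v. big K (X \<omega>) v} \<subseteq> {..<N}" by (force simp: not_le[symmetric])
    then show ?case using finite_subset by blast
  qed
qed

text \<open>In the continuous-time embedding, \<open>1 / q \<theta> d\<close> is the characteristic function, at \<open>- \<theta>\<close>, of the time
  that a node needs to reach degree \<open>d\<close>.\<close>

definition q :: "real \<Rightarrow> nat \<Rightarrow> complex" where
  "q \<theta> d = (\<Prod>i<d. 1 + \<i> * of_real (\<theta> / f i))"

lemma q_Suc: "q \<theta> (Suc d) = q \<theta> d * (1 + \<i> * of_real (\<theta> / f d))"
  by (simp add: q_def)

lemma norm_q_factor: "cmod (1 + \<i> * of_real t) = sqrt (1 + t\<^sup>2)"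
  by (simp add: cmod_def)

lemma norm_q_mono: "d \<le> e \<Longrightarrow> cmod (q \<theta> d) \<le> cmod (q \<theta> e)"
proof (induction e rule: dec_induct)
  case (step e)
  have "1 \<le> cmod (1 + \<i> * of_real (\<theta> / f e))" by (simp only: norm_q_factor) simp
  then have "cmod (q \<theta> e) * 1 \<le> cmod (q \<theta> (Suc e))"
    unfolding q_Suc norm_mult by (intro mult_left_mono) auto
  then show ?case using step by simp
qed simp

lemma norm_q_ge_1: "1 \<le> cmod (q \<theta> d)"
  using norm_q_mono[of 0 d \<theta>] by (simp add: q_def)

lemma summable_inverse_f: "summable (\<lambda>i. 1 / f i)"
  using summable_shifted_powr[OF p] by (simp add: powr_minus_divide)

lemma norm_q_le: "cmod (q \<theta> d) \<le> exp (\<bar>\<theta>\<bar> * (\<Sum>i. 1 / f i))"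
proof -
  have "cmod (q \<theta> d) = (\<Prod>i<d. cmod (1 + \<i> * of_real (\<theta> / f i)))" by (simp add: q_def prod_norm)
  also have "\<dots> \<le> (\<Prod>i<d. exp (\<bar>\<theta>\<bar> * (1 / f i)))"
  proof (intro prod_mono conjI)
    fix i
    have "cmod (1 + \<i> * of_real (\<theta> / f i)) \<le> 1 + \<bar>\<theta>\<bar> * (1 / f i)"
      by (rule order_trans[OF norm_triangle_ineq]) (simp add: norm_mult norm_divide)
    also have "\<dots> \<le> exp (\<bar>\<theta>\<bar> * (1 / f i))" by (rule exp_ge_add_one_self)
    finally show "cmod (1 + \<i> * of_real (\<theta> / f i)) \<le> exp (\<bar>\<theta>\<bar> * (1 / f i))" .
  qed auto
  also have "\<dots> = exp (\<bar>\<theta>\<bar> * (\<Sum>i<d. 1 / f i))" by (simp add: exp_sum sum_distrib_left)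
  also have "\<dots> \<le> exp (\<bar>\<theta>\<bar> * (\<Sum>i. 1 / f i))"
    using sum_le_suminf[OF summable_inverse_f, of "{..<d}"] by (auto intro!: mult_left_mono)
  finally show ?thesis .
qed

text \<open>The increments are bounded multiples of \<open>1 / f i\<close>, which is summable since
  \<open>p > 1\<close>.\<close>

lemma convergent_q: "convergent (q \<theta>)"
proof -
  have "summable (\<lambda>i. q \<theta> i * (\<i> * of_real (\<theta> / f i)))"
  proof (rule summable_comparison_test'[of "\<lambda>i. exp (\<bar>\<theta>\<bar> * (\<Sum>i. 1 / f i)) * \<bar>\<theta>\<bar> * (1 / f i)" 0])
    show "summable (\<lambda>i. exp (\<bar>\<theta>\<bar> * (\<Sum>i. 1 / f i)) * \<bar>\<theta>\<bar> * (1 / f i))"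
      by (intro summable_mult summable_inverse_f)
    show "norm (q \<theta> i * (\<i> * of_real (\<theta> / f i))) \<le> exp (\<bar>\<theta>\<bar> * (\<Sum>i. 1 / f i)) * \<bar>\<theta>\<bar> * (1 / f i)" for i
      using mult_right_mono[OF norm_q_le[of \<theta> i], of "\<bar>\<theta>\<bar> * (1 / f i)"]
      by (simp add: norm_mult norm_divide mult.assoc)
  qed
  moreover have "q \<theta> (Suc i) - q \<theta> i = q \<theta> i * (\<i> * of_real (\<theta> / f i))" for i
    by (simp only: q_Suc ring_distribs) simp
  ultimately have "summable (\<lambda>i. q \<theta> (Suc i) - q \<theta> i)" by simp
  then have "convergent (\<lambda>d. \<Sum>i<d. q \<theta> (Suc i) - q \<theta> i)" by (simp add: summable_iff_convergent)
  then have "convergent (\<lambda>d. q \<theta> d - q \<theta> 0)" by (simp only: sum_lessThan_telescope)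
  then show ?thesis by (simp add: convergent_diff_const_right_iff)
qed

lemma norm_q_le_lim: "cmod (q \<theta> d) \<le> cmod (lim (q \<theta>))"
proof -
  have "(\<lambda>d. cmod (q \<theta> d)) \<longlonglongrightarrow> cmod (lim (q \<theta>))"
    by (intro tendsto_norm) (use convergent_q convergent_LIMSEQ_iff in blast)
  then show ?thesis by (rule LIMSEQ_le_const) (use norm_q_mono in auto)
qed

text \<open>The limit contains the factor with index \<open>d\<close>, of norm at least
  \<open>\<theta> / f d\<close>, and all other factors have norm at least 1.\<close>

lemma q_ratio_tendsto_0: "(\<lambda>n. cmod (q (real n) d) / cmod (lim (q (real n)))) \<longlonglongrightarrow> 0"
proof (rule tendsto_sandwich[of "\<lambda>_. 0" _ _ "\<lambda>n. f d / real n"])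
  show "eventually (\<lambda>n. cmod (q (real n) d) / cmod (lim (q (real n))) \<le> f d / real n) sequentially"
    using eventually_gt_at_top[of 0]
  proof eventually_elim
    fix n :: nat assume n: "0 < n"
    let ?r = "real n"
    have pos: "0 < cmod (q ?r d)" using norm_q_ge_1[of ?r d] by linarith
    have "?r / f d \<le> sqrt (1 + (?r / f d)\<^sup>2)" by (rule real_le_rsqrt) simp
    then have "cmod (q ?r d) * (?r / f d) \<le> cmod (q ?r (Suc d))"
      unfolding q_Suc norm_mult norm_q_factor by (intro mult_left_mono) auto
    also have "\<dots> \<le> cmod (lim (q ?r))" by (rule norm_q_le_lim)
    finally have *: "cmod (q ?r d) * (?r / f d) \<le> cmod (lim (q ?r))" .
    have "cmod (q ?r d) / cmod (lim (q ?r)) \<le> cmod (q ?r d) / (cmod (q ?r d) * (?r / f d))"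
      using n pos order.strict_trans2[OF pos norm_q_le_lim] by (intro divide_left_mono * mult_pos_pos) auto
    also have "\<dots> = f d / ?r" using pos by simp
    finally show "cmod (q ?r d) / cmod (lim (q ?r)) \<le> f d / ?r" .
  qed
  show "(\<lambda>n. f d / real n) \<longlonglongrightarrow> 0" by (rule lim_const_over_n)
qed auto

end

section \<open>Uniqueness of the node of infinite degree\<close>

context superlinear_GN
begin

text \<open>Conjugation gives the second node the factors \<open>1 - \<i> * \<theta> / f i\<close>,
  so that the drifts caused by the two nodes have opposite signs.\<close>

definition Z :: "nat \<Rightarrow> nat \<Rightarrow> real \<Rightarrow> nat \<Rightarrow> (nat \<Rightarrow> nat) \<Rightarrow> complex" where
  "Z u v \<theta> m x = q \<theta> (deg x m u) * cnj (q \<theta> (deg x m v))"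

lemma determined_Z: "determined m (Z u v \<theta> m)"
  unfolding Z_def by (rule determined_comp[OF determined_deg, where F = "\<lambda>d. q \<theta> (d u) * cnj (q \<theta> (d v))"])

text \<open>Node \<open>u\<close> is hit with probability \<open>f / wt\<close> and then changes
  \<open>Z\<close> by the relative amount \<open>\<i> * \<theta> / f\<close>. The product
  \<open>\<i> * \<theta> / wt\<close> no longer depends on the degree, so the contribution of
  \<open>v\<close> cancels that of \<open>u\<close> once both are born.\<close>

lemma Z_step:
  assumes "u \<noteq> v" "u \<le> m" "v \<le> m"
  shows "(\<Sum>y\<le>m. pr x m y *\<^sub>R Z u v \<theta> (Suc m) (x(Suc m := y))) = Z u v \<theta> m x"
proof -
  define z where "z = Z u v \<theta> m x"
  define a where "a d = \<i> * complex_of_real (\<theta> / f d)" for d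
  have Z: "Z u v \<theta> (Suc m) (x(Suc m := y)) =
      z + (if y = u then z * a (deg x m u) else 0) - (if y = v then z * a (deg x m v) else 0)" for y
    using assms(1) by (auto simp: Z_def z_def deg_upd q_Suc a_def algebra_simps)
  have c: "pr x m y *\<^sub>R a (deg x m y) = \<i> * complex_of_real (\<theta> / wt x m)" for y
    by (simp add: pr_def a_def scaleR_conv_of_real)
  have "(\<Sum>y\<le>m. pr x m y *\<^sub>R Z u v \<theta> (Suc m) (x(Suc m := y))) =
     (\<Sum>y\<le>m. pr x m y *\<^sub>R z) + (\<Sum>y\<le>m. if y = u then pr x m y *\<^sub>R (z * a (deg x m u)) else 0)
     - (\<Sum>y\<le>m. if y = v then pr x m y *\<^sub>R (z * a (deg x m v)) else 0)"
    unfolding sum.distrib[symmetric] sum_subtractf[symmetric]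
    by (intro sum.cong refl) (simp add: Z scaleR_add_right scaleR_diff_right)
  also have "\<dots> = (\<Sum>y\<le>m. pr x m y) *\<^sub>R z + z * (pr x m u *\<^sub>R a (deg x m u)) - z * (pr x m v *\<^sub>R a (deg x m v))"
    using assms by (simp add: scaleR_sum_left)
  also have "\<dots> = z" unfolding sum_pr c by simp
  finally show ?thesis by (simp add: z_def)
qed

lemma integral_Z:
  assumes "u \<noteq> v" "max u v \<le> m"
  shows "(\<integral>\<omega>. Z u v \<theta> m (X \<omega>) \<partial>M) = (\<integral>\<omega>. Z u v \<theta> (max u v) (X \<omega>) \<partial>M)"
  using assms(2)
proof (induction m rule: dec_induct)
  case (step m)
  have "(\<integral>\<omega>. Z u v \<theta> (Suc m) (X \<omega>) \<partial>M)
    = (\<integral>\<omega>. (\<Sum>y\<le>m. pr (X \<omega>) m y *\<^sub>R Z u v \<theta> (Suc m) ((X \<omega>)(Suc m := y))) \<partial>M)"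
    by (rule one_step[OF determined_Z])
  also have "\<dots> = (\<integral>\<omega>. Z u v \<theta> m (X \<omega>) \<partial>M)"
    using step by (subst Z_step) (auto simp: assms(1))
  finally show ?case using step by simp
qed simp

lemma norm_Z_le: "cmod (Z u v \<theta> m x) \<le> (cmod (lim (q \<theta>)))\<^sup>2"
  unfolding Z_def norm_mult complex_mod_cnj power2_eq_square by (intro mult_mono norm_q_le_lim) auto

lemma q_deg_convergent: "convergent (\<lambda>m. q \<theta> (deg x m u))"
proof (cases "hub x u")
  case True
  have "(q \<theta> \<longlongrightarrow> lim (q \<theta>)) sequentially" using convergent_q convergent_LIMSEQ_iff by blast
  from filterlim_compose[OF this hub_deg_at_top[OF True]] show ?thesis by (auto simp: convergent_def)
next
  case False
  then obtain d where "eventually (\<lambda>m. deg x m u = d) sequentially" by (rule not_hub_deg_const)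
  then have "(\<lambda>m. q \<theta> (deg x m u)) \<longlonglongrightarrow> q \<theta> d" by (intro tendsto_eventually) (auto elim: eventually_mono)
  then show ?thesis by (auto simp: convergent_def)
qed

lemma lim_q_deg_hub:
  assumes "hub x u"
  shows "lim (\<lambda>m. q \<theta> (deg x m u)) = lim (q \<theta>)"
proof -
  have "(q \<theta> \<longlongrightarrow> lim (q \<theta>)) sequentially" using convergent_q convergent_LIMSEQ_iff by blast
  from filterlim_compose[OF this hub_deg_at_top[OF assms]] show ?thesis by (rule limI)
qed

lemma norm_lim_q_deg_le: "cmod (lim (\<lambda>m. q \<theta> (deg x m u))) \<le> cmod (lim (q \<theta>))"
proof -
  have "(\<lambda>m. cmod (q \<theta> (deg x m u))) \<longlonglongrightarrow> cmod (lim (\<lambda>m. q \<theta> (deg x m u)))"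
    by (intro tendsto_norm) (use q_deg_convergent convergent_LIMSEQ_iff in blast)
  then show ?thesis by (rule LIMSEQ_le_const2) (use norm_q_le_lim in auto)
qed

lemma lim_q_deg_ratio:
  assumes "\<not> hub x u"
  shows "(\<lambda>n. cmod (lim (\<lambda>m. q (real n) (deg x m u))) / cmod (lim (q (real n)))) \<longlonglongrightarrow> 0"
proof -
  obtain d where "eventually (\<lambda>m. deg x m u = d) sequentially" using assms by (rule not_hub_deg_const)
  then have "(\<lambda>m. q \<theta> (deg x m u)) \<longlonglongrightarrow> q \<theta> d" for \<theta> by (intro tendsto_eventually) (auto elim: eventually_mono)
  then have "lim (\<lambda>m. q \<theta> (deg x m u)) = q \<theta> d" for \<theta> by (rule limI)
  then show ?thesis using q_ratio_tendsto_0[of d] by simp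
qed

lemma lim_q_pos: "0 < cmod (lim (q \<theta>))"
  using norm_q_ge_1[of \<theta> 0] norm_q_le_lim[of \<theta> 0] by linarith

text \<open>For \<open>u \<noteq> v\<close> the process \<open>Z u v \<theta>\<close> is a bounded martingale. When \<open>u\<close> and \<open>v\<close> are both hubs, it ends at
  the constant \<open>\<bar>lim (q \<theta>)\<bar>\<^sup>2\<close>, and for \<open>\<theta> \<rightarrow> \<infinity>\<close> this constant dominates both its initial value and all
  other final values.\<close>

lemma prob_two_hubs:
  assumes uv: "u \<noteq> v"
  shows "prob {\<omega>\<in>space M. hub (X \<omega>) u \<and> hub (X \<omega>) v} = 0"
proof -
  let ?B = "{\<omega>\<in>space M. hub (X \<omega>) u \<and> hub (X \<omega>) v}"
  define A where "A \<theta> = (cmod (lim (q \<theta>)))\<^sup>2" for \<theta>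
  have A: "0 < A \<theta>" for \<theta> using lim_q_pos[of \<theta>] by (simp add: A_def)
  define Zl where "Zl \<theta> \<omega> = lim (\<lambda>m. q \<theta> (deg (X \<omega>) m u)) * cnj (lim (\<lambda>m. q \<theta> (deg (X \<omega>) m v)))" for \<theta> \<omega>
  let ?m = "max u v"
  have Zm [measurable]: "(\<lambda>\<omega>. Z u v \<theta> m (X \<omega>)) \<in> borel_measurable M" for \<theta> m
    using integrable_determined[OF determined_Z] by (rule borel_measurable_integrable)
  have ZZl: "(\<lambda>m. Z u v \<theta> m (X \<omega>)) \<longlonglongrightarrow> Zl \<theta> \<omega>" for \<theta> \<omega>
    unfolding Z_def Zl_def
    by (intro tendsto_mult tendsto_cnj) (use q_deg_convergent convergent_LIMSEQ_iff in blast)+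
  have Zlm [measurable]: "Zl \<theta> \<in> borel_measurable M" for \<theta>
    by (rule borel_measurable_LIMSEQ_metric[OF Zm ZZl])
  have EZl: "(\<integral>\<omega>. Zl \<theta> \<omega> \<partial>M) = (\<integral>\<omega>. Z u v \<theta> ?m (X \<omega>) \<partial>M)" for \<theta>
  proof (rule LIMSEQ_unique)
    show "(\<lambda>m. \<integral>\<omega>. Z u v \<theta> m (X \<omega>) \<partial>M) \<longlonglongrightarrow> (\<integral>\<omega>. Zl \<theta> \<omega> \<partial>M)"
    proof (rule integral_dominated_convergence[where w = "\<lambda>_. A \<theta>"])
      show "AE \<omega> in M. (\<lambda>m. Z u v \<theta> m (X \<omega>)) \<longlonglongrightarrow> Zl \<theta> \<omega>" by (rule AE_I2) (rule ZZl)
      show "AE \<omega> in M. cmod (Z u v \<theta> m (X \<omega>)) \<le> A \<theta>" for m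
        by (rule AE_I2) (unfold A_def, rule norm_Z_le)
    qed simp_all
    show "(\<lambda>m. \<integral>\<omega>. Z u v \<theta> m (X \<omega>) \<partial>M) \<longlonglongrightarrow> (\<integral>\<omega>. Z u v \<theta> ?m (X \<omega>) \<partial>M)"
      by (rule tendsto_eventually, rule eventually_mono[OF eventually_ge_at_top[of ?m]]) (rule integral_Z[OF uv])
  qed
  have norm_Zl: "cmod (Zl \<theta> \<omega>) \<le> A \<theta>" for \<theta> \<omega>
    unfolding Zl_def A_def norm_mult complex_mod_cnj power2_eq_square by (intro mult_mono norm_lim_q_deg_le) auto
  have bounded: "norm (z / complex_of_real (A \<theta>)) \<le> 1" if "cmod z \<le> A \<theta>" for z \<theta>
    using A[of \<theta>] that by (simp add: norm_divide)
  have ratio: "norm (a * cnj b / complex_of_real (A \<theta>)) = (cmod a / cmod (lim (q \<theta>))) * (cmod b / cmod (lim (q \<theta>)))" for a b \<theta>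
    by (simp add: norm_mult norm_divide A_def power2_eq_square)
  \<comment> \<open>Initial value: at the fixed time \<open>?m\<close> both degrees are finite, so
    each normalised factor tends to 0 as \<theta> grows.\<close>
  have lim0: "(\<lambda>n. \<integral>\<omega>. Z u v (real n) ?m (X \<omega>) / complex_of_real (A (real n)) \<partial>M) \<longlonglongrightarrow> (\<integral>\<omega>. 0 \<partial>M)"
  proof (rule integral_dominated_convergence[where w = "\<lambda>_. 1"])
    show "AE \<omega> in M. (\<lambda>n. Z u v (real n) ?m (X \<omega>) / complex_of_real (A (real n))) \<longlonglongrightarrow> 0"
      by (rule AE_I2, rule tendsto_norm_zero_cancel)
         (simp only: Z_def ratio, rule tendsto_mult_zero[OF q_ratio_tendsto_0 q_ratio_tendsto_0])
    show "AE \<omega> in M. norm (Z u v (real n) ?m (X \<omega>) / complex_of_real (A (real n))) \<le> 1" for n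
      by (intro AE_I2 bounded) (unfold A_def, rule norm_Z_le)
  qed auto
  \<comment> \<open>Final value: with two hubs the normalised limit is exactly 1 for every \<theta>;
    otherwise one degree stays bounded and its factor forces the limit to 0, the other factor having
    norm at most 1.\<close>
  have limB: "(\<lambda>n. \<integral>\<omega>. Zl (real n) \<omega> / complex_of_real (A (real n)) \<partial>M) \<longlonglongrightarrow> (\<integral>\<omega>. complex_of_real (indicator ?B \<omega>) \<partial>M)"
  proof (rule integral_dominated_convergence[where w = "\<lambda>_. 1"])
    show "AE \<omega> in M. (\<lambda>n. Zl (real n) \<omega> / complex_of_real (A (real n))) \<longlonglongrightarrow> complex_of_real (indicator ?B \<omega>)"
    proof (rule AE_I2)
      fix \<omega> assume \<omega>: "\<omega> \<in> space M"
      show "(\<lambda>n. Zl (real n) \<omega> / complex_of_real (A (real n))) \<longlonglongrightarrow> complex_of_real (indicator ?B \<omega>)"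
      proof (cases "hub (X \<omega>) u \<and> hub (X \<omega>) v")
        case True
        have "Zl \<theta> \<omega> = complex_of_real (A \<theta>)" for \<theta>
          using True by (simp add: Zl_def lim_q_deg_hub A_def complex_norm_square[symmetric])
        then show ?thesis using True \<omega> A by (simp add: less_imp_neq[THEN not_sym])
      next
        case False
        have le1: "cmod (lim (\<lambda>m. q \<theta> (deg x m u))) / cmod (lim (q \<theta>)) \<le> 1" for \<theta> x u
          using norm_lim_q_deg_le lim_q_pos[of \<theta>] by simp
        have "(\<lambda>n. norm (Zl (real n) \<omega> / complex_of_real (A (real n)))) \<longlonglongrightarrow> 0"
          unfolding Zl_def ratio
        proof (cases "hub (X \<omega>) u")
          case True
          then have "\<not> hub (X \<omega>) v" using False by simp
          from lim_q_deg_ratio[OF this] show "(\<lambda>n. cmod (lim (\<lambda>m. q (real n) (deg (X \<omega>) m u))) / cmod (lim (q (real n))) *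
              (cmod (lim (\<lambda>m. q (real n) (deg (X \<omega>) m v))) / cmod (lim (q (real n))))) \<longlonglongrightarrow> 0"
            by (rule Lim_null_comparison[rotated]) (auto intro!: always_eventually mult_left_le_one_le le1 simp del: times_divide_eq_left times_divide_eq_right)
        next
          case False
          from lim_q_deg_ratio[OF this] show "(\<lambda>n. cmod (lim (\<lambda>m. q (real n) (deg (X \<omega>) m u))) / cmod (lim (q (real n))) *
              (cmod (lim (\<lambda>m. q (real n) (deg (X \<omega>) m v))) / cmod (lim (q (real n))))) \<longlonglongrightarrow> 0"
            by (rule Lim_null_comparison[rotated]) (auto intro!: always_eventually mult_right_le_one_le le1 simp del: times_divide_eq_left times_divide_eq_right)
        qed
        then have "(\<lambda>n. Zl (real n) \<omega> / complex_of_real (A (real n))) \<longlonglongrightarrow> 0"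
          by (rule tendsto_norm_zero_cancel)
        then show ?thesis using False by simp
      qed
    qed
    show "AE \<omega> in M. norm (Zl (real n) \<omega> / complex_of_real (A (real n))) \<le> 1" for n
      by (intro AE_I2 bounded norm_Zl)
    show "(\<lambda>\<omega>. complex_of_real (indicator ?B \<omega>)) \<in> borel_measurable M"
      unfolding hub_def by measurable
  qed auto
  have eq: "(\<integral>\<omega>. Zl (real n) \<omega> / complex_of_real (A (real n)) \<partial>M)
    = (\<integral>\<omega>. Z u v (real n) ?m (X \<omega>) / complex_of_real (A (real n)) \<partial>M)" for n
    by (simp add: EZl)
  have "(\<integral>\<omega>. complex_of_real (indicator ?B \<omega>) \<partial>M) = (\<integral>\<omega>. 0 \<partial>M)"
    by (rule LIMSEQ_unique[OF limB]) (unfold eq, rule lim0)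
  moreover have "?B \<in> sets M" unfolding hub_def by measurable
  ultimately show ?thesis by (simp add: integral_complex_of_real)
qed

lemma AE_unique_hub: "AE \<omega> in M. \<forall>u v. hub (X \<omega>) u \<longrightarrow> hub (X \<omega>) v \<longrightarrow> u = v"
proof -
  have "AE \<omega> in M. u \<noteq> v \<longrightarrow> \<not> (hub (X \<omega>) u \<and> hub (X \<omega>) v)" for u v
  proof (cases "u = v")
    case False
    have "{\<omega>\<in>space M. hub (X \<omega>) u \<and> hub (X \<omega>) v} \<in> sets M" unfolding hub_def by measurable
    then have "AE \<omega> in M. \<omega> \<notin> {\<omega>\<in>space M. hub (X \<omega>) u \<and> hub (X \<omega>) v}"
      by (intro AE_not_in null_setsI) (simp_all add: emeasure_eq_measure prob_two_hubs[OF False])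
    then show ?thesis by (rule AE_mp) (rule AE_I2, simp)
  qed simp
  then have "AE \<omega> in M. \<forall>u v. u \<noteq> v \<longrightarrow> \<not> (hub (X \<omega>) u \<and> hub (X \<omega>) v)" by (simp only: AE_all_countable) simp
  then show ?thesis by (rule AE_mp) (rule AE_I2, blast)
qed

end

section \<open>Abundance of small subtrees\<close>

text \<open>A list \<open>ds\<close> with \<open>ds ! i \<le> i\<close> encodes the tree on \<open>{0..length ds}\<close> in which the parent of \<open>Suc i\<close> is
  \<open>ds ! i\<close>.\<close>

definition code :: "nat list \<Rightarrow> bool" where
  "code ds \<longleftrightarrow> (\<forall>i<length ds. ds ! i \<le> i)"

text \<open>The family has grown in the very order prescribed by the code. A tree may have several
  codes, but a lower bound for its probability needs only one order of growth.\<close>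

definition matches :: "(nat \<Rightarrow> nat) \<Rightarrow> nat \<Rightarrow> nat \<Rightarrow> nat list \<Rightarrow> bool" where
  "matches x v m ds \<longleftrightarrow> length (family x v m) = Suc (length ds) \<and>
     (\<forall>i<length ds. x (family x v m ! Suc i) = family x v m ! (ds ! i))"

lemma family_nth_Suc:
  assumes "Suc i < length (family x v m)"
  shows "v < family x v m ! Suc i" "family x v m ! Suc i \<le> m"
proof -
  have "v \<le> m" using assms family_unborn[of m v x] by (cases "v \<le> m") auto
  then obtain ys where ys: "family x v m = v # ys" using family_hd by blast
  have "family x v m ! Suc i \<in> set (family x v m)" by (rule nth_mem[OF assms])
  then have r: "v \<le> family x v m ! Suc i" "family x v m ! Suc i \<le> m" using family_range[of x v m] by auto
  have "family x v m ! Suc i \<in> set ys" using assms ys by simp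
  moreover have "v \<notin> set ys" using distinct_family[of x v m] ys by simp
  ultimately have "v \<noteq> family x v m ! Suc i" by auto
  then show "v < family x v m ! Suc i" "family x v m ! Suc i \<le> m" using r by auto
qed

text \<open>Only parents of later family members are read; these members lie strictly between
  \<open>v - 1\<close> and \<open>m + 1\<close> and differ from \<open>v\<close>, so the junk entry
  at 0 is never consulted.\<close>

lemma determined_matches: "determined m (\<lambda>x. matches x v m ds)"
proof (rule determinedI)
  fix x y :: "nat \<Rightarrow> nat" assume eq: "\<And>j. 1 \<le> j \<Longrightarrow> j \<le> m \<Longrightarrow> x j = y j"
  have fam: "family x v m = family y v m" by (rule determinedD[OF determined_family]) (use eq in auto)
  have "x (family y v m ! Suc i) = y (family y v m ! Suc i)" if "Suc i < length (family y v m)" for i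
    using family_nth_Suc[OF that] by (intro eq) auto
  then show "matches x v m ds = matches y v m ds" unfolding matches_def fam by auto
qed

lemma matches_born: "matches x v m ds \<Longrightarrow> v \<le> m"
  unfolding matches_def using family_unborn[of m v x] by (cases "v \<le> m") auto

lemma matches_birth: "matches x v v []"
  by (simp add: matches_def family_birth)

lemma matches_upd_other:
  assumes "v \<le> m" "y \<notin> set (family x v m)"
  shows "family (x(Suc m := y)) v (Suc m) = family x v m"
    and "matches (x(Suc m := y)) v (Suc m) ds \<longleftrightarrow> matches x v m ds"
proof -
  show fam: "family (x(Suc m := y)) v (Suc m) = family x v m"
    using assms by (subst family_upd) simp
  have "(x(Suc m := y)) (family x v m ! Suc i) = x (family x v m ! Suc i)" if "Suc i < length (family x v m)" for i
    using family_nth_Suc[OF that] by auto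
  then show "matches (x(Suc m := y)) v (Suc m) ds \<longleftrightarrow> matches x v m ds"
    unfolding matches_def fam
    by (cases "length (family x v m) = Suc (length ds)") (simp_all del: fun_upd_apply)
qed

lemma matches_upd_grow:
  assumes v: "v \<le> m" and ds: "code ds" and j: "j < length ds" and match: "matches x v m (take j ds)"
    and y: "y = family x v m ! (ds ! j)"
  shows "matches (x(Suc m := y)) v (Suc m) (take (Suc j) ds)"
proof -
  let ?L = "family x v m"
  have len: "length ?L = Suc j" using match j by (simp add: matches_def)
  moreover have "ds ! j \<le> j" using ds j by (simp add: code_def)
  ultimately have "y \<in> set ?L" using y by simp
  then have fam: "family (x(Suc m := y)) v (Suc m) = ?L @ [Suc m]"
    using v by (subst family_upd) simp
  have "(x(Suc m := y)) ((?L @ [Suc m]) ! Suc i) = (?L @ [Suc m]) ! (take (Suc j) ds ! i)" if i: "i < Suc j" for i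
  proof (cases "i = j")
    case True
    moreover have "ds ! j < Suc j" using ds j by (simp add: code_def le_imp_less_Suc)
    ultimately show ?thesis using len j y by (simp add: nth_append)
  next
    case False
    then have i': "i < j" using i by simp
    then have "x (?L ! Suc i) = ?L ! (ds ! i)" using match j by (simp add: matches_def)
    moreover have "?L ! Suc i \<noteq> Suc m" using family_nth_Suc(2)[of i x v m] len i' by simp
    moreover have "ds ! i \<le> i" using ds i' j by (simp add: code_def)
    ultimately show ?thesis using len i' by (simp add: nth_append)
  qed
  then show ?thesis unfolding matches_def fam using len j by simp
qed

lemma families_disjoint:
  assumes x: "parent_fun x" and v: "0 < v" "0 < v'" "v \<noteq> v'" "x v = x v'"
  shows "set (family x v m) \<inter> set (family x v' m) = {}"
proof (induction m)
  case (Suc m)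
  have not_parent: "x v \<notin> set (family x v m)" "x v' \<notin> set (family x v' m)"
    using parent_funD[OF x v(1)] parent_funD[OF x v(2)] family_range[of x v m] family_range[of x v' m] by auto
  have "Suc m \<notin> set (family x v m)" "Suc m \<notin> set (family x v' m)"
    using family_range[of x v m] family_range[of x v' m] by auto
  then show ?case using Suc not_parent v by auto
qed (use v in auto)

section \<open>Lower bounds for the chance of prescribed growth\<close>

context superlinear_GN
begin

text \<open>Up to a constant, \<open>\<epsilon>\<close> times the sum of \<open>j powr (- p)\<close>
  over \<open>j\<close> from \<open>m\<close> to \<open>N\<close>: what a prescribed single
  attachment can collect before the horizon \<open>N\<close> if the total weight is as large as
  possible.\<close>

definition slope :: "real \<Rightarrow> nat \<Rightarrow> nat \<Rightarrow> real" where
  "slope \<epsilon> N m = \<epsilon> * max 0 (real m powr (1 - p) - real N powr (1 - p))"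

text \<open>One factor for each of the \<open>e\<close> missing nodes. The shifted times
  \<open>m + i\<close> allow the product to be peeled off at either end, so that its values at
  \<open>m\<close> and \<open>Suc m\<close> share all but one factor.\<close>

definition chance :: "real \<Rightarrow> nat \<Rightarrow> nat \<Rightarrow> nat \<Rightarrow> real" where
  "chance \<epsilon> N e m = (\<Prod>i<e. slope \<epsilon> N (m + i))"

lemma slope_nonneg: "0 \<le> \<epsilon> \<Longrightarrow> 0 \<le> slope \<epsilon> N m"
  by (simp add: slope_def)

lemma slope_le:
  assumes "0 \<le> \<epsilon>" shows "slope \<epsilon> N m \<le> \<epsilon>"
proof -
  have "real m powr (1 - p) \<le> 1"
  proof (cases "m = 0")
    case False
    then have "real m powr (1 - p) \<le> real m powr 0" using p by (intro powr_mono) auto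
    then show ?thesis using False by simp
  qed simp
  then have "real m powr (1 - p) - real N powr (1 - p) \<le> 1"
    using powr_ge_zero[of "real N" "1 - p"] by linarith
  then have "max 0 (real m powr (1 - p) - real N powr (1 - p)) \<le> 1" by simp
  from mult_left_mono[OF this assms] show ?thesis by (simp add: slope_def)
qed

lemma slope_diff:
  assumes m: "0 < m" and "0 \<le> \<epsilon>"
  shows "slope \<epsilon> N m - slope \<epsilon> N (m + e) \<le> \<epsilon> * (p - 1) * real e * real m powr (- p)"
proof -
  have "real m powr (1 - p) - real (m + e) powr (1 - p) \<le> (p - 1) * real e * real m powr (- p)"
  proof (cases "e = 0")
    case False
    have der: "((\<lambda>t. t powr (1 - p)) has_real_derivative (1 - p) * t powr (- p)) (at t)" if "real m \<le> t" for t
      using has_real_derivative_powr[of t "1 - p"] that m by simp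
    obtain z where z: "real m < z" 
      and eq: "real (m + e) powr (1 - p) - real m powr (1 - p) = (real (m + e) - real m) * ((1 - p) * z powr (- p))"
      using MVT2[of "real m" "real (m + e)" "\<lambda>t. t powr (1 - p)" "\<lambda>t. (1 - p) * t powr (- p)"] der False by auto
    have "z powr (- p) \<le> real m powr (- p)" using z m p by (intro powr_mono2') auto
    then have "(p - 1) * real e * z powr (- p) \<le> (p - 1) * real e * real m powr (- p)"
      using p by (intro mult_left_mono) auto
    moreover have "(real (m + e) - real m) * ((1 - p) * z powr (- p)) = - ((p - 1) * real e * z powr (- p))"
      by (simp add: algebra_simps)
    ultimately show ?thesis using eq by linarith
  qed simp
  moreover have "real (m + e) powr (1 - p) \<le> real m powr (1 - p)"
    using m p by (intro powr_mono2') auto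
  moreover have "0 \<le> (p - 1) * real e * real m powr (- p)" using p by simp
  ultimately have "max 0 (real m powr (1 - p) - real N powr (1 - p)) - max 0 (real (m + e) powr (1 - p) - real N powr (1 - p))
     \<le> (p - 1) * real e * real m powr (- p)" by linarith
  from mult_left_mono[OF this \<open>0 \<le> \<epsilon>\<close>] show ?thesis by (simp add: slope_def algebra_simps)
qed

lemma chance_0 [simp]: "chance \<epsilon> N 0 m = 1"
  by (simp add: chance_def)

lemma chance_Suc: "chance \<epsilon> N (Suc e) m = slope \<epsilon> N m * chance \<epsilon> N e (Suc m)"
  unfolding chance_def by (subst prod.lessThan_Suc_shift) simp

lemma chance_Suc_last: "chance \<epsilon> N (Suc e) m = slope \<epsilon> N (m + e) * chance \<epsilon> N e m"
  by (simp add: chance_def)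

lemma chance_nonneg: "0 \<le> \<epsilon> \<Longrightarrow> 0 \<le> chance \<epsilon> N e m"
  unfolding chance_def by (intro prod_nonneg) (auto simp: slope_nonneg)

lemma chance_le_1: "0 \<le> \<epsilon> \<Longrightarrow> \<epsilon> \<le> 1 \<Longrightarrow> chance \<epsilon> N e m \<le> 1"
  unfolding chance_def using slope_nonneg slope_le order_trans by (intro prod_le_1) blast+

lemma chance_horizon: "N \<le> m \<Longrightarrow> 0 < N \<Longrightarrow> 0 < e \<Longrightarrow> chance \<epsilon> N e m = 0"
proof -
  assume "N \<le> m" "0 < N" "0 < e"
  then obtain e' where e: "e = Suc e'" by (cases e) auto
  have "real m powr (1 - p) \<le> real N powr (1 - p)"
    using \<open>N \<le> m\<close> \<open>0 < N\<close> p by (intro powr_mono2') auto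
  then show ?thesis unfolding e chance_Suc by (simp add: slope_def)
qed

text \<open>The expected gain of one step for a family that still lacks \<open>Suc e\<close> nodes: here \<open>R\<close> bounds its weight
  and \<open>W\<close> is the total weight.\<close>

lemma chance_gain:
  assumes m: "0 < m" and W: "0 < W" "W \<le> (2 * real m + 1) powr p" and R: "0 \<le> R" and e: "Suc e \<le> l"
    and \<epsilon>: "0 < \<epsilon>" "\<epsilon> \<le> 1 / (2 + 8 * R)" "\<epsilon> \<le> 1 / (4 * 3 powr p * p * real l)"
  shows "chance \<epsilon> N (Suc e) m - chance \<epsilon> N (Suc e) (Suc m) \<le>
    1 / W * (1 - exp (chance \<epsilon> N (Suc e) (Suc m) - chance \<epsilon> N e (Suc m)))
    - R / W * (exp (chance \<epsilon> N (Suc e) (Suc m)) - 1)"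
proof -
  define P where "P = chance \<epsilon> N e (Suc m)"
  define b where "b = chance \<epsilon> N (Suc e) (Suc m)"
  have "1 / (2 + 8 * R) \<le> 1 / 2" using R by (intro divide_left_mono) auto
  then have \<epsilon>1: "\<epsilon> \<le> 1 / 2" using \<epsilon> by simp
  have P: "0 \<le> P" "P \<le> 1" using \<epsilon> \<epsilon>1 chance_nonneg chance_le_1 by (auto simp: P_def)
  have bP: "b = slope \<epsilon> N (Suc m + e) * P" by (simp add: b_def P_def chance_Suc_last)
  have b: "0 \<le> b" "b \<le> \<epsilon> * P"
    unfolding bP using P \<epsilon> slope_nonneg slope_le by (auto intro!: mult_right_mono mult_nonneg_nonneg)
  have "\<epsilon> * P \<le> 1 / 2 * P" by (rule mult_right_mono[OF \<epsilon>1 P(1)])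
  then have b1: "b \<le> 1 / 2 * P" using b by linarith
  have exp_b: "exp b - 1 \<le> 2 * b" using real_exp_bound_lemma[of b] b b1 P by simp
  have exp_d: "(P - b) / 2 \<le> 1 - exp (b - P)"
  proof -
    define z where "z = P - b"
    have z: "0 \<le> z" "z \<le> 1" using b b1 P by (auto simp: z_def)
    have "z * z \<le> z * 1" using z by (intro mult_left_mono) auto
    then have "1 \<le> (1 + z) * (1 - z / 2)" by (simp add: algebra_simps)
    also have "\<dots> \<le> exp z * (1 - z / 2)"
      using z exp_ge_add_one_self[of z] by (intro mult_right_mono) auto
    finally have "exp (- z) * 1 \<le> exp (- z) * (exp z * (1 - z / 2))" by (rule mult_left_mono) simp
    also have "\<dots> = 1 - z / 2" by (simp add: mult.assoc[symmetric] exp_add[symmetric])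
    finally have "exp (- z) \<le> 1 - z / 2" by (simp only: mult_1_right)
    then show ?thesis unfolding z_def minus_diff_eq by linarith
  qed
  \<comment> \<open>The first bound on \<epsilon>: with \<open>b\<close> at most
    \<open>\<epsilon> * P\<close>, the net gain \<open>(P - b) / 2 - 2 * R * b\<close> is still at
    least \<open>P / 4\<close>.\<close>
  have "\<epsilon> * (2 + 8 * R) \<le> 1" using \<epsilon>(2) R by (simp add: pos_le_divide_eq)
  then have "P * (\<epsilon> * (2 + 8 * R)) \<le> P * 1" by (rule mult_left_mono[OF _ P(1)])
  then have *: "8 * (R * (\<epsilon> * P)) \<le> P - 2 * (\<epsilon> * P)" by (simp add: algebra_simps)
  have "R * b \<le> R * (\<epsilon> * P)" by (rule mult_left_mono[OF b(2) R])
  moreover have "R * (exp b - 1) \<le> 2 * (R * b)"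
    using mult_left_mono[OF exp_b R] by (simp only: mult.left_commute)
  ultimately have gain: "P / 4 \<le> (1 - exp (b - P)) - R * (exp b - 1)"
    using exp_d b * unfolding mult.assoc by argo
  \<comment> \<open>All factors of \<open>P\<close> are common to both products; what remains is the
    difference of two slopes at distance \<open>Suc e\<close>.\<close>
  have "chance \<epsilon> N (Suc e) m - b = P * (slope \<epsilon> N m - slope \<epsilon> N (m + Suc e))"
    by (simp add: bP chance_Suc P_def algebra_simps)
  also have "\<dots> \<le> P * (\<epsilon> * (p - 1) * real (Suc e) * real m powr (- p))"
    using P \<epsilon> slope_diff[OF m, of \<epsilon> N "Suc e"] by (intro mult_left_mono) auto
  \<comment> \<open>The second bound on \<epsilon>: the loss by one unit of time is at most
    \<open>P / 4\<close> times \<open>(3 * m) powr (- p)\<close>, and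
    \<open>2 * m + 1 \<le> 3 * m\<close> makes this at most \<open>P / 4\<close> divided by
    \<open>W\<close>.\<close>
  also have "\<dots> \<le> P * (1 / (4 * 3 powr p) * real m powr (- p))"
  proof (intro mult_left_mono mult_right_mono P)
    have l: "0 < real l" using e by simp
    have "\<epsilon> * (p - 1) * real (Suc e) \<le> \<epsilon> * p * real l"
      using \<epsilon> p e by (intro mult_mono) auto
    also have "\<dots> \<le> 1 / (4 * 3 powr p)"
      using \<epsilon>(3) l p by (simp add: field_simps)
    finally show "\<epsilon> * (p - 1) * real (Suc e) \<le> 1 / (4 * 3 powr p)" .
  qed simp
  also have "\<dots> = P / 4 * (1 / (3 * real m) powr p)"
    using m by (simp add: powr_mult powr_minus_divide)
  also have "\<dots> \<le> P / 4 * (1 / W)"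
  proof (intro mult_left_mono divide_left_mono)
    have "(2 * real m + 1) powr p \<le> (3 * real m) powr p" using m p by (intro powr_mono2) auto
    then show "W \<le> (3 * real m) powr p" using W by linarith
  qed (use P W m in auto)
  also have "\<dots> \<le> ((1 - exp (b - P)) - R * (exp b - 1)) * (1 / W)"
    using gain W by (intro mult_right_mono) auto
  also have "\<dots> = 1 / W * (1 - exp (b - P)) - R / W * (exp b - 1)"
    by (simp add: diff_divide_distrib)
  finally show ?thesis by (simp add: b_def P_def)
qed

end

definition kids :: "(nat \<Rightarrow> nat) \<Rightarrow> nat \<Rightarrow> nat \<Rightarrow> nat \<Rightarrow> nat set" where
  "kids x u a m = {v \<in> {a<..m}. x v = u}"

definition found :: "nat list \<Rightarrow> nat \<Rightarrow> nat \<Rightarrow> nat \<Rightarrow> (nat \<Rightarrow> nat) \<Rightarrow> bool" where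
  "found ds u a m x \<longleftrightarrow> (\<exists>v\<in>kids x u a m. \<exists>n\<le>m. matches x v n ds)"

text \<open>The family has realised an initial segment of the code; a family of \<open>j + 1\<close>
  nodes has used \<open>j\<close> entries.\<close>

definition onpath :: "nat list \<Rightarrow> nat \<Rightarrow> nat \<Rightarrow> (nat \<Rightarrow> nat) \<Rightarrow> bool" where
  "onpath ds v m x \<longleftrightarrow> length (family x v m) \<le> Suc (length ds) \<and>
     matches x v m (take (length (family x v m) - 1) ds)"

lemma finite_kids [simp]: "finite (kids x u a m)"
  by (simp add: kids_def)

lemma determined_kids: "determined m (\<lambda>x. kids x u a m)"
  by (rule determinedI) (auto simp: kids_def)

lemma determined_found: "determined m (found ds u a m)"
proof (rule determinedI)
  fix x y :: "nat \<Rightarrow> nat" assume eq: "\<And>j. 1 \<le> j \<Longrightarrow> j \<le> m \<Longrightarrow> x j = y j"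
  have "kids x u a m = kids y u a m" by (rule determinedD[OF determined_kids]) (use eq in auto)
  moreover have "matches x v n ds = matches y v n ds" if "n \<le> m" for v n
    by (rule determinedD[OF determined_matches]) (use eq that in auto)
  ultimately show "found ds u a m x = found ds u a m y" by (simp add: found_def cong: conj_cong)
qed

lemma determined_onpath: "determined m (onpath ds v m)"
proof (rule determinedI)
  fix x y :: "nat \<Rightarrow> nat" assume eq: "\<And>j. 1 \<le> j \<Longrightarrow> j \<le> m \<Longrightarrow> x j = y j"
  have "family x v m = family y v m" by (rule determinedD[OF determined_family]) (use eq in auto)
  moreover have "matches x v m d = matches y v m d" for d
    by (rule determinedD[OF determined_matches]) (use eq in auto)
  ultimately show "onpath ds v m x = onpath ds v m y" by (auto simp: onpath_def)
qed

lemma kids_upd: "a \<le> m \<Longrightarrow> kids (x(Suc m := y)) u a (Suc m) =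
    (if y = u then insert (Suc m) (kids x u a m) else kids x u a m)"
  by (auto simp: kids_def)

lemma found_upd:
  assumes "a \<le> m" "found ds u a m x"
  shows "found ds u a (Suc m) (x(Suc m := y))"
proof -
  obtain v n where v: "v \<in> kids x u a m" "n \<le> m" "matches x v n ds" using assms by (auto simp: found_def)
  have "matches (x(Suc m := y)) v n ds = matches x v n ds"
    by (rule determinedD[OF determined_matches]) (use v in auto)
  moreover have "v \<in> kids (x(Suc m := y)) u a (Suc m)" using v(1) assms(1) by (simp add: kids_upd)
  ultimately show ?thesis using v(2,3) unfolding found_def by (meson le_SucI)
qed

context superlinear_GN
begin

text \<open>Current lower bound for the chance of completing the code. A family that has left the
  prescribed order is given up and counts 0.\<close>

definition pot :: "real \<Rightarrow> nat \<Rightarrow> nat list \<Rightarrow> nat \<Rightarrow> nat \<Rightarrow> (nat \<Rightarrow> nat) \<Rightarrow> real" where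
  "pot \<epsilon> N ds v m x = (if onpath ds v m x then chance \<epsilon> N (Suc (length ds) - length (family x v m)) m else 0)"

text \<open>Each child of \<open>u\<close> born after \<open>a\<close> contributes a lower bound for its chance of realising the code \<open>ds\<close>
  before the horizon \<open>N\<close>; the children then behave as if their trials were independent.\<close>

definition Pot :: "real \<Rightarrow> nat \<Rightarrow> nat list \<Rightarrow> nat \<Rightarrow> nat \<Rightarrow> nat \<Rightarrow> (nat \<Rightarrow> nat) \<Rightarrow> real" where
  "Pot \<epsilon> N ds u a m x = of_bool (\<not> found ds u a m x) *
     exp (\<Sum>v\<in>kids x u a m. chance \<epsilon> N (length ds) v - pot \<epsilon> N ds v m x)"

lemma determined_Pot: "determined m (Pot \<epsilon> N ds u a m)"
proof (rule determinedI)
  fix x y :: "nat \<Rightarrow> nat" assume eq: "\<And>j. 1 \<le> j \<Longrightarrow> j \<le> m \<Longrightarrow> x j = y j"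
  have "kids x u a m = kids y u a m" by (rule determinedD[OF determined_kids]) (use eq in auto)
  moreover have "found ds u a m x = found ds u a m y" by (rule determinedD[OF determined_found]) (use eq in auto)
  moreover have "pot \<epsilon> N ds v m x = pot \<epsilon> N ds v m y" for v
  proof -
    have on: "onpath ds v m x = onpath ds v m y" by (rule determinedD[OF determined_onpath]) (use eq in auto)
    have fam: "family x v m = family y v m" by (rule determinedD[OF determined_family]) (use eq in auto)
    show ?thesis by (simp only: pot_def on fam)
  qed
  ultimately show "Pot \<epsilon> N ds u a m x = Pot \<epsilon> N ds u a m y" by (simp add: Pot_def)
qed

lemma pot_nonneg: "0 \<le> \<epsilon> \<Longrightarrow> 0 \<le> pot \<epsilon> N ds v m x"
  by (simp add: pot_def chance_nonneg)

lemma pot_birth: "pot \<epsilon> N ds v v x = chance \<epsilon> N (length ds) v"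
  by (simp add: pot_def onpath_def family_birth matches_birth)

lemma onpath_not_found:
  assumes "onpath ds v m x" "v \<in> kids x u a m" "\<not> found ds u a m x"
  shows "length (family x v m) \<le> length ds"
proof (rule ccontr)
  assume "\<not> ?thesis"
  then have "length (family x v m) = Suc (length ds)" using assms(1) unfolding onpath_def by linarith
  then have "matches x v m ds" using assms(1) by (simp add: onpath_def)
  then show False using assms by (auto simp: found_def)
qed

lemma pot_upd_other:
  assumes "v \<le> m" "y \<notin> set (family x v m)"
  shows "pot \<epsilon> N ds v (Suc m) (x(Suc m := y)) =
    (if onpath ds v m x then chance \<epsilon> N (Suc (length ds) - length (family x v m)) (Suc m) else 0)"
  unfolding pot_def onpath_def matches_upd_other[OF assms] ..

lemma pot_upd_grow:
  assumes "v \<le> m" "code ds" "onpath ds v m x" "length (family x v m) \<le> length ds"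
    and y: "y = family x v m ! (ds ! (length (family x v m) - 1))"
  shows "pot \<epsilon> N ds v (Suc m) (x(Suc m := y)) = chance \<epsilon> N (length ds - length (family x v m)) (Suc m)"
proof -
  define j where "j = length (family x v m) - 1"
  have ne: "family x v m \<noteq> []" using family_self[of v m x] assms(1) by auto
  then have j: "length (family x v m) = Suc j" by (simp add: j_def)
  have match: "matches x v m (take j ds)" using assms(3) by (simp add: onpath_def j)
  have *: "matches (x(Suc m := y)) v (Suc m) (take (Suc j) ds)"
    by (rule matches_upd_grow[OF assms(1,2) _ match]) (use assms(4) j y in simp_all)
  then have "length (family (x(Suc m := y)) v (Suc m)) = Suc (Suc j)"
    using assms(4) j by (simp add: matches_def)
  then show ?thesis using * assms(4) j by (simp add: pot_def onpath_def)
qed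

text \<open>A newborn child of \<open>u\<close> contributes 0, and the new node enters at most one
  of the disjoint families. The exponential of the changes therefore linearises to
  \<open>1 + sum of h\<close>, whose mean is controlled by \<open>chance_gain\<close>; finally
  \<open>1 - D \<le> exp (- D)\<close> compensates the deterministic decrease \<open>D\<close> of
  the potentials.\<close>

lemma Pot_step:
  assumes x: "parent_fun x" and a: "0 < a" "a \<le> m" and ds: "code ds"
    and \<epsilon>: "0 < \<epsilon>" "\<epsilon> \<le> 1 / (2 + 8 * real (Suc (length ds)) powr (p + 1))"
      "\<epsilon> \<le> 1 / (4 * 3 powr p * p * real (Suc (length ds)))"
  shows "(\<Sum>y\<le>m. pr x m y * Pot \<epsilon> N ds u a (Suc m) (x(Suc m := y))) \<le> Pot \<epsilon> N ds u a m x"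
proof (cases "found ds u a m x")
  case True
  then show ?thesis using found_upd[OF a(2) True] by (simp add: Pot_def)
next
  case nf: False
  define C where "C = kids x u a m"
  define R where "R = real (Suc (length ds)) powr (p + 1)"
  define L where "L v = length (family x v m)" for v
  define on where "on v = onpath ds v m x" for v
  define b where "b v = (if on v then chance \<epsilon> N (Suc (length ds) - L v) (Suc m) else 0)" for v
  define P where "P v = chance \<epsilon> N (length ds - L v) (Suc m)" for v
  define good where "good v = family x v m ! (ds ! (L v - 1))" for v
  have C: "0 < v" "v \<le> m" "x v = u" if "v \<in> C" for v using that a by (auto simp: C_def kids_def)
  have finC: "finite C" by (simp add: C_def)
  have R0: "0 \<le> R" by (simp add: R_def)
  have "1 / (2 + 8 * R) \<le> 1 / 2" using R0 by (intro divide_left_mono) auto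
  then have \<epsilon>1: "\<epsilon> \<le> 1" using \<epsilon>(2) by (simp add: R_def)
  have L: "0 < L v" if "v \<in> C" for v using family_self[OF C(2)[OF that], of x] by (auto simp: L_def)
  have Lle: "L v \<le> length ds" if "v \<in> C" "on v" for v
    using onpath_not_found[of ds v m x u a] that nf by (auto simp: L_def on_def C_def)
  have b0: "0 \<le> b v" for v using \<epsilon> by (simp add: b_def chance_nonneg)
  have good: "good v \<in> set (family x v m)" if "v \<in> C" "on v" for v
  proof -
    have "ds ! (L v - 1) \<le> L v - 1" using ds Lle[OF that] L[OF that(1)] by (simp add: code_def)
    also have "\<dots> < L v" using L[OF that(1)] by simp
    finally show ?thesis by (simp add: good_def L_def)
  qed
  have bP: "b v \<le> P v" if v: "v \<in> C" "on v" for v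
  proof -
    have e: "Suc (length ds) - L v = Suc (length ds - L v)" using Lle[OF v] by simp
    have "b v = slope \<epsilon> N (Suc m + (length ds - L v)) * P v"
      using v by (simp add: b_def P_def e chance_Suc_last)
    also have "\<dots> \<le> 1 * P v"
    proof (rule mult_right_mono)
      show "slope \<epsilon> N (Suc m + (length ds - L v)) \<le> 1"
        using slope_le[of \<epsilon> N "Suc m + (length ds - L v)"] \<epsilon>(1) \<epsilon>1 by linarith
    qed (use \<epsilon> in \<open>simp add: P_def chance_nonneg\<close>)
    finally show ?thesis by simp
  qed
  define pot' where "pot' y v = pot \<epsilon> N ds v (Suc m) (x(Suc m := y))" for y v
  have pot'0: "0 \<le> pot' y v" for y v using \<epsilon> by (simp add: pot'_def pot_nonneg)
  have pot'_other: "pot' y v = b v" if "v \<in> C" "y \<notin> set (family x v m)" for y v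
    using pot_upd_other[OF C(2)[OF that(1)] that(2)] by (simp add: pot'_def b_def on_def L_def)
  have pot'_good: "pot' (good v) v = P v" if "v \<in> C" "on v" for v
    using pot_upd_grow[OF C(2)[OF that(1)] ds, of x "good v"] that Lle[OF that]
    by (simp add: pot'_def P_def on_def L_def good_def)
  define S where "S = (\<Sum>v\<in>C. chance \<epsilon> N (length ds) v - pot \<epsilon> N ds v m x)"
  define D where "D = (\<Sum>v\<in>C. pot \<epsilon> N ds v m x - b v)"
  \<comment> \<open>The new node destroys the potential \<open>b v\<close> if it joins the family of
    \<open>v\<close>, except at the prescribed position \<open>good v\<close>, where the potential
    rises to \<open>P v\<close>. The second term is subtracted on top of the first, which only
    enlarges the bound.\<close>
  define h where "h y v = of_bool (y \<in> set (family x v m)) * (exp (b v) - 1)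
     - of_bool (on v \<and> y = good v) * (1 - exp (b v - P v))" for y v
  have h_other: "h y v = 0" if "v \<in> C" "y \<notin> set (family x v m)" for y v
    using that good[OF that(1)] by (auto simp: h_def)
  have factor: "exp (\<Sum>v\<in>C. b v - pot' y v) \<le> 1 + (\<Sum>v\<in>C. h y v)" for y
  proof (cases "\<exists>v\<in>C. y \<in> set (family x v m)")
    case False
    then have "(\<Sum>v\<in>C. b v - pot' y v) = 0" "(\<Sum>v\<in>C. h y v) = 0"
      using pot'_other h_other by (auto intro!: sum.neutral)
    then show ?thesis by simp
  next
    case True
    then obtain v where v: "v \<in> C" "y \<in> set (family x v m)" by blast
    have other: "y \<notin> set (family x v' m)" if "v' \<in> C - {v}" for v'
      using families_disjoint[OF x, of v v' m] C[OF v(1)] C[of v'] that v(2) by auto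
    have "(\<Sum>v\<in>C. b v - pot' y v) = (b v - pot' y v) + (\<Sum>v\<in>C - {v}. b v - pot' y v)"
      using finC v by (intro sum.remove) auto
    also have "(\<Sum>v\<in>C - {v}. b v - pot' y v) = 0"
      using other pot'_other by (intro sum.neutral) auto
    finally have 1: "(\<Sum>v\<in>C. b v - pot' y v) = b v - pot' y v" by simp
    have "(\<Sum>v\<in>C. h y v) = h y v + (\<Sum>v\<in>C - {v}. h y v)"
      using finC v by (intro sum.remove) auto
    also have "(\<Sum>v\<in>C - {v}. h y v) = 0"
      using other h_other by (intro sum.neutral) auto
    finally have 2: "(\<Sum>v\<in>C. h y v) = h y v" by simp
    have "exp (b v - pot' y v) \<le> 1 + h y v"
    proof (cases "on v \<and> y = good v")
      case True
      have "1 \<le> exp (b v)" using b0 by simp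
      then show ?thesis using True v pot'_good[OF v(1)] by (simp add: h_def)
    next
      case False
      then show ?thesis using v pot'0[of y v] by (auto simp: h_def)
    qed
    then show ?thesis by (simp only: 1 2)
  qed
  have Pot': "Pot \<epsilon> N ds u a (Suc m) (x(Suc m := y)) \<le> exp (S + D) * (1 + (\<Sum>v\<in>C. h y v))" for y
  proof -
    \<comment> \<open>A child born at this step starts with its full chance as potential, so its
      term is 0 and the sum may be restricted to the old children.\<close>
    have "(\<Sum>v\<in>kids (x(Suc m := y)) u a (Suc m). chance \<epsilon> N (length ds) v - pot' y v)
      = (\<Sum>v\<in>C. chance \<epsilon> N (length ds) v - pot' y v)"
    proof (cases "y = u")
      case True
      have "Suc m \<notin> C" using C(2) by fastforce
      then show ?thesis using True a finC by (simp add: kids_upd C_def[symmetric] pot'_def pot_birth)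
    qed (use a in \<open>simp add: kids_upd C_def[symmetric]\<close>)
    also have "\<dots> = S + D + (\<Sum>v\<in>C. b v - pot' y v)"
      unfolding S_def D_def by (simp add: sum.distrib[symmetric])
    finally have "Pot \<epsilon> N ds u a (Suc m) (x(Suc m := y)) \<le> exp (S + D + (\<Sum>v\<in>C. b v - pot' y v))"
      by (simp add: Pot_def pot'_def)
    also have "\<dots> = exp (S + D) * exp (\<Sum>v\<in>C. b v - pot' y v)" by (simp add: exp_add)
    also have "\<dots> \<le> exp (S + D) * (1 + (\<Sum>v\<in>C. h y v))" by (intro mult_left_mono factor) simp
    finally show ?thesis .
  qed
  have gain: "pot \<epsilon> N ds v m x - b v \<le> - (\<Sum>y\<le>m. pr x m y * h y v)" if v: "v \<in> C" for v
  proof (cases "on v")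
    case False
    then show ?thesis by (simp add: h_def b_def pot_def on_def)
  next
    case True
    note Lv = Lle[OF v True]
    have e: "Suc (length ds) - L v = Suc (length ds - L v)" using Lv by simp
    have W: "0 < wt x m" by (rule wt_pos)
    have gm: "good v \<le> m" using good[OF v True] family_range[of x v m] by auto
    have sub: "{..m} \<inter> set (family x v m) = set (family x v m)" using family_range[of x v m] by auto
    have "(\<Sum>y\<le>m. pr x m y * of_bool (y \<in> set (family x v m))) = (\<Sum>y\<in>{..m} \<inter> set (family x v m). pr x m y)"
      by (simp add: sum.inter_restrict of_bool_def if_distrib cong: if_cong)
    also have "\<dots> = (\<Sum>y\<in>set (family x v m). f (deg x m y)) / wt x m"
      unfolding sub by (simp add: pr_def sum_divide_distrib)
    also have "\<dots> \<le> R / wt x m"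
      using family_weight[OF x, of v m "Suc (length ds)"] Lv W unfolding R_def L_def
      by (intro divide_right_mono) auto
    finally have fam: "(\<Sum>y\<le>m. pr x m y * of_bool (y \<in> set (family x v m))) \<le> R / wt x m" .
    have "(\<Sum>y\<le>m. pr x m y * of_bool (y = good v)) = pr x m (good v)"
      using gm by (simp add: of_bool_def if_distrib sum.delta' cong: if_cong)
    also have "1 / wt x m \<le> \<dots>"
      unfolding pr_def using W p by (intro divide_right_mono ge_one_powr_ge_zero) auto
    finally have gd: "1 / wt x m \<le> (\<Sum>y\<le>m. pr x m y * of_bool (y = good v))" .
    have "pot \<epsilon> N ds v m x - b v = chance \<epsilon> N (Suc (length ds - L v)) m - chance \<epsilon> N (Suc (length ds - L v)) (Suc m)"
      using True by (simp add: pot_def b_def on_def L_def[symmetric] e)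
    also have "\<dots> \<le> 1 / wt x m * (1 - exp (b v - P v)) - R / wt x m * (exp (b v) - 1)"
    proof -
      have "b v = chance \<epsilon> N (Suc (length ds - L v)) (Suc m)" using True by (simp add: b_def e)
      then show ?thesis
        unfolding P_def using chance_gain[of m "wt x m" R "length ds - L v" "Suc (length ds)" \<epsilon> N]
        using a W wt_le_powr[OF x, of m] R0 \<epsilon> by (simp add: R_def)
    qed
    also have "\<dots> \<le> (\<Sum>y\<le>m. pr x m y * of_bool (y = good v)) * (1 - exp (b v - P v))
      - (\<Sum>y\<le>m. pr x m y * of_bool (y \<in> set (family x v m))) * (exp (b v) - 1)"
      using bP[OF v True] b0[of v] by (intro diff_mono mult_right_mono gd fam) auto
    also have "\<dots> = - (\<Sum>y\<le>m. pr x m y * h y v)"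
      unfolding sum_distrib_right sum_subtractf[symmetric] sum_negf[symmetric]
      by (intro sum.cong refl) (simp add: h_def True algebra_simps)
    finally show ?thesis .
  qed
  have "(\<Sum>y\<le>m. pr x m y * Pot \<epsilon> N ds u a (Suc m) (x(Suc m := y)))
    \<le> (\<Sum>y\<le>m. pr x m y * (exp (S + D) * (1 + (\<Sum>v\<in>C. h y v))))"
    by (intro sum_mono mult_left_mono Pot' pr_nonneg)
  also have "\<dots> = exp (S + D) * (\<Sum>y\<le>m. pr x m y * (1 + (\<Sum>v\<in>C. h y v)))"
    by (simp add: sum_distrib_left mult.left_commute)
  also have "(\<Sum>y\<le>m. pr x m y * (1 + (\<Sum>v\<in>C. h y v))) = 1 + (\<Sum>v\<in>C. \<Sum>y\<le>m. pr x m y * h y v)"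
  proof -
    have "(\<Sum>y\<le>m. pr x m y * (1 + (\<Sum>v\<in>C. h y v))) = (\<Sum>y\<le>m. pr x m y) + (\<Sum>y\<le>m. \<Sum>v\<in>C. pr x m y * h y v)"
      by (simp add: ring_distribs sum.distrib sum_distrib_left)
    then show ?thesis unfolding sum_pr using sum.swap[of "\<lambda>y v. pr x m y * h y v" C "{..m}"] by simp
  qed
  also have "\<dots> \<le> 1 - D"
  proof -
    have "D \<le> (\<Sum>v\<in>C. - (\<Sum>y\<le>m. pr x m y * h y v))" unfolding D_def by (intro sum_mono gain)
    then show ?thesis by (simp add: sum_negf)
  qed
  also have "\<dots> \<le> exp (- D)" using exp_ge_add_one_self[of "- D"] by simp
  also have "exp (S + D) * exp (- D) = exp S" by (simp add: exp_add[symmetric])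
  also have "\<dots> = Pot \<epsilon> N ds u a m x" using nf by (simp add: Pot_def S_def C_def)
  finally show ?thesis by this (simp_all add: mult_left_mono)
qed

text \<open>At the horizon every unfinished family has potential 0, so the exponent becomes the full
  sum of the initial chances. At time \<open>a\<close> there are no children to consider and the
  supermartingale starts at 1.\<close>

lemma Pot_horizon:
  assumes a: "0 < a" "a \<le> N" and ds: "code ds"
    and \<epsilon>: "0 < \<epsilon>" "\<epsilon> \<le> 1 / (2 + 8 * real (Suc (length ds)) powr (p + 1))"
      "\<epsilon> \<le> 1 / (4 * 3 powr p * p * real (Suc (length ds)))"
  shows "(\<integral>\<omega>. of_bool (\<not> found ds u a N (X \<omega>)) * exp (\<Sum>v\<in>kids (X \<omega>) u a N. chance \<epsilon> N (length ds) v) \<partial>M) \<le> 1"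
proof -
  have "of_bool (\<not> found ds u a N x) * exp (\<Sum>v\<in>kids x u a N. chance \<epsilon> N (length ds) v) = Pot \<epsilon> N ds u a N x" for x
  proof (cases "found ds u a N x")
    case False
    have "pot \<epsilon> N ds v N x = 0" if "v \<in> kids x u a N" for v
      using onpath_not_found[OF _ that False] a by (auto simp: pot_def intro!: chance_horizon)
    then show ?thesis using False by (simp add: Pot_def)
  qed (simp add: Pot_def)
  then have "(\<integral>\<omega>. of_bool (\<not> found ds u a N (X \<omega>)) * exp (\<Sum>v\<in>kids (X \<omega>) u a N. chance \<epsilon> N (length ds) v) \<partial>M)
    = (\<integral>\<omega>. Pot \<epsilon> N ds u a N (X \<omega>) \<partial>M)" by simp
  also have "\<dots> \<le> (\<integral>\<omega>. Pot \<epsilon> N ds u a a (X \<omega>) \<partial>M)"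
    using supermartingale[of a "\<lambda>n. Pot \<epsilon> N ds u a n" "\<lambda>_. True" N] determined_Pot Pot_step a ds \<epsilon> by simp
  also have "\<dots> \<le> (\<integral>\<omega>. 1 \<partial>M)"
    by (rule integral_mono[OF integrable_determined[OF determined_Pot]]) (auto simp: Pot_def kids_def)
  finally show ?thesis by (simp add: prob_space)
qed

text \<open>Each of the \<open>e\<close> factors is at least \<open>\<epsilon> / 2\<close> times
  \<open>(v + e) powr (1 - p)\<close>; the condition on \<open>e\<close> says that their product is
  still at least of order \<open>1 / (v + e)\<close>.\<close>

lemma chance_lower:
  assumes e: "(p - 1) * real e \<le> 1" and v: "0 < v" and \<epsilon>: "0 \<le> \<epsilon>"
    and N: "real N powr (1 - p) \<le> real (v + e) powr (1 - p) / 2"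
  shows "(\<epsilon> / 2) ^ e / real (v + e) \<le> chance \<epsilon> N e v"
proof -
  have "(\<epsilon> / 2) ^ e / real (v + e) = (\<epsilon> / 2) ^ e * real (v + e) powr (- 1)"
    using v by (simp add: powr_minus_divide)
  also have "\<dots> \<le> (\<epsilon> / 2) ^ e * real (v + e) powr (real e * (1 - p))"
    using e v \<epsilon> by (intro mult_left_mono powr_mono) (auto simp: algebra_simps)
  also have "\<dots> = (\<Prod>i<e. \<epsilon> / 2 * real (v + e) powr (1 - p))"
  proof -
    have "real (v + e) powr (real e * (1 - p)) = (real (v + e) powr (1 - p)) ^ e"
      using v by (simp add: powr_power)
    then show ?thesis by (simp only: power_mult_distrib[symmetric] prod_constant card_lessThan)
  qed
  also have "\<dots> \<le> chance \<epsilon> N e v"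
    unfolding chance_def
  proof (intro prod_mono conjI)
    fix i assume "i \<in> {..<e}"
    then have "real (v + e) powr (1 - p) \<le> real (v + i) powr (1 - p)"
      using v p by (intro powr_mono2') auto
    then have "real (v + e) powr (1 - p) / 2 \<le> max 0 (real (v + i) powr (1 - p) - real N powr (1 - p))"
      using N by linarith
    from mult_left_mono[OF this \<epsilon>] show "\<epsilon> / 2 * real (v + e) powr (1 - p) \<le> slope \<epsilon> N (v + i)"
      by (simp add: slope_def)
  qed (use \<epsilon> in simp)
  finally show ?thesis .
qed

text \<open>Markov's inequality for \<open>Pot_horizon\<close>: never succeeding while the harmonic
  sum over the children reaches \<open>A\<close> has probability at most
  \<open>exp (- (c * A))\<close>. The chances add up as if the trials were independent.\<close>

lemma prob_not_found:
  assumes a: "0 < a" and ds: "code ds" "(p - 1) * real (length ds) \<le> 1"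
  shows "prob {\<omega>\<in>space M. (\<forall>n. \<not> found ds u a n (X \<omega>)) \<and>
    (\<forall>A::nat. \<exists>n. real A \<le> (\<Sum>v\<in>kids (X \<omega>) u a n. 1 / real (v + length ds)))} = 0" (is "prob ?B = 0")
proof -
  define l where "l = length ds"
  define \<epsilon> where "\<epsilon> = min (1 / (2 + 8 * real (Suc l) powr (p + 1))) (1 / (4 * 3 powr p * p * real (Suc l)))"
  have \<epsilon>: "0 < \<epsilon>" "\<epsilon> \<le> 1 / (2 + 8 * real (Suc (length ds)) powr (p + 1))"
    "\<epsilon> \<le> 1 / (4 * 3 powr p * p * real (Suc (length ds)))"
    using p by (auto simp: \<epsilon>_def l_def intro!: add_pos_nonneg)
  define c where "c = (\<epsilon> / 2) ^ l"
  have c: "0 < c" using \<epsilon> by (simp add: c_def)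
  define s where "s x n = (\<Sum>v\<in>kids x u a n. 1 / real (v + l))" for x n
  have s_det: "determined n (\<lambda>x. s x n)" for n
    unfolding s_def by (rule determined_comp[OF determined_kids])
  have [measurable]: "(\<lambda>\<omega>. s (X \<omega>) n) \<in> measurable M (count_space UNIV)" 
      "Measurable.pred M (\<lambda>\<omega>. found ds u a n (X \<omega>))" for n
    using determined_measurable[OF s_det] determined_sets[OF determined_found, of ds u a n] by (auto simp: pred_def)
  let ?Q = "\<lambda>A n. {\<omega>\<in>space M. (\<forall>n. \<not> found ds u a n (X \<omega>)) \<and> A \<le> s (X \<omega>) n}"
  have Q: "prob (?Q A n) \<le> exp (- (c * A))" for A n
  proof -
    \<comment> \<open>The horizon is taken so late that truncation costs every child born up to
      \<open>n\<close> at most half of each slope.\<close>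
    have "((\<lambda>N. real N powr (1 - p)) \<longlongrightarrow> 0) sequentially"
      using p by (intro tendsto_neg_powr filterlim_real_sequentially) auto
    then have "eventually (\<lambda>N. real N powr (1 - p) < real (n + l + 1) powr (1 - p) / 2) sequentially"
      by (rule order_tendstoD) simp
    then have "eventually (\<lambda>N. real N powr (1 - p) < real (n + l + 1) powr (1 - p) / 2 \<and> max a n \<le> N) sequentially"
      using eventually_ge_at_top[of "max a n"] by eventually_elim simp
    then obtain N where N: "real N powr (1 - p) < real (n + l + 1) powr (1 - p) / 2" "a \<le> N" "n \<le> N"
      by (auto simp: eventually_sequentially)
    let ?F = "\<lambda>x. of_bool (\<not> found ds u a N x) * exp (\<Sum>v\<in>kids x u a N. chance \<epsilon> N (length ds) v)"
    have F: "determined N ?F"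
      by (rule determined_comp2[OF determined_found determined_kids])
    have "indicator (?Q A n) \<omega> * exp (c * A) \<le> ?F (X \<omega>)" for \<omega>
    proof (cases "\<omega> \<in> ?Q A n")
      case True
      then have "c * A \<le> c * s (X \<omega>) n" using c by (intro mult_left_mono) auto
      also have "\<dots> = (\<Sum>v\<in>kids (X \<omega>) u a n. c / real (v + l))" by (simp add: s_def sum_distrib_left)
      also have "\<dots> \<le> (\<Sum>v\<in>kids (X \<omega>) u a n. chance \<epsilon> N (length ds) v)"
      proof (rule sum_mono)
        fix v assume "v \<in> kids (X \<omega>) u a n"
        then have v: "0 < v" "v \<le> n" by (auto simp: kids_def)
        have "real (n + l + 1) powr (1 - p) \<le> real (v + l) powr (1 - p)"
          using v p by (intro powr_mono2') auto
        then show "c / real (v + l) \<le> chance \<epsilon> N (length ds) v"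
          unfolding c_def l_def using N v ds \<epsilon> by (intro chance_lower) (auto simp: l_def)
      qed
      also have "\<dots> \<le> (\<Sum>v\<in>kids (X \<omega>) u a N. chance \<epsilon> N (length ds) v)"
        using N \<epsilon> by (intro sum_mono2) (auto simp: kids_def chance_nonneg)
      finally show ?thesis using True by simp
    qed simp
    then have "(\<integral>\<omega>. indicator (?Q A n) \<omega> * exp (c * A) \<partial>M) \<le> (\<integral>\<omega>. ?F (X \<omega>) \<partial>M)"
      by (intro integral_mono integrable_determined[OF F] integrable_mult_left integrable_real_indicator)
         (auto simp: less_top[symmetric])
    also have "\<dots> \<le> 1" using Pot_horizon[OF a N(2) ds(1) \<epsilon>] .
    finally show ?thesis by (simp add: exp_minus field_simps)
  qed
  have "prob ?B \<le> exp (- (c * real A))" for A :: nat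
  proof -
    have "incseq (?Q A)"
    proof (rule incseq_SucI, safe)
      fix n \<omega> assume "real A \<le> s (X \<omega>) n"
      also have "s (X \<omega>) n \<le> s (X \<omega>) (Suc n)"
        unfolding s_def by (intro sum_mono2) (auto simp: kids_def)
      finally show "real A \<le> s (X \<omega>) (Suc n)" .
    qed
    then have "(\<lambda>n. prob (?Q A n)) \<longlonglongrightarrow> prob (\<Union>n. ?Q A n)"
      by (intro finite_Lim_measure_incseq) auto
    then have "prob (\<Union>n. ?Q A n) \<le> exp (- (c * real A))" by (rule LIMSEQ_le_const2) (use Q in auto)
    moreover have "prob ?B \<le> prob (\<Union>n. ?Q A n)"
    proof (rule finite_measure_mono)
      show "(\<Union>n. ?Q A n) \<in> sets M" by measurable
    qed (auto simp: s_def l_def)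
    ultimately show ?thesis by simp
  qed
  moreover have "(\<lambda>A. exp (- (c * real A))) \<longlonglongrightarrow> 0"
    using c by real_asymp
  ultimately have "prob ?B \<le> 0" by (intro LIMSEQ_le_const) auto
  then show ?thesis by (simp add: measure_le_0_iff)
qed

end

section \<open>Completed families that never change again\<close>

definition lin :: "nat \<Rightarrow> (nat \<Rightarrow> nat) \<Rightarrow> nat \<Rightarrow> bool" where
  "lin C x u \<longleftrightarrow> (\<forall>m. m \<le> C * (deg x m u + 1))"

definition settled :: "(nat \<Rightarrow> nat) \<Rightarrow> nat \<Rightarrow> nat list \<Rightarrow> bool" where
  "settled x v ds \<longleftrightarrow> (\<exists>n0. \<forall>n\<ge>n0. matches x v n ds)"

lemma deg_le_card_kids: "deg x n u \<le> card (kids x u a n) + a"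
proof -
  have "deg x n u \<le> card (kids x u a n \<union> {1..a})"
    unfolding deg_def by (rule card_mono) (auto simp: kids_def)
  also have "\<dots> \<le> card (kids x u a n) + card {1..a}" by (rule card_Un_le)
  finally show ?thesis by simp
qed

text \<open>Blocks as for the harmonic series: if \<open>n\<close> is about \<open>2 * C\<close>
  times the previous endpoint, at least \<open>n / (2 * C)\<close> children are born inside the
  block, each contributing at least \<open>1 / (2 * n)\<close>, so every block adds
  \<open>1 / (4 * C)\<close>.\<close>

lemma lin_diverges:
  assumes "lin C x u"
  shows "\<exists>n. real A \<le> (\<Sum>v\<in>kids x u a n. 1 / real (v + l))"
proof -
  have C: "0 < C" using assms[unfolded lin_def, THEN spec, of 1] by (cases C) auto
  define s where "s n = (\<Sum>v\<in>kids x u a n. 1 / real (v + l))" for n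
  have s_mono: "s n \<le> s n'" if "n \<le> n'" for n n'
    unfolding s_def using that by (intro sum_mono2) (auto simp: kids_def)
  have "\<exists>n. real j / (4 * real C) \<le> s n" for j
  proof (induction j)
    case 0
    have "0 \<le> s 0" by (simp add: s_def sum_nonneg)
    then show ?case by auto
  next
    case (Suc j)
    then obtain n1 where "real j / (4 * real C) \<le> s n1" by blast
    then have n0: "real j / (4 * real C) \<le> s (max n1 a)" using s_mono[of n1 "max n1 a"] by simp
    define n0 where "n0 = max n1 a"
    define n where "n = 2 * C * (n0 + 1) + l"
    have "n0 \<le> 2 * C * (n0 + 1)" using C by (cases C) auto
    then have n: "n0 \<le> n" "l \<le> n" "a \<le> n0" by (auto simp: n_def n0_def)
    have "n \<le> C * (deg x n u + 1)" using assms by (simp add: lin_def)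
    also have "\<dots> \<le> C * (card (kids x u n0 n) + n0 + 1)"
      using deg_le_card_kids[of x n u n0] by (intro mult_left_mono) auto
    finally have "real n \<le> real (C * (card (kids x u n0 n) + n0 + 1))" by linarith
    moreover have "2 * real C * (real n0 + 1) \<le> real n" by (simp add: n_def algebra_simps)
    ultimately have card: "real n \<le> 2 * real C * real (card (kids x u n0 n))"
      by (simp add: algebra_simps)
    have npos: "0 < n" using C by (simp add: n_def)
    have "1 / (4 * real C) \<le> real (card (kids x u n0 n)) * (1 / (2 * real n))"
      using card C npos by (simp add: field_simps)
    also have "\<dots> = (\<Sum>v\<in>kids x u n0 n. 1 / (2 * real n))" by simp
    also have "\<dots> \<le> (\<Sum>v\<in>kids x u n0 n. 1 / real (v + l))"
      using n by (intro sum_mono divide_left_mono) (auto simp: kids_def)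
    finally have "real j / (4 * real C) + 1 / (4 * real C) \<le> s n0 + (\<Sum>v\<in>kids x u n0 n. 1 / real (v + l))"
      using n0 unfolding n0_def by linarith
    also have "\<dots> = s n"
    proof -
      have "kids x u a n = kids x u a n0 \<union> kids x u n0 n" "kids x u a n0 \<inter> kids x u n0 n = {}"
        using n by (auto simp: kids_def)
      then show ?thesis unfolding s_def by (simp add: sum.union_disjoint)
    qed
    also have "real j / (4 * real C) + 1 / (4 * real C) = real (Suc j) / (4 * real C)"
      by (simp add: add_divide_distrib)
    finally show ?case by blast
  qed
  from this[of "4 * C * A"] show ?thesis using C by (simp add: s_def)
qed

text \<open>An adapted choice of one completed family, never revised afterwards. It turns a stopping
  time into a running value, so that the later fate of this family can be followed by a counter
  started at the fixed time \<open>a\<close>.\<close>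

primrec first :: "nat list \<Rightarrow> nat \<Rightarrow> nat \<Rightarrow> (nat \<Rightarrow> nat) \<Rightarrow> nat \<Rightarrow> nat option" where
  "first ds u a x 0 = None"
| "first ds u a x (Suc n) = (case first ds u a x n of Some v \<Rightarrow> Some v
     | None \<Rightarrow> if \<exists>v\<in>kids x u a (Suc n). matches x v (Suc n) ds
         then Some (LEAST v. v \<in> kids x u a (Suc n) \<and> matches x v (Suc n) ds) else None)"

lemma determined_first: "determined m (\<lambda>x. first ds u a x m)"
proof (induction m)
  case (Suc m)
  show ?case
  proof (rule determinedI)
    fix x y :: "nat \<Rightarrow> nat" assume eq: "\<And>j. 1 \<le> j \<Longrightarrow> j \<le> Suc m \<Longrightarrow> x j = y j"
    have 1: "first ds u a x m = first ds u a y m" by (rule determinedD[OF Suc]) (use eq in auto)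
    have 2: "kids x u a (Suc m) = kids y u a (Suc m)" by (rule determinedD[OF determined_kids]) (use eq in auto)
    have 3: "matches x v (Suc m) ds = matches y v (Suc m) ds" for v
      by (rule determinedD[OF determined_matches]) (use eq in auto)
    show "first ds u a x (Suc m) = first ds u a y (Suc m)" by (simp only: first.simps 1 2 3)
  qed
qed (simp add: determined_def)

lemma first_mono: "n \<le> n' \<Longrightarrow> first ds u a x n = Some v \<Longrightarrow> first ds u a x n' = Some v"
  by (induction n' rule: dec_induct) auto

lemma first_matches:
  "first ds u a x n = Some v \<Longrightarrow> v \<in> kids x u a n \<and> (\<exists>n'\<le>n. matches x v n' ds)"
proof (induction n)
  case (Suc n)
  show ?case
  proof (cases "first ds u a x n")
    case None
    then have ex: "\<exists>v. v \<in> kids x u a (Suc n) \<and> matches x v (Suc n) ds"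
      and v: "v = (LEAST v. v \<in> kids x u a (Suc n) \<and> matches x v (Suc n) ds)"
      using Suc.prems by (auto split: if_splits)
    from LeastI_ex[OF ex] show ?thesis unfolding v by blast
  next
    case (Some v')
    then have "v \<in> kids x u a n \<and> (\<exists>n'\<le>n. matches x v n' ds)" using Suc by simp
    then show ?thesis by (auto simp: kids_def intro: le_SucI)
  qed
qed simp

lemma found_first:
  assumes "found ds u a n x"
  shows "first ds u a x n \<noteq> None"
proof -
  obtain v m where v: "v \<in> kids x u a n" "m \<le> n" "matches x v m ds" using assms by (auto simp: found_def)
  have "v \<le> m" by (rule matches_born[OF v(3)])
  then obtain m' where m: "m = Suc m'" using v(1) by (cases m) (auto simp: kids_def)
  have "v \<in> kids x u a m" using v(1) \<open>v \<le> m\<close> by (auto simp: kids_def)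
  then have "first ds u a x m \<noteq> None" using v(3) unfolding m by (auto split: option.split)
  then show ?thesis using first_mono[OF v(2)] by force
qed

lemma first_early: "n \<le> a \<Longrightarrow> first ds u a x n = None"
  by (induction n) (auto simp: kids_def)

text \<open>The first completed family keeps its shape for ever if and only if \<open>excess\<close> stays \<open>0\<close>.\<close>

definition excess :: "nat list \<Rightarrow> nat \<Rightarrow> nat \<Rightarrow> nat \<Rightarrow> (nat \<Rightarrow> nat) \<Rightarrow> nat" where
  "excess ds u a n x = (case first ds u a x n of None \<Rightarrow> 0 | Some v \<Rightarrow> length (family x v n) - Suc (length ds))"

lemma determined_excess: "determined n (excess ds u a n)"
proof (rule determinedI)
  fix x y :: "nat \<Rightarrow> nat" assume eq: "\<And>j. 1 \<le> j \<Longrightarrow> j \<le> n \<Longrightarrow> x j = y j"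
  have 1: "first ds u a x n = first ds u a y n" by (rule determinedD[OF determined_first]) (use eq in auto)
  have 2: "family x v n = family y v n" for v by (rule determinedD[OF determined_family]) (use eq in auto)
  show "excess ds u a n x = excess ds u a n y" by (simp only: excess_def 1 2)
qed

lemma not_excess_settled:
  assumes "first ds u a x n0 = Some v" and "\<And>n. a \<le> n \<Longrightarrow> excess ds u a n x = 0"
  shows "settled x v ds"
  unfolding settled_def
proof (intro exI allI impI)
  fix n assume n: "n0 \<le> n"
  obtain m where m: "m \<le> n0" "matches x v m ds" and v: "v \<in> kids x u a n0" using first_matches[OF assms(1)] by blast
  have "a \<le> n" using v n by (auto simp: kids_def)
  then have "length (family x v n) \<le> Suc (length ds)"
    using assms(2)[of n] first_mono[OF n assms(1)] by (simp add: excess_def)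
  moreover obtain ys where "family x v n = family x v m @ ys"
    using family_extends[of m n v x] m n matches_born[OF m(2)] by auto
  ultimately have "family x v n = family x v m" using m(2) by (auto simp: matches_def)
  then show "matches x v n ds" using m(2) by (simp add: matches_def)
qed

context superlinear_GN
begin

text \<open>Before a family is selected nothing can raise the counter, and afterwards the weight at
  risk is that of a family with at most \<open>Suc (length ds)\<close> nodes. The degree condition
  at time \<open>a\<close> makes \<open>g\<close> of the maximal degree small when \<open>a\<close>
  is large.\<close>

lemma prob_excess:
  assumes C: "0 < C" and a: "0 < a"
  shows "prob {\<omega>\<in>space M. a \<le> C * (deg (X \<omega>) a u + 1) \<and> (\<exists>n\<ge>a. 1 \<le> excess ds u a n (X \<omega>))}
    \<le> real (Suc (length ds)) powr (p + 1) * (2 powr p / (p - 1) * (real a / real C) powr (1 - p))"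
    (is "_ \<le> ?R * ?\<gamma>")
proof -
  define H where "H x \<longleftrightarrow> a \<le> C * (deg x a u + 1)" for x
  have H: "determined a H" unfolding H_def by (rule determined_comp[OF determined_deg])
  have "prob {\<omega>\<in>space M. H (X \<omega>) \<and> (\<exists>n\<ge>a. 1 \<le> excess ds u a n (X \<omega>))}
    \<le> prob {\<omega>\<in>space M. H (X \<omega>)} * (?R * ?\<gamma>) ^ 1"
  proof (rule counter_bound[where B = "\<lambda>n x. case first ds u a x n of None \<Rightarrow> {} | Some v \<Rightarrow> set (family x v n)"])
    fix n assume n: "a \<le> n"
    show "determined n (excess ds u a n)" by (rule determined_excess)
    fix x assume x: "parent_fun x"
    have first: "first ds u a (x(Suc n := y)) n = first ds u a x n" for y
      by (rule determinedD[OF determined_first]) auto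
    show "excess ds u a n x \<le> excess ds u a (Suc n) (x(Suc n := y))"
      "excess ds u a (Suc n) (x(Suc n := y)) \<le> excess ds u a n x +
         of_bool (y \<in> (case first ds u a x n of None \<Rightarrow> {} | Some v \<Rightarrow> set (family x v n)))" for y
    proof -
      show "excess ds u a n x \<le> excess ds u a (Suc n) (x(Suc n := y))"
      proof (cases "first ds u a x n")
        case (Some v)
        then have "v \<le> n" using first_matches by (fastforce simp: kids_def)
        then show ?thesis using Some first[of y] family_upd[of x n y v] by (simp add: excess_def diff_le_mono2 del: family.simps)
      qed (simp add: excess_def)
      show "excess ds u a (Suc n) (x(Suc n := y)) \<le> excess ds u a n x +
         of_bool (y \<in> (case first ds u a x n of None \<Rightarrow> {} | Some v \<Rightarrow> set (family x v n)))"
      proof (cases "first ds u a x n")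
        case (Some v)
        then have "v \<le> n" using first_matches by (fastforce simp: kids_def)
        then show ?thesis using Some first[of y] family_upd[of x n y v] by (simp add: excess_def del: family.simps) arith
      next
        \<comment> \<open>A family selected at this very step matches the code exactly, so the
          counter starts at 0.\<close>
        case None
        show ?thesis
        proof (cases "first ds u a (x(Suc n := y)) (Suc n)")
          case (Some v)
          then have ex: "\<exists>v. v \<in> kids (x(Suc n := y)) u a (Suc n) \<and> matches (x(Suc n := y)) v (Suc n) ds"
            and v: "v = (LEAST v. v \<in> kids (x(Suc n := y)) u a (Suc n) \<and> matches (x(Suc n := y)) v (Suc n) ds)"
            using None first[of y] by (auto simp del: fun_upd_apply split: if_splits)
          have "matches (x(Suc n := y)) v (Suc n) ds" using LeastI_ex[OF ex] unfolding v[symmetric] by blast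
          then have "excess ds u a (Suc n) (x(Suc n := y)) = 0"
            using Some by (simp add: excess_def matches_def del: first.simps family.simps)
          then show ?thesis by simp
        qed (simp add: excess_def del: first.simps)
      qed
    qed
    assume e: "excess ds u a n x < 1"
    show "(\<Sum>y\<in>{..n} \<inter> (case first ds u a x n of None \<Rightarrow> {} | Some v \<Rightarrow> set (family x v n)). f (deg x n y)) \<le> ?R"
    proof (cases "first ds u a x n")
      case (Some v)
      have "{..n} \<inter> set (family x v n) = set (family x v n)" using family_range[of x v n] by auto
      moreover have "length (family x v n) \<le> Suc (length ds)" using e Some by (simp add: excess_def)
      ultimately show ?thesis using family_weight[OF x, of v n "Suc (length ds)"] Some by simp
    qed simp
  next
    fix x assume x: "parent_fun x" and Hx: "H x"
    have "real a \<le> real (C * (deg x a u + 1))" using Hx unfolding H_def by linarith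
    then have "real a / real C \<le> real (deg x a u) + 1" using C by (simp add: field_simps)
    also have "\<dots> \<le> real (mx x a) + 1" using deg_le_mx[OF x, of a u] by simp
    finally have "(real (mx x a) + 1) powr (1 - p) \<le> (real a / real C) powr (1 - p)"
      using a C p by (intro powr_mono2') auto
    then have "g (mx x a) \<le> ?\<gamma>" unfolding g_def using p by (intro mult_left_mono) auto
    then show "excess ds u a a x = 0 \<and> g (mx x a) \<le> ?\<gamma>" by (simp add: excess_def first_early)
  qed (use H in auto)
  also have "\<dots> \<le> 1 * (?R * ?\<gamma>)"
    unfolding power_one_right by (rule mult_right_mono[OF prob_le_1]) (use p in simp)
  finally show ?thesis by (simp add: H_def)
qed

text \<open>Beyond any bound some child of the hub must settle: after a late time \<open>a\<close>
  the code is almost surely completed, and the first completed family is disturbed only with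
  probability tending to 0 in \<open>a\<close>.\<close>

lemma AE_infinite_settled:
  assumes ds: "code ds" "(p - 1) * real (length ds) \<le> 1"
  shows "AE \<omega> in M. \<forall>C u. lin C (X \<omega>) u \<longrightarrow> infinite {v. X \<omega> v = u \<and> settled (X \<omega>) v ds}"
proof -
  have mm [measurable]: "Measurable.pred M (\<lambda>\<omega>. matches (X \<omega>) v n ds)"
     "Measurable.pred M (\<lambda>\<omega>. found ds u a n (X \<omega>))"
     "(\<lambda>\<omega>. excess ds u a n (X \<omega>)) \<in> measurable M (count_space UNIV)"
     "Measurable.pred M (\<lambda>\<omega>. lin C (X \<omega>) u)" for v n u a C
    using determined_sets[OF determined_matches, of v n ds] determined_sets[OF determined_found, of ds u a n]
      determined_measurable[OF determined_excess, of ds u a n]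
    unfolding lin_def by (auto simp: pred_def) measurable
  have [measurable]: "Measurable.pred M (\<lambda>\<omega>. settled (X \<omega>) v ds)" for v
    unfolding settled_def by measurable
  have "AE \<omega> in M. lin C (X \<omega>) u \<longrightarrow> (\<exists>v>a0. X \<omega> v = u \<and> settled (X \<omega>) v ds)" for C u a0
  proof (cases "C = 0")
    case True
    have "\<not> lin 0 x u" for x unfolding lin_def by (auto intro: exI[of _ 1])
    then show ?thesis using True by simp
  next
    case False
    then have C: "0 < C" by simp
    let ?B = "\<lambda>a. {\<omega>\<in>space M. lin C (X \<omega>) u \<and> \<not> (\<exists>v>a. X \<omega> v = u \<and> settled (X \<omega>) v ds)}"
    define \<gamma> where "\<gamma> a = real (Suc (length ds)) powr (p + 1) * (2 powr p / (p - 1) * (real a / real C) powr (1 - p))" for a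
    \<comment> \<open>The left side does not depend on \<open>a\<close>; letting \<open>a\<close>
      grow shows that the event is null.\<close>
    have bound: "prob (?B a0) \<le> \<gamma> a" if a: "max 1 a0 \<le> a" for a
    proof -
      let ?N = "{\<omega>\<in>space M. (\<forall>n. \<not> found ds u a n (X \<omega>)) \<and>
        (\<forall>A::nat. \<exists>n. real A \<le> (\<Sum>v\<in>kids (X \<omega>) u a n. 1 / real (v + length ds)))}"
      let ?E = "{\<omega>\<in>space M. a \<le> C * (deg (X \<omega>) a u + 1) \<and> (\<exists>n\<ge>a. 1 \<le> excess ds u a n (X \<omega>))}"
      have km [measurable]: "(\<lambda>\<omega>. (\<Sum>v\<in>kids (X \<omega>) u a n. 1 / real (v + length ds))) \<in> measurable M (count_space UNIV)" for n
        by (rule determined_measurable[OF determined_comp[OF determined_kids]])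
      have sets: "?N \<in> sets M" "?E \<in> sets M" by measurable
      have "?B a0 \<subseteq> ?N \<union> ?E"
      proof
        fix \<omega> assume \<omega>: "\<omega> \<in> ?B a0"
        then have \<omega>': "\<omega> \<in> space M" "lin C (X \<omega>) u" by auto
        show "\<omega> \<in> ?N \<union> ?E"
        proof (cases "\<forall>n. \<not> found ds u a n (X \<omega>)")
          case True
          then show ?thesis using \<omega>' lin_diverges[OF \<omega>'(2)] by simp
        next
          case False
          then obtain n v where v: "first ds u a (X \<omega>) n = Some v" using found_first by blast
          have "v \<in> kids (X \<omega>) u a n" using first_matches[OF v] by blast
          then have "a0 < v" "X \<omega> v = u" using a by (auto simp: kids_def)
          then have "\<not> settled (X \<omega>) v ds" using \<omega> by blast
          then have "\<exists>n\<ge>a. excess ds u a n (X \<omega>) \<noteq> 0" using not_excess_settled[OF v] by blast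
          then have "\<exists>n\<ge>a. 1 \<le> excess ds u a n (X \<omega>)" by (simp add: Suc_le_eq)
          moreover have "a \<le> C * (deg (X \<omega>) a u + 1)" using \<omega>' by (simp only: lin_def)
          ultimately show ?thesis using \<omega>' by blast
        qed
      qed
      then have "prob (?B a0) \<le> prob (?N \<union> ?E)" using sets by (intro finite_measure_mono) auto
      also have "\<dots> \<le> prob ?N + prob ?E" using sets by (rule measure_Un_le)
      also have "prob ?N = 0" using a ds by (intro prob_not_found) auto
      also have "prob ?E \<le> \<gamma> a" unfolding \<gamma>_def using a C by (intro prob_excess) auto
      finally show ?thesis by simp
    qed
    have "filterlim (\<lambda>a. real a / real C) at_top sequentially" using C by real_asymp
    then have "(\<lambda>a. (real a / real C) powr (1 - p)) \<longlonglongrightarrow> 0"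
      using p by (intro tendsto_neg_powr) auto
    then have "\<gamma> \<longlonglongrightarrow> 0" unfolding \<gamma>_def by (intro tendsto_mult_right_zero)
    then have "prob (?B a0) \<le> 0"
      by (rule LIMSEQ_le_const) (intro exI[of _ "max 1 a0"] allI impI bound)
    then have "prob (?B a0) = 0" by (simp add: measure_le_0_iff)
    moreover have "?B a0 \<in> sets M" by measurable
    ultimately have "AE \<omega> in M. \<omega> \<notin> ?B a0"
      by (intro AE_not_in null_setsI) (simp_all add: emeasure_eq_measure)
    then show ?thesis by (rule AE_mp) (rule AE_I2, blast)
  qed
  then have "AE \<omega> in M. \<forall>C u a0. lin C (X \<omega>) u \<longrightarrow> (\<exists>v>a0. X \<omega> v = u \<and> settled (X \<omega>) v ds)"
    by (simp only: AE_all_countable) simp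
  then show ?thesis
    by (rule AE_mp) (rule AE_I2, simp add: infinite_nat_iff_unbounded)
qed

end

section \<open>The shape of the limit tree\<close>

definition fam :: "(nat \<Rightarrow> nat) \<Rightarrow> nat \<Rightarrow> nat set" where
  "fam x v = (\<Union>m. set (family x v m))"

text \<open>Here \<open>F\<close> and \<open>u\<close> play the roles of \<open>T\<close> and \<open>v\<close> in \<open>Glue T v k\<close>.\<close>

definition core :: "(nat \<Rightarrow> nat) \<Rightarrow> nat \<Rightarrow> nat \<Rightarrow> nat set \<Rightarrow> bool" where
  "core x k u F \<longleftrightarrow> finite F \<and> 0 \<in> F \<and> u \<in> F \<and> (\<forall>j>0. j \<in> F \<longrightarrow> x j \<in> F) \<and>
     (\<forall>j>0. j \<notin> F \<longrightarrow> x j \<in> F \<longrightarrow> x j = u) \<and> (\<forall>j. j \<notin> F \<longrightarrow> x j = u \<longrightarrow> \<not> big k x j)"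

lemma fam_self: "v \<in> fam x v"
  unfolding fam_def using family_self[of v v x] by blast

lemma fam_ge: "j \<in> fam x v \<Longrightarrow> v \<le> j"
proof -
  assume "j \<in> fam x v"
  then obtain m where "j \<in> set (family x v m)" by (auto simp: fam_def)
  then show "v \<le> j" using family_range[of x v m] by auto
qed

lemma fam_child:
  assumes x: "parent_fun x" and j: "0 < j" "x j \<in> fam x v" shows "j \<in> fam x v"
proof -
  obtain m where m: "x j \<in> set (family x v m)" using j(2) unfolding fam_def by (rule UN_E)
  have "set (family x v m) \<subseteq> set (family x v (max m j))" by (rule set_family_mono[OF max.cobounded1])
  from family_child[OF x _ _ subsetD[OF this m]] have "j \<in> set (family x v (max m j))"
    using j(1) by simp
  then show ?thesis unfolding fam_def by blast
qed

lemma fam_parent: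
  assumes "j \<in> fam x v" "j \<noteq> v" shows "0 < j" "x j \<in> fam x v"
proof -
  obtain m where "j \<in> set (family x v m)" using assms by (auto simp: fam_def)
  then have "0 < j \<and> x j \<in> fam x v"
  proof (induction m)
    case (Suc m)
    then show ?case using assms(2) by (auto simp: fam_def split: if_splits)
  qed (use assms in \<open>auto split: if_splits\<close>)
  then show "0 < j" "x j \<in> fam x v" by auto
qed

lemma fam_0:
  assumes x: "parent_fun x" shows "fam x 0 = UNIV"
proof -
  have "j \<in> fam x 0" for j
  proof (induction j rule: less_induct)
    case (less j)
    then show ?case using fam_self fam_child[OF x, of j 0] parent_funD[OF x, of j] by (cases "j = 0") auto
  qed
  then show ?thesis by auto
qed

lemma not_big_card:
  assumes "\<not> big k x v"
  shows "finite (fam x v)" "card (fam x v) \<le> k" "\<exists>n0. \<forall>n\<ge>n0. fam x v = set (family x v n)"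
proof -
  have len: "length (family x v n) \<le> k" for n using assms by (auto simp: big_def not_less)
  have fin: "finite (range (\<lambda>n. length (family x v n)))"
    by (rule finite_subset[of _ "{..k}"]) (use len in auto)
  obtain n0 where n0: "length (family x v n0) = Max (range (\<lambda>n. length (family x v n)))"
    using Max_in[OF fin] by force
  have max: "length (family x v n) \<le> length (family x v n0)" for n
    unfolding n0 using fin by (rule Max_ge) simp
  have "1 \<le> length (family x v n0)" using max[of v] by (simp add: family_birth)
  then have v: "v \<le> n0" using family_unborn[of n0 v x] by (cases "v \<le> n0") auto
  have eq: "family x v n = family x v n0" if n: "n0 \<le> n" for n
    using family_extends[OF n v, of x] max[of n] by auto
  have "set (family x v n) \<subseteq> set (family x v n0)" for n
    using set_family_mono[of n "max n n0" x v] eq[of "max n n0"] by simp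
  then have fam: "fam x v = set (family x v n0)" unfolding fam_def by blast
  show "finite (fam x v)" "card (fam x v) \<le> k"
    using card_length[of "family x v n0"] len[of n0] by (simp_all add: fam)
  show "\<exists>n0. \<forall>n\<ge>n0. fam x v = set (family x v n)" using fam eq by metis
qed

lemma big_iff: "big k x v \<longleftrightarrow> infinite (fam x v) \<or> k < card (fam x v)"
proof
  assume "big k x v"
  then obtain n where n: "k < length (family x v n)" by (auto simp: big_def)
  have "set (family x v n) \<subseteq> fam x v" by (auto simp: fam_def)
  then have "length (family x v n) \<le> card (fam x v)" if "finite (fam x v)"
    using card_mono[OF that \<open>set (family x v n) \<subseteq> fam x v\<close>] distinct_card[OF distinct_family[of x v n]] by simp
  then show "infinite (fam x v) \<or> k < card (fam x v)" using n by force
qed (use not_big_card[of k x v] in force)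

lemma hub_iff: "hub x u \<longleftrightarrow> infinite {j. 0 < j \<and> x j = u}"
proof
  assume hub: "hub x u"
  show "infinite {j. 0 < j \<and> x j = u}"
  proof
    assume fin: "finite {j. 0 < j \<and> x j = u}"
    obtain m where "Suc (card {j. 0 < j \<and> x j = u}) \<le> deg x m u" using hub by (auto simp: hub_def)
    moreover have "deg x m u \<le> card {j. 0 < j \<and> x j = u}"
      unfolding deg_def by (rule card_mono[OF fin]) auto
    ultimately show False by simp
  qed
next
  assume inf: "infinite {j. 0 < j \<and> x j = u}"
  show "hub x u"
    unfolding hub_def
  proof
    fix N
    obtain S where S: "S \<subseteq> {j. 0 < j \<and> x j = u}" "finite S" "card S = N"
      using infinite_arbitrarily_large[OF inf] by blast
    obtain m where "S \<subseteq> {..m}" using S(2) finite_nat_iff_bounded_le by blast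
    then have "card S \<le> deg x m u"
      unfolding deg_def using S by (intro card_mono) (auto simp: Suc_le_eq)
    then show "\<exists>m. N \<le> deg x m u" using S by auto
  qed
qed

text \<open>Walking from \<open>j\<close> towards the root, \<open>y\<close> is the last node before
  the path first enters \<open>A\<close>.\<close>

lemma exists_top:
  assumes x: "parent_fun x" and "0 \<in> A" and "j \<notin> A"
  shows "\<exists>y>0. y \<notin> A \<and> x y \<in> A \<and> j \<in> fam x y"
  using assms(3)
proof (induction j rule: less_induct)
  case (less j)
  have j: "0 < j" using less.prems assms(2) by (cases j) auto
  show ?case
  proof (cases "x j \<in> A")
    case True
    then show ?thesis using j less.prems fam_self by blast
  next
    case False
    then obtain y where "0 < y" "y \<notin> A" "x y \<in> A" "x j \<in> fam x y"
      using less.IH[OF parent_funD[OF x j]] by blast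
    then show ?thesis using fam_child[OF x j] by blast
  qed
qed

text \<open>The set \<open>A\<close> of nodes with more than \<open>K\<close> descendants is finite
  and contains the root. If no node of \<open>A\<close> had infinitely many children, only finitely
  many finite families would hang from \<open>A\<close> and the whole tree would be finite. So
  \<open>A\<close> contains the hub \<open>u\<close>, and \<open>F\<close> is what remains after
  cutting off all branches of at most \<open>k\<close> nodes at \<open>u\<close>.\<close>

lemma core_exists:
  assumes x: "parent_fun x" and fin: "finite {v. big K x v}"
    and uniq: "\<And>u v. hub x u \<Longrightarrow> hub x v \<Longrightarrow> u = v"
    and big: "\<And>u. finite {t. 0 < t \<and> x t = u \<and> big k x t}"
  shows "\<exists>u F. core x k u F"
proof -
  define A where "A = {v. big K x v}"
  have finA: "finite A" using fin by (simp add: A_def)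
  have A0: "0 \<in> A" using fam_0[OF x] by (simp add: A_def big_iff)
  have fam_fin: "finite (fam x y)" if "y \<notin> A" for y using that not_big_card(1) by (simp add: A_def)
  have "\<exists>u\<in>A. hub x u"
  proof (rule ccontr)
    assume "\<not> ?thesis"
    then have "finite {y. 0 < y \<and> x y = u}" if "u \<in> A" for u using that by (auto simp: hub_iff)
    then have "finite (\<Union>u\<in>A. {y. 0 < y \<and> x y = u} - A)" using finA by auto
    then have "finite (\<Union>y\<in>(\<Union>u\<in>A. {y. 0 < y \<and> x y = u} - A). fam x y)"
      using fam_fin by auto
    moreover have "UNIV \<subseteq> A \<union> (\<Union>y\<in>(\<Union>u\<in>A. {y. 0 < y \<and> x y = u} - A). fam x y)"
      using exists_top[OF x A0] by blast
    ultimately have "finite (UNIV :: nat set)" using finA finite_subset by blast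
    then show False by simp
  qed
  then obtain u where u: "u \<in> A" "hub x u" by blast
  have others: "finite {y. 0 < y \<and> x y = v}" if "v \<noteq> u" for v
    using uniq[OF u(2)] that by (auto simp: hub_iff)
  define F where "F = {j. \<not> (\<exists>c>0. x c = u \<and> \<not> big k x c \<and> j \<in> fam x c)}"
  \<comment> \<open>Tops of the families outside \<open>A\<close> that survive in \<open>F\<close>:
    children of the other members of \<open>A\<close>, finitely many as these are no hubs, and big
    children of \<open>u\<close>, finitely many by hypothesis.\<close>
  define Y where "Y = (\<Union>v\<in>A - {u}. {y. 0 < y \<and> x y = v} - A) \<union> ({t. 0 < t \<and> x t = u \<and> big k x t} - A)"
  have finY: "finite Y" unfolding Y_def using finA others big by auto
  have "F \<subseteq> A \<union> (\<Union>y\<in>Y. fam x y)"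
  proof
    fix j assume j: "j \<in> F"
    show "j \<in> A \<union> (\<Union>y\<in>Y. fam x y)"
    proof (cases "j \<in> A")
      case False
      then obtain y where y: "0 < y" "y \<notin> A" "x y \<in> A" "j \<in> fam x y" using exists_top[OF x A0] by blast
      have "y \<in> Y"
      proof (cases "x y = u")
        case True
        then have "big k x y" using j y unfolding F_def by blast
        then show ?thesis using y True by (simp add: Y_def)
      qed (use y in \<open>simp add: Y_def\<close>)
      then show ?thesis using y by blast
    qed simp
  qed
  moreover have "finite (A \<union> (\<Union>y\<in>Y. fam x y))"
    using finA finY fam_fin by (auto simp: Y_def)
  ultimately have "finite F" by (rule finite_subset)
  moreover have "0 \<in> F"
  proof -
    have "0 \<notin> fam x c" if "0 < c" for c using fam_ge[of 0 x c] that by auto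
    then show ?thesis unfolding F_def by blast
  qed
  moreover have uF: "u \<in> F"
  proof -
    have "u \<notin> fam x c" if "0 < c" "x c = u" for c
      using fam_ge[of u x c] parent_funD[OF x that(1)] that(2) by auto
    then show ?thesis unfolding F_def by blast
  qed
  moreover have "x j \<in> F" if "0 < j" "j \<in> F" for j
    using that fam_child[OF x that(1)] unfolding F_def by blast
  moreover have good: "x j = u \<and> \<not> big k x j" if "j \<notin> F" "x j \<in> F" for j
  proof -
    have "\<exists>c>0. x c = u \<and> \<not> big k x c \<and> j \<in> fam x c" using that(1) unfolding F_def mem_Collect_eq not_not .
    then obtain c where c: "c > 0" "x c = u" "\<not> big k x c" "j \<in> fam x c" by blast
    have "j = c"
    proof (rule ccontr)
      assume "j \<noteq> c"
      then have "x j \<in> fam x c" by (rule fam_parent(2)[OF c(4)])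
      then have "x j \<notin> F" using c unfolding F_def by blast
      then show False using that(2) by simp
    qed
    then show ?thesis using c by simp
  qed
  moreover have "\<not> big k x j" if "j \<notin> F" "x j = u" for j using good[OF that(1)] that uF by simp
  ultimately show ?thesis unfolding core_def by blast
qed

lemma core_top:
  assumes x: "parent_fun x" and core: "core x k u F" and j: "j \<notin> F"
  obtains c where "0 < c" "c \<notin> F" "x c = u" "j \<in> fam x c" "\<not> big k x c"
proof -
  have "0 \<in> F" using core by (simp add: core_def)
  then obtain c where "0 < c" "c \<notin> F" "x c \<in> F" "j \<in> fam x c" using exists_top[OF x _ j] by blast
  then show ?thesis using core that by (auto simp: core_def)
qed

text \<open>Each node up to \<open>m\<close> is in \<open>F\<close> or in a branch of at most
  \<open>k\<close> nodes whose root is a child of \<open>u\<close> born by time \<open>m\<close>.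
  This supplies the positive density of the hub's children.\<close>

lemma core_lin:
  assumes x: "parent_fun x" and core: "core x k u F"
  shows "\<exists>C. lin C x u"
proof
  show "lin (card F + k) x u"
    unfolding lin_def
  proof
    fix m
    have finF: "finite F" using core by (simp add: core_def)
    let ?S = "{c \<in> {1..m}. x c = u}"
    let ?G = "{c \<in> ?S. \<not> big k x c}"
    have "{..m} \<subseteq> F \<union> (\<Union>c\<in>?G. fam x c)"
    proof
      fix j assume j: "j \<in> {..m}"
      show "j \<in> F \<union> (\<Union>c\<in>?G. fam x c)"
      proof (cases "j \<in> F")
        case False
        then obtain c where c: "0 < c" "x c = u" "j \<in> fam x c" "\<not> big k x c" using core_top[OF x core] by metis
        then have "c \<le> m" using fam_ge[of j x c] j by simp
        then show ?thesis using c by (auto simp: Suc_le_eq)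
      qed simp
    qed
    then have "card {..m} \<le> card (F \<union> (\<Union>c\<in>?G. fam x c))"
      using finF not_big_card(1) by (intro card_mono) auto
    also have "\<dots> \<le> card F + card (\<Union>c\<in>?G. fam x c)" by (rule card_Un_le)
    also have "card (\<Union>c\<in>?G. fam x c) \<le> (\<Sum>c\<in>?G. card (fam x c))" by (rule card_UN_le) auto
    also have "\<dots> \<le> (\<Sum>c\<in>?G. k)" by (rule sum_mono) (use not_big_card(2) in auto)
    also have "\<dots> \<le> k * deg x m u"
    proof -
      have "card ?G \<le> card ?S" by (rule card_mono) auto
      then have "k * card ?G \<le> k * card ?S" by (rule mult_le_mono2)
      then show ?thesis unfolding deg_def sum_constant by (simp only: mult.commute of_nat_id)
    qed
    finally have "m + 1 \<le> card F + k * deg x m u" by simp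
    also have "\<dots> \<le> (card F + k) * (deg x m u + 1)" by (simp add: algebra_simps)
    finally show "m \<le> (card F + k) * (deg x m u + 1)" by simp
  qed
qed

context superlinear_GN
begin

lemma AE_core:
  assumes k: "1 < (p - 1) * real k"
  shows "AE \<omega> in M. \<exists>u F. core (X \<omega>) k u F"
proof -
  obtain K :: nat where "8 / (p - 1) < real K" using reals_Archimedean2 by blast
  then have K: "8 < (p - 1) * real K" using p by (simp add: field_simps)
  show ?thesis
    using AE_finite_big[OF K] AE_unique_hub AE_finite_big_children[OF k] AE_space
  proof eventually_elim
    case (elim \<omega>)
    show ?case
      by (rule core_exists[OF parent_fun_X[OF elim(4)] elim(1)]) (use elim in blast)+
  qed
qed

end

section \<open>Isomorphisms\<close>

definition is_iso :: "('a \<Rightarrow> 'b) \<Rightarrow> 'a rtree \<Rightarrow> 'b rtree \<Rightarrow> bool" where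
  "is_iso \<phi> S T \<longleftrightarrow> bij_betw \<phi> (nodes S) (nodes T) \<and> \<phi> (root S) = root T \<and>
     (\<forall>a\<in>nodes S. \<forall>b\<in>nodes S. (a, b) \<in> edges S \<longleftrightarrow> (\<phi> a, \<phi> b) \<in> edges T)"

lemma rtree_iso_iff: "rtree_iso S T \<longleftrightarrow> (\<exists>\<phi>. is_iso \<phi> S T)"
  by (simp add: rtree_iso_def is_iso_def)

lemma is_iso_id: "is_iso id T T"
  by (simp add: is_iso_def)

lemma is_iso_comp: "is_iso \<phi> R S \<Longrightarrow> is_iso \<psi> S T \<Longrightarrow> is_iso (\<psi> \<circ> \<phi>) R T"
  unfolding is_iso_def using bij_betw_trans bij_betwE by (metis comp_apply)

lemma is_iso_inv:
  assumes "is_iso \<phi> S T" "root S \<in> nodes S"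
  shows "is_iso (inv_into (nodes S) \<phi>) T S"
proof -
  have bij: "bij_betw \<phi> (nodes S) (nodes T)" using assms by (simp add: is_iso_def)
  have mem: "inv_into (nodes S) \<phi> y \<in> nodes S" and inv: "\<phi> (inv_into (nodes S) \<phi> y) = y" if "y \<in> nodes T" for y
    using bij_betw_imp_surj_on[OF bij] that by (auto intro: inv_into_into f_inv_into_f)
  have "root T = \<phi> (root S)" using assms(1) by (simp add: is_iso_def)
  then have "inv_into (nodes S) \<phi> (root T) = root S"
    using inv_into_f_f[OF bij_betw_imp_inj_on[OF bij] assms(2)] by simp
  moreover have "(a, b) \<in> edges T \<longleftrightarrow> (inv_into (nodes S) \<phi> a, inv_into (nodes S) \<phi> b) \<in> edges S"
    if "a \<in> nodes T" "b \<in> nodes T" for a b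
    using assms(1) mem[OF that(1)] mem[OF that(2)] inv[OF that(1)] inv[OF that(2)] by (simp add: is_iso_def)
  ultimately show ?thesis using bij_betw_inv_into[OF bij] by (simp add: is_iso_def)
qed

lemma rtree_iso_sym:
  assumes "rtree_iso S T" "root S \<in> nodes S"
  shows "rtree_iso T S"
proof -
  obtain \<phi> where "is_iso \<phi> S T" using assms(1) unfolding rtree_iso_iff ..
  from is_iso_inv[OF this assms(2)] show ?thesis
    unfolding rtree_iso_iff by (rule exI[of "\<lambda>\<phi>. is_iso \<phi> T S"])
qed

lemma rtree_iso_trans:
  assumes "rtree_iso R S" "rtree_iso S T"
  shows "rtree_iso R T"
proof -
  obtain \<phi> \<psi> where "is_iso \<phi> R S" "is_iso \<psi> S T" using assms unfolding rtree_iso_iff by (elim exE)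
  from is_iso_comp[OF this] show ?thesis
    unfolding rtree_iso_iff by (rule exI[of "\<lambda>\<phi>. is_iso \<phi> R T"])
qed

lemma iso_class_eq:
  assumes "rtree_iso S T" "root S \<in> nodes S"
  shows "iso_class S = iso_class T"
proof -
  have "rtree_iso R S \<longleftrightarrow> rtree_iso R T" for R :: "nat rtree"
    using rtree_iso_trans[of R S T] rtree_iso_trans[of R T S] assms rtree_iso_sym[OF assms] by blast
  then show ?thesis by (simp add: iso_class_def)
qed

lemma iso_class_self: "rooted_tree S \<Longrightarrow> S \<in> iso_class S"
  unfolding iso_class_def rtree_iso_iff by (simp add: exI[of _ id] is_iso_id)

text \<open>Preserving edges in one direction is enough: a node other than the root has a parent in
  the source and at most one in the target, so no further edge can appear.\<close>

lemma iso_by_edges: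
  assumes bij: "bij_betw \<phi> (nodes S) (nodes T)" and root: "\<phi> (root S) = root T"
    and fwd: "\<And>a b. (a, b) \<in> edges S \<Longrightarrow> (\<phi> a, \<phi> b) \<in> edges T"
    and parent: "\<And>a. a \<in> nodes S \<Longrightarrow> a \<noteq> root S \<Longrightarrow> \<exists>b\<in>nodes S. (a, b) \<in> edges S"
    and single: "\<And>a b c. (a, b) \<in> edges T \<Longrightarrow> (a, c) \<in> edges T \<Longrightarrow> b = c"
    and no_root: "\<And>b. (root T, b) \<notin> edges T"
  shows "is_iso \<phi> S T"
  unfolding is_iso_def
proof (intro conjI ballI iffI bij root)
  fix a b assume ab: "a \<in> nodes S" "b \<in> nodes S" and e: "(\<phi> a, \<phi> b) \<in> edges T"
  have "a \<noteq> root S" using e no_root root by metis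
  then obtain b' where b': "b' \<in> nodes S" "(a, b') \<in> edges S" using parent ab by blast
  have "\<phi> b = \<phi> b'" by (rule single[OF e fwd[OF b'(2)]])
  then have "b = b'" using bij_betw_imp_inj_on[OF bij] ab b' by (auto dest: inj_onD)
  then show "(a, b) \<in> edges S" using b' by simp
qed (rule fwd)

lemma rooted_treeD:
  assumes "rooted_tree T"
  shows "root T \<in> nodes T" "(a, b) \<in> edges T \<Longrightarrow> a \<in> nodes T \<and> b \<in> nodes T" "(root T, b) \<notin> edges T"
    "(a, b) \<in> edges T \<Longrightarrow> (a, c) \<in> edges T \<Longrightarrow> b = c" "a \<in> nodes T \<Longrightarrow> (a, root T) \<in> (edges T)\<^sup>*"
    "a \<in> nodes T \<Longrightarrow> a \<noteq> root T \<Longrightarrow> \<exists>b\<in>nodes T. (a, b) \<in> edges T"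
proof -
  show 1: "root T \<in> nodes T" "(a, b) \<in> edges T \<Longrightarrow> a \<in> nodes T \<and> b \<in> nodes T" for a b
    using assms by (auto simp: rooted_tree_def)
  show 2: "(root T, b) \<notin> edges T" "a \<in> nodes T \<Longrightarrow> (a, root T) \<in> (edges T)\<^sup>*" for a b
    using assms by (simp_all add: rooted_tree_def)
  have ex1: "a \<in> nodes T \<Longrightarrow> a \<noteq> root T \<Longrightarrow> \<exists>!b. (a, b) \<in> edges T" for a
    using assms by (simp add: rooted_tree_def)
  show "(a, b) \<in> edges T \<Longrightarrow> (a, c) \<in> edges T \<Longrightarrow> b = c"
    using 1(2) 2(1) ex1 by metis
  show "a \<in> nodes T \<Longrightarrow> a \<noteq> root T \<Longrightarrow> \<exists>b\<in>nodes T. (a, b) \<in> edges T"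
    using 1(2) ex1 by blast
qed

section \<open>Trees given by parent functions and by codes\<close>

definition full_tree :: "(nat \<Rightarrow> nat) \<Rightarrow> nat rtree" where
  "full_tree x = \<lparr> nodes = UNIV, edges = {(j, x j) | j. 0 < j}, root = 0 \<rparr>"

definition sub_tree :: "(nat \<Rightarrow> nat) \<Rightarrow> nat set \<Rightarrow> nat rtree" where
  "sub_tree x F = \<lparr> nodes = F, edges = {(j, x j) | j. j \<in> F \<and> 0 < j}, root = 0 \<rparr>"

definition branch :: "(nat \<Rightarrow> nat) \<Rightarrow> nat \<Rightarrow> nat rtree" where
  "branch x c = \<lparr> nodes = fam x c, edges = {(j, x j) | j. j \<in> fam x c \<and> j \<noteq> c}, root = c \<rparr>"

definition code_tree :: "nat list \<Rightarrow> nat rtree" where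
  "code_tree ds = \<lparr> nodes = {..length ds}, edges = {(Suc i, ds ! i) | i. i < length ds}, root = 0 \<rparr>"

lemma full_tree_simps [simp]:
  "nodes (full_tree x) = UNIV" "root (full_tree x) = 0" "(a, b) \<in> edges (full_tree x) \<longleftrightarrow> 0 < a \<and> b = x a"
  by (auto simp: full_tree_def)

lemma sub_tree_simps [simp]:
  "nodes (sub_tree x F) = F" "root (sub_tree x F) = 0"
  "(a, b) \<in> edges (sub_tree x F) \<longleftrightarrow> a \<in> F \<and> 0 < a \<and> b = x a"
  by (auto simp: sub_tree_def)

lemma branch_simps [simp]:
  "nodes (branch x c) = fam x c" "root (branch x c) = c"
  "(a, b) \<in> edges (branch x c) \<longleftrightarrow> a \<in> fam x c \<and> a \<noteq> c \<and> b = x a"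
  by (auto simp: branch_def)

lemma code_tree_simps [simp]:
  "nodes (code_tree ds) = {..length ds}" "root (code_tree ds) = 0"
  "(a, b) \<in> edges (code_tree ds) \<longleftrightarrow> (\<exists>i<length ds. a = Suc i \<and> b = ds ! i)"
  by (auto simp: code_tree_def)

lemma rooted_full_tree:
  assumes x: "parent_fun x" shows "rooted_tree (full_tree x)"
proof -
  have "(j, 0) \<in> (edges (full_tree x))\<^sup>*" for j
  proof (induction j rule: less_induct)
    case (less j)
    show ?case
    proof (cases "j = 0")
      case False
      then have "(j, x j) \<in> edges (full_tree x)" by simp
      then show ?thesis using less.IH[OF parent_funD[OF x, of j]] False by (meson converse_rtrancl_into_rtrancl not_gr_zero)
    qed simp
  qed
  then show ?thesis by (auto simp: rooted_tree_def)
qed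

lemma rooted_branch:
  assumes x: "parent_fun x" shows "rooted_tree (branch x c)"
proof -
  have "(j, c) \<in> (edges (branch x c))\<^sup>*" if "j \<in> fam x c" for j
    using that
  proof (induction j rule: less_induct)
    case (less j)
    show ?case
    proof (cases "j = c")
      case False
      note p = fam_parent[OF less.prems False]
      have "(j, x j) \<in> edges (branch x c)" using False less.prems by simp
      then show ?thesis using less.IH[OF parent_funD[OF x p(1)] p(2)] by (rule converse_rtrancl_into_rtrancl)
    qed simp
  qed
  then show ?thesis using fam_self fam_parent(2) by (auto simp: rooted_tree_def)
qed

lemma rtrancl_enters:
  assumes "(y, r) \<in> E\<^sup>*" "y \<notin> I" "r \<in> I"
  shows "\<exists>a b. (a, b) \<in> E \<and> a \<notin> I \<and> b \<in> I"
  using assms by (induction rule: converse_rtrancl_induct) blast+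

text \<open>Nodes are enumerated one by one: while some are missing, the path from a missing node to
  the root contains an edge entering the set already enumerated, and its tail is taken next. Every
  parent thus precedes its child.\<close>

lemma code_exists:
  assumes S: "finite_rooted_tree S"
  shows "\<exists>ds \<phi>. code ds \<and> is_iso \<phi> (code_tree ds) S"
proof -
  have rS: "rooted_tree S" and fin: "finite (nodes S)" using S by (auto simp: finite_rooted_tree_def)
  have "\<exists>ds \<phi>. length ds = n \<and> code ds \<and> inj_on \<phi> {..n} \<and> \<phi> ` {..n} \<subseteq> nodes S \<and> \<phi> 0 = root S \<and>
      (\<forall>i<n. (\<phi> (Suc i), \<phi> (ds ! i)) \<in> edges S)" if "n < card (nodes S)" for n
    using that
  proof (induction n)
    case 0
    show ?case using rooted_treeD(1)[OF rS] by (intro exI[of _ "[]"] exI[of _ "\<lambda>_. root S"]) (auto simp: code_def)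
  next
    case (Suc n)
    then obtain ds \<phi> where ds: "length ds = n" "code ds" and \<phi>: "inj_on \<phi> {..n}" "\<phi> ` {..n} \<subseteq> nodes S" "\<phi> 0 = root S"
      and e: "\<And>i. i < n \<Longrightarrow> (\<phi> (Suc i), \<phi> (ds ! i)) \<in> edges S" by auto
    have "card (\<phi> ` {..n}) = Suc n" using card_image[OF \<phi>(1)] by simp
    then have "\<phi> ` {..n} \<noteq> nodes S" using Suc.prems by auto
    then obtain y0 where "y0 \<in> nodes S" "y0 \<notin> \<phi> ` {..n}" using \<phi>(2) by blast
    moreover have "root S \<in> \<phi> ` {..n}" using \<phi>(3) by force
    ultimately obtain a b where ab: "(a, b) \<in> edges S" "a \<notin> \<phi> ` {..n}" "b \<in> \<phi> ` {..n}"
      using rtrancl_enters[OF rooted_treeD(5)[OF rS]] by blast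
    then obtain j where j: "j \<le> n" "b = \<phi> j" by auto
    let ?ds = "ds @ [j]"
    define \<phi>' where "\<phi>' = \<phi>(Suc n := a)"
    have "inj_on \<phi>' {..Suc n}"
      using \<phi>(1) ab(2) by (auto simp: atMost_Suc inj_on_def \<phi>'_def)
    moreover have "\<phi>' ` {..Suc n} \<subseteq> nodes S"
      using \<phi>(2) rooted_treeD(2)[OF rS ab(1)] by (auto simp: atMost_Suc \<phi>'_def)
    moreover have "code ?ds" using ds j by (auto simp: code_def nth_append less_Suc_eq)
    moreover have "(\<phi>' (Suc i), \<phi>' (?ds ! i)) \<in> edges S" if "i < Suc n" for i
    proof (cases "i = n")
      case True
      then show ?thesis using ab j ds by (simp add: nth_append \<phi>'_def)
    next
      case False
      then have "i < n" using that by simp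
      moreover have "ds ! i \<le> i" using ds \<open>i < n\<close> by (simp add: code_def)
      ultimately show ?thesis using e[of i] ds by (simp add: nth_append \<phi>'_def)
    qed
    moreover have "\<phi>' 0 = root S" "length ?ds = Suc n" using \<phi>(3) ds by (simp_all add: \<phi>'_def)
    ultimately show ?case by blast
  qed
  moreover have c: "0 < card (nodes S)" using rooted_treeD(1)[OF rS] fin by (auto simp: card_gt_0_iff)
  ultimately obtain ds \<phi> where ds: "length ds = card (nodes S) - 1" "code ds"
    and \<phi>: "inj_on \<phi> {..length ds}" "\<phi> ` {..length ds} \<subseteq> nodes S" "\<phi> 0 = root S"
      and e: "\<And>i. i < length ds \<Longrightarrow> (\<phi> (Suc i), \<phi> (ds ! i)) \<in> edges S" 
    by (metis diff_less zero_less_one)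
  have "card (\<phi> ` {..length ds}) = card (nodes S)" using card_image[OF \<phi>(1)] ds c by simp
  then have "\<phi> ` {..length ds} = nodes S" using \<phi>(2) fin by (simp add: card_subset_eq)
  then have "bij_betw \<phi> {..length ds} (nodes S)" using \<phi>(1) by (simp add: bij_betw_def)
  then have "is_iso \<phi> (code_tree ds) S"
  proof (intro iso_by_edges)
    fix a assume a: "a \<in> nodes (code_tree ds)" "a \<noteq> root (code_tree ds)"
    then obtain i where i: "a = Suc i" "i < length ds" by (cases a) auto
    then have "ds ! i \<le> i" using ds by (simp add: code_def)
    then show "\<exists>b\<in>nodes (code_tree ds). (a, b) \<in> edges (code_tree ds)" using i by auto
  qed (use \<phi> e rooted_treeD[OF rS] in auto)
  then show ?thesis using ds by blast
qed

lemma rooted_code_tree: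
  assumes ds: "code ds" shows "finite_rooted_tree (code_tree ds)"
proof -
  have "(j, 0) \<in> (edges (code_tree ds))\<^sup>*" if "j \<le> length ds" for j
    using that
  proof (induction j rule: less_induct)
    case (less j)
    show ?case
    proof (cases j)
      case (Suc i)
      then have i: "ds ! i \<le> i" "i < length ds" using ds less.prems by (auto simp: code_def)
      then have "(j, ds ! i) \<in> edges (code_tree ds)" using Suc by auto
      moreover have "(ds ! i, 0) \<in> (edges (code_tree ds))\<^sup>*" using i Suc by (intro less.IH) auto
      ultimately show ?thesis by (rule converse_rtrancl_into_rtrancl)
    qed simp
  qed
  moreover have "\<exists>!y. (j, y) \<in> edges (code_tree ds)" if "j \<le> length ds" "j \<noteq> 0" for j
    using that by (cases j) auto
  moreover have "edges (code_tree ds) \<subseteq> nodes (code_tree ds) \<times> nodes (code_tree ds)"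
    using ds by (fastforce simp: code_def)
  ultimately show ?thesis by (auto simp: finite_rooted_tree_def rooted_tree_def)
qed

text \<open>A family that matches for ever has a constant list from some time on; sending positions
  to list entries is the isomorphism.\<close>

lemma settled_branch:
  assumes x: "parent_fun x" and settled: "settled x v ds" and ds: "code ds"
  shows "rtree_iso (branch x v) (code_tree ds)"
proof -
  obtain n0 where n0: "\<And>n. n0 \<le> n \<Longrightarrow> matches x v n ds" using settled by (auto simp: settled_def)
  define n where "n = max n0 v"
  define L where "L = family x v n"
  have n: "n0 \<le> n" "v \<le> n" by (auto simp: n_def)
  have m: "matches x v n ds" using n0 n by simp
  then have len: "length L = Suc (length ds)" by (simp add: matches_def L_def)
  have "set (family x v m) \<subseteq> set L" for m
  proof -
    have "length (family x v (max n m)) = length L" using n0[of "max n m"] n len by (simp add: matches_def)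
    moreover obtain ys where "family x v (max n m) = L @ ys"
      using family_extends[of n "max n m" v x] n by (auto simp: L_def)
    ultimately have "family x v (max n m) = L" by simp
    then show ?thesis using set_family_mono[of m "max n m" x v] by simp
  qed
  then have fam: "fam x v = set L" unfolding fam_def L_def by blast
  have dist: "distinct L" by (simp add: L_def distinct_family)
  obtain ys where ys: "L = v # ys" using family_hd[OF n(2)] by (auto simp: L_def)
  have "is_iso (\<lambda>i. L ! i) (code_tree ds) (branch x v)"
  proof (rule iso_by_edges)
    show "bij_betw ((!) L) (nodes (code_tree ds)) (nodes (branch x v))"
      using bij_betw_nth[OF dist, of "{..<Suc (length ds)}"] len by (simp add: fam lessThan_Suc_atMost)
    show "L ! root (code_tree ds) = root (branch x v)" using ys by simp
    fix a b assume "(a, b) \<in> edges (code_tree ds)"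
    then obtain i where i: "i < length ds" "a = Suc i" "b = ds ! i" by auto
    have "x (L ! a) = L ! b" using m i by (simp add: matches_def L_def)
    moreover have "L ! a \<in> set L" using i len by simp
    moreover have "L ! a \<noteq> v" using family_nth_Suc(1)[of i x v n] i len by (simp add: L_def)
    ultimately show "(L ! a, L ! b) \<in> edges (branch x v)" by (simp add: fam)
  next
    fix a assume a: "a \<in> nodes (code_tree ds)" "a \<noteq> root (code_tree ds)"
    then obtain i where i: "a = Suc i" "i < length ds" by (cases a) auto
    then have "ds ! i \<le> i" using ds by (simp add: code_def)
    then show "\<exists>b\<in>nodes (code_tree ds). (a, b) \<in> edges (code_tree ds)" using i by auto
  qed auto
  then show ?thesis using rtree_iso_sym[of "code_tree ds" "branch x v"] by (auto simp: rtree_iso_iff)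
qed

section \<open>Recognising a glued tree\<close>

lemma representative:
  assumes "C \<in> small_classes k"
  shows "rooted_tree (representative C)" "finite (nodes (representative C))" "card (nodes (representative C)) \<le> k"
    "iso_class (representative C) = C"
proof -
  obtain S :: "nat rtree" where S: "C = iso_class S" "finite_rooted_tree S" "card (nodes S) \<le> k"
    using assms by (auto simp: small_classes_def)
  have rS: "rooted_tree S" using S by (simp add: finite_rooted_tree_def)
  have "representative C \<in> C"
    unfolding representative_def using iso_class_self[OF rS] S(1) by (metis someI)
  then have rep: "rooted_tree (representative C)" "rtree_iso (representative C) S"
    by (auto simp: S(1) iso_class_def)
  then have "bij_betw f (nodes (representative C)) (nodes S) \<Longrightarrow> 
      finite (nodes (representative C)) \<and> card (nodes (representative C)) \<le> k" for f
    using S bij_betw_finite bij_betw_same_card by (fastforce simp: finite_rooted_tree_def)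
  then show "finite (nodes (representative C))" "card (nodes (representative C)) \<le> k"
    using rep(2) by (auto simp: rtree_iso_def)
  show "rooted_tree (representative C)" by (rule rep(1))
  show "iso_class (representative C) = C"
    using iso_class_eq[OF rep(2) rooted_treeD(1)[OF rep(1)]] S(1) by simp
qed

lemma Glue_nodes:
  "root (Glue S v k) = Inl (root S)"
  "Inl a \<in> nodes (Glue S v k) \<longleftrightarrow> a \<in> nodes S"
  "Inr (C, i, z) \<in> nodes (Glue S v k) \<longleftrightarrow> C \<in> small_classes k \<and> z \<in> nodes (representative C)"
  by (auto simp: Glue_def)

lemma Glue_edges:
  "(Inl a, Inl b) \<in> edges (Glue S v k) \<longleftrightarrow> (a, b) \<in> edges S"
  "(Inl a, Inr r) \<notin> edges (Glue S v k)"
  "(Inr (C, i, z), Inl b) \<in> edges (Glue S v k) \<longleftrightarrow> C \<in> small_classes k \<and> z = root (representative C) \<and> b = v"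
  "(Inr (C, i, z), Inr (C', i', z')) \<in> edges (Glue S v k) \<longleftrightarrow>
     C' = C \<and> i' = i \<and> C \<in> small_classes k \<and> (z, z') \<in> edges (representative C)"
  by (auto simp: Glue_def)

lemma Glue_single:
  assumes S: "rooted_tree S"
  shows "(a, b) \<in> edges (Glue S v k) \<Longrightarrow> (a, c) \<in> edges (Glue S v k) \<Longrightarrow> b = c"
    and "(root (Glue S v k), b) \<notin> edges (Glue S v k)"
proof -
  show "b = c" if e: "(a, b) \<in> edges (Glue S v k)" "(a, c) \<in> edges (Glue S v k)"
  proof (cases a)
    case (Inl a')
    then obtain b' c' where "b = Inl b'" "c = Inl c'" using e Glue_edges(2) by (metis sum.exhaust)
    then show ?thesis using e rooted_treeD(4)[OF S] Inl by (auto simp: Glue_edges)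
  next
    case (Inr r)
    obtain C i z where r: "r = (C, i, z)" by (cases r)
    have C: "C \<in> small_classes k" using e(1) Inr r by (cases b) (auto simp: Glue_edges split: prod.splits)
    note R = rooted_treeD[OF representative(1)[OF C]]
    show ?thesis
      using e Inr r R(3) R(4) by (cases b; cases c) (auto simp: Glue_edges)
  qed
  show "(root (Glue S v k), b) \<notin> edges (Glue S v k)"
    using rooted_treeD(3)[OF S] by (cases b) (auto simp: Glue_nodes Glue_edges)
qed

definition rich :: "(nat \<Rightarrow> nat) \<Rightarrow> nat \<Rightarrow> nat \<Rightarrow> nat set \<Rightarrow> bool" where
  "rich x k u F \<longleftrightarrow> (\<forall>ds. code ds \<and> length ds < k \<longrightarrow>
     infinite {c. c \<notin> F \<and> x c = u \<and> rtree_iso (branch x c) (code_tree ds)})"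

lemma fam_disjoint:
  assumes x: "parent_fun x" and c: "0 < c" "0 < c'" "x c = x c'" "j \<in> fam x c" "j \<in> fam x c'"
  shows "c = c'"
proof (rule ccontr)
  assume ne: "c \<noteq> c'"
  obtain m where m: "j \<in> set (family x c m)" using c(4) unfolding fam_def by (rule UN_E)
  obtain m' where m': "j \<in> set (family x c' m')" using c(5) unfolding fam_def by (rule UN_E)
  have "j \<in> set (family x c (max m m'))" by (rule subsetD[OF set_family_mono[OF max.cobounded1] m])
  moreover have "j \<in> set (family x c' (max m m'))" by (rule subsetD[OF set_family_mono[OF max.cobounded2] m'])
  ultimately show False using families_disjoint[OF x c(1,2) ne c(3)] by blast
qed

lemma core_fam:
  assumes core: "core x k u F" and c: "c \<notin> F" and x: "parent_fun x" and "j \<in> fam x c"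
  shows "j \<notin> F"
  using assms(4)
proof (induction j rule: less_induct)
  case (less j)
  show ?case
  proof (cases "j = c")
    case False
    note j = fam_parent[OF less.prems False]
    have "x j \<notin> F" by (rule less.IH[OF parent_funD[OF x j(1)] j(2)])
    then show ?thesis using core j(1) by (auto simp: core_def)
  qed (use c in simp)
qed

lemma branch_small:
  assumes x: "parent_fun x" and "\<not> big k x c"
  shows "iso_class (branch x c) \<in> small_classes k"
  using rooted_branch[OF x, of c] not_big_card[OF assms(2)]
  unfolding small_classes_def finite_rooted_tree_def by (auto intro!: exI[of _ "branch x c"])

lemma small_class_code:
  assumes C: "C \<in> small_classes k"
  obtains ds where "code ds" "length ds < k" "iso_class (code_tree ds) = C"
proof -
  have R: "finite_rooted_tree (representative C)"
    using representative[OF C] by (simp add: finite_rooted_tree_def)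
  obtain ds \<phi> where ds: "code ds" and \<phi>: "is_iso \<phi> (code_tree ds) (representative C)"
    using code_exists[OF R] by blast
  have "card {..length ds} = card (nodes (representative C))"
    using \<phi> bij_betw_same_card by (fastforce simp: is_iso_def)
  then have "length ds < k" using representative(3)[OF C] by simp
  moreover have "iso_class (code_tree ds) = C"
    using iso_class_eq[of "code_tree ds" "representative C"] \<phi> representative(4)[OF C] by (auto simp: rtree_iso_iff)
  ultimately show ?thesis using that ds by blast
qed

text \<open>For each small class, \<open>rich\<close> makes the set \<open>G C\<close> of children
  of \<open>u\<close> with that branch type infinite, so it can be enumerated by all naturals; the
  index of a child is the number of its copy. A node outside \<open>F\<close> is sent to the class
  and index of the unique child \<open>tp j\<close> above it, and to its image under a chosen
  isomorphism of that branch.\<close>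

lemma full_tree_iso_Glue:
  assumes x: "parent_fun x" and core: "core x k u F" and rich: "rich x k u F"
    and S: "rooted_tree S" and \<phi>: "is_iso \<phi> (sub_tree x F) S" "\<phi> u = v"
  shows "rtree_iso (full_tree x) (Glue S v k)"
proof -
  define cl where "cl c = iso_class (branch x c)" for c
  define G where "G C = {c. c \<notin> F \<and> x c = u \<and> cl c = C}" for C
  have F0: "0 \<in> F" and uF: "u \<in> F" and F_parent: "\<And>j. 0 < j \<Longrightarrow> j \<in> F \<Longrightarrow> x j \<in> F"
    and F_child: "\<And>j. 0 < j \<Longrightarrow> j \<notin> F \<Longrightarrow> x j \<in> F \<Longrightarrow> x j = u"
    and small: "\<And>c. c \<notin> F \<Longrightarrow> x c = u \<Longrightarrow> \<not> big k x c"
    using core by (auto simp: core_def)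
  have pos: "0 < c" if "c \<notin> F" for c using F0 that by (cases c) auto
  have cl_small: "cl c \<in> small_classes k" if "c \<notin> F" "x c = u" for c
    unfolding cl_def by (rule branch_small[OF x small[OF that]])
  have G_inf: "infinite (G C)" if C: "C \<in> small_classes k" for C
  proof -
    obtain ds where ds: "code ds" "length ds < k" "iso_class (code_tree ds) = C" using C by (rule small_class_code)
    have "{c. c \<notin> F \<and> x c = u \<and> rtree_iso (branch x c) (code_tree ds)} \<subseteq> G C"
      using iso_class_eq[of "branch x _" "code_tree ds"] ds(3) by (auto simp: G_def cl_def fam_self)
    moreover have "infinite {c. c \<notin> F \<and> x c = u \<and> rtree_iso (branch x c) (code_tree ds)}"
      using rich ds by (simp add: rich_def)
    ultimately show ?thesis using finite_subset by blast
  qed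
  have idx: "bij_betw (to_nat_on (G C)) (G C) UNIV" if "C \<in> small_classes k" for C
    using G_inf[OF that] by (intro to_nat_on_infinite) auto
  have "\<exists>\<psi>. is_iso \<psi> (branch x c) (representative (cl c))" if c: "c \<notin> F" "x c = u" for c
  proof -
    have "representative (cl c) \<in> iso_class (branch x c)"
      using representative(4)[OF cl_small[OF c]] iso_class_self[OF representative(1)[OF cl_small[OF c]]]
      by (simp add: cl_def)
    then have "rtree_iso (representative (cl c)) (branch x c)" by (simp add: iso_class_def)
    then show ?thesis
      using rtree_iso_sym rooted_treeD(1)[OF representative(1)[OF cl_small[OF c]]] by (auto simp: rtree_iso_iff)
  qed
  then obtain \<psi> where \<psi>: "\<And>c. c \<notin> F \<Longrightarrow> x c = u \<Longrightarrow> is_iso (\<psi> c) (branch x c) (representative (cl c))" by metis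
  define tp where "tp j = (SOME c. c \<notin> F \<and> x c = u \<and> j \<in> fam x c)" for j
  have tp: "tp j \<notin> F" "x (tp j) = u" "j \<in> fam x (tp j)" if "j \<notin> F" for j
  proof -
    obtain c where "c \<notin> F \<and> x c = u \<and> j \<in> fam x c" using core_top[OF x core \<open>j \<notin> F\<close>] by metis
    then have "tp j \<notin> F \<and> x (tp j) = u \<and> j \<in> fam x (tp j)" unfolding tp_def by (rule someI)
    then show "tp j \<notin> F" "x (tp j) = u" "j \<in> fam x (tp j)" by auto
  qed
  have tp_eq: "tp j = c" if "c \<notin> F" "x c = u" "j \<in> fam x c" for j c
  proof -
    have j: "j \<notin> F" by (rule core_fam[OF core that(1) x that(3)])
    show ?thesis by (rule fam_disjoint[OF x pos[OF tp(1)[OF j]] pos[OF that(1)] _ tp(3)[OF j] that(3)])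
      (simp add: tp(2)[OF j] that(2))
  qed
  define \<Phi> where "\<Phi> j = (if j \<in> F then Inl (\<phi> j)
    else Inr (cl (tp j), to_nat_on (G (cl (tp j))) (tp j), \<psi> (tp j) j))" for j
  have \<phi>bij: "bij_betw \<phi> F (nodes S)" using \<phi>(1) by (simp add: is_iso_def)
  have \<psi>bij: "bij_betw (\<psi> c) (fam x c) (nodes (representative (cl c)))" if "c \<notin> F" "x c = u" for c
    using \<psi>[OF that] by (simp add: is_iso_def)
  have tpG: "tp j \<in> G (cl (tp j))" if "j \<notin> F" for j using tp[OF that] by (simp add: G_def)
  have "inj \<Phi>"
  proof (rule injI)
    fix i j assume eq: "\<Phi> i = \<Phi> j"
    show "i = j"
    proof (cases "i \<in> F")
      case True
      then have "j \<in> F" "\<phi> i = \<phi> j" using eq by (auto simp: \<Phi>_def split: if_splits)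
      then show ?thesis using True bij_betw_imp_inj_on[OF \<phi>bij] by (auto dest: inj_onD)
    next
      case False
      then have j: "j \<notin> F" using eq by (auto simp: \<Phi>_def split: if_splits)
      have e: "cl (tp i) = cl (tp j)" "to_nat_on (G (cl (tp i))) (tp i) = to_nat_on (G (cl (tp j))) (tp j)"
        "\<psi> (tp i) i = \<psi> (tp j) j" using eq False j by (auto simp: \<Phi>_def)
      have "inj_on (to_nat_on (G (cl (tp i)))) (G (cl (tp i)))"
        using idx[OF cl_small[OF tp(1,2)[OF False]]] by (rule bij_betw_imp_inj_on)
      then have t: "tp i = tp j" using e(1,2) tpG[OF False] tpG[OF j] by (metis inj_onD)
      have "inj_on (\<psi> (tp i)) (fam x (tp i))"
        using \<psi>bij[OF tp(1,2)[OF False]] by (rule bij_betw_imp_inj_on)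
      then show ?thesis using e(3) tp(3)[OF False] tp(3)[OF j] unfolding t by (rule inj_onD)
    qed
  qed
  moreover have "range \<Phi> = nodes (Glue S v k)"
  proof (intro equalityI subsetI)
    fix r assume "r \<in> range \<Phi>"
    then obtain j where r: "r = \<Phi> j" by blast
    show "r \<in> nodes (Glue S v k)"
    proof (cases "j \<in> F")
      case True
      then show ?thesis using bij_betwE[OF \<phi>bij] by (simp add: r \<Phi>_def Glue_nodes)
    next
      case False
      then show ?thesis using cl_small[OF tp(1,2)] bij_betwE[OF \<psi>bij[OF tp(1,2)]] tp(3)
        by (simp add: r \<Phi>_def Glue_nodes)
    qed
  next
    fix r assume r: "r \<in> nodes (Glue S v k)"
    show "r \<in> range \<Phi>"
    proof (cases r)
      case (Inl a)
      then have "a \<in> \<phi> ` F" using r bij_betw_imp_surj_on[OF \<phi>bij] by (simp add: Glue_nodes)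
      then show ?thesis using Inl by (auto simp: \<Phi>_def)
    next
      case (Inr t)
      obtain C i y where t: "t = (C, i, y)" by (cases t)
      have C: "C \<in> small_classes k" and y: "y \<in> nodes (representative C)" using r Inr t by (auto simp: Glue_nodes)
      obtain c where c: "c \<in> G C" "to_nat_on (G C) c = i" using bij_betw_imp_surj_on[OF idx[OF C]] by (metis UNIV_I imageE)
      then have c': "c \<notin> F" "x c = u" "cl c = C" by (auto simp: G_def)
      obtain j where j: "j \<in> fam x c" "y = \<psi> c j"
        using bij_betw_imp_surj_on[OF \<psi>bij[OF c'(1,2)]] y c'(3) by (metis imageE)
      have "j \<notin> F" by (rule core_fam[OF core c'(1) x j(1)])
      then have "\<Phi> j = r" using tp_eq[OF c'(1,2) j(1)] c' c j t Inr by (simp add: \<Phi>_def)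
      then show ?thesis by blast
    qed
  qed
  ultimately have bij: "bij_betw \<Phi> (nodes (full_tree x)) (nodes (Glue S v k))" by (simp add: bij_betw_def)
  have "is_iso \<Phi> (full_tree x) (Glue S v k)"
  proof (rule iso_by_edges[OF bij])
    show "\<Phi> (root (full_tree x)) = root (Glue S v k)" using F0 \<phi>(1) by (simp add: \<Phi>_def Glue_nodes is_iso_def)
    fix a b assume "(a, b) \<in> edges (full_tree x)"
    then have a: "0 < a" "b = x a" by auto
    show "(\<Phi> a, \<Phi> b) \<in> edges (Glue S v k)"
    proof (cases "a \<in> F")
      case True
      then have "(\<phi> a, \<phi> (x a)) \<in> edges S" using \<phi>(1) a F_parent by (auto simp: is_iso_def)
      then show ?thesis using True a F_parent by (simp add: \<Phi>_def Glue_edges)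
    next
      case False
      note t = tp[OF False]
      note C = cl_small[OF t(1,2)]
      show ?thesis
      proof (cases "a = tp a")
        case True
        have "\<psi> (tp a) (tp a) = root (representative (cl (tp a)))" using \<psi>[OF t(1,2)] by (simp add: is_iso_def)
        moreover have "b = u" using t(2) True a by simp
        ultimately show ?thesis using False True uF \<phi>(2) C by (simp add: \<Phi>_def Glue_edges)
      next
        case ne: False
        have m: "x a \<in> fam x (tp a)" by (rule fam_parent(2)[OF t(3) ne])
        have nF: "x a \<notin> F" by (rule core_fam[OF core t(1) x m])
        have "tp (x a) = tp a" by (rule tp_eq[OF t(1,2) m])
        moreover have "(\<psi> (tp a) a, \<psi> (tp a) (x a)) \<in> edges (representative (cl (tp a)))"
          using \<psi>[OF t(1,2)] t(3) m ne by (auto simp: is_iso_def)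
        ultimately show ?thesis using False nF a C by (simp add: \<Phi>_def Glue_edges)
      qed
    qed
  qed (use Glue_single[OF S] in auto)
  then show ?thesis unfolding rtree_iso_iff by blast
qed

text \<open>The converse serves measurability: an isomorphism onto a glued tree is a choice among
  uncountably many maps, whereas \<open>core\<close> and \<open>rich\<close> are countable
  conditions.\<close>

lemma Glue_iso_full_tree:
  assumes x: "parent_fun x" and iso: "rtree_iso (full_tree x) (Glue S v k)"
    and S: "finite_rooted_tree S" and v: "v \<in> nodes S"
  shows "\<exists>u F \<phi>. core x k u F \<and> rich x k u F \<and> is_iso \<phi> (sub_tree x F) S \<and> \<phi> u = v"
proof -
  let ?G = "Glue S v k"
  have rS: "rooted_tree S" and finS: "finite (nodes S)" using S by (auto simp: finite_rooted_tree_def)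
  obtain \<Psi> where \<Psi>: "is_iso \<Psi> (full_tree x) ?G" using iso by (auto simp: rtree_iso_iff)
  have bij: "bij_betw \<Psi> UNIV (nodes ?G)" and root: "\<Psi> 0 = Inl (root S)"
    and edge: "(0 < a \<and> b = x a) \<longleftrightarrow> (\<Psi> a, \<Psi> b) \<in> edges ?G" for a b
    using \<Psi> by (auto simp: is_iso_def Glue_nodes)
  have inj: "inj \<Psi>" and surj: "range \<Psi> = nodes ?G" using bij by (auto simp: bij_betw_def)
  have up: "(\<Psi> j, \<Psi> (x j)) \<in> edges ?G" if "0 < j" for j using edge[of j "x j"] that by simp
  define F where "F = {j. \<exists>a. \<Psi> j = Inl a}"
  define \<phi> where "\<phi> j = (case \<Psi> j of Inl a \<Rightarrow> a | Inr _ \<Rightarrow> root S)" for j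
  have \<phi>: "\<Psi> j = Inl (\<phi> j)" if "j \<in> F" for j using that by (auto simp: F_def \<phi>_def)
  have \<phi>bij: "bij_betw \<phi> F (nodes S)"
  proof (rule bij_betwI')
    show "\<phi> i = \<phi> j \<longleftrightarrow> i = j" if "i \<in> F" "j \<in> F" for i j
      using \<phi>[OF that(1)] \<phi>[OF that(2)] inj by (metis injD)
    show "\<phi> j \<in> nodes S" if "j \<in> F" for j
      using \<phi>[OF that] surj Glue_nodes(2)[of "\<phi> j" S v k] by (metis rangeI)
    show "\<exists>j\<in>F. a = \<phi> j" if "a \<in> nodes S" for a
    proof -
      have "Inl a \<in> range \<Psi>" using that surj by (simp add: Glue_nodes)
      then obtain j where "\<Psi> j = Inl a" by (metis imageE)
      then show ?thesis by (intro bexI[of _ j]) (auto simp: F_def \<phi>_def)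
    qed
  qed
  have finF: "finite F" using bij_betw_finite[OF \<phi>bij] finS by simp
  obtain u where u: "u \<in> F" "\<phi> u = v" using bij_betw_imp_surj_on[OF \<phi>bij] v by (metis imageE)
  have F0: "0 \<in> F" using root by (simp add: F_def)
  have F_parent: "x j \<in> F" if "0 < j" "j \<in> F" for j
  proof (rule ccontr)
    assume "x j \<notin> F"
    then obtain r where "\<Psi> (x j) = Inr r" by (cases "\<Psi> (x j)") (auto simp: F_def)
    then show False using up[OF that(1)] \<phi>[OF that(2)] by (simp add: Glue_edges)
  qed
  have notF: "\<exists>C i z. \<Psi> j = Inr (C, i, z) \<and> C \<in> small_classes k \<and> z \<in> nodes (representative C)" if "j \<notin> F" for j
  proof (cases "\<Psi> j")
    case (Inr r)
    obtain C i z where "r = (C, i, z)" by (cases r)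
    moreover have "\<Psi> j \<in> nodes ?G" using surj by blast
    ultimately show ?thesis using Inr by (auto simp: Glue_nodes)
  qed (use that in \<open>auto simp: F_def\<close>)
  have entry: "x c = u \<and> \<Psi> c = Inr (C, i, root (representative C))"
    if "0 < c" "\<Psi> c = Inr (C, i, z)" "x c \<in> F" for c C i z
  proof -
    have "(Inr (C, i, z), Inl (\<phi> (x c))) \<in> edges ?G" using up[OF that(1)] that(2) \<phi>[OF that(3)] by simp
    then have "z = root (representative C)" "\<phi> (x c) = v" by (auto simp: Glue_edges)
    then show ?thesis using that u bij_betw_imp_inj_on[OF \<phi>bij] by (auto dest: inj_onD)
  qed
  have kid: "c \<notin> F \<and> x c = u" if "\<Psi> c = Inr (C, i, root (representative C))" "C \<in> small_classes k" for c C i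
  proof -
    have "(\<Psi> c, \<Psi> u) \<in> edges ?G" using that \<phi>[OF u(1)] u(2) by (simp add: Glue_edges)
    then show ?thesis using edge[of c u] that by (auto simp: F_def)
  qed
  \<comment> \<open>The branch at \<open>c\<close> fills exactly one copy: descendants cannot leave
    it, since edges between copied nodes stay in the same copy, and every node of the copy is
    reached by induction along its path to the root.\<close>
  have comp: "bij_betw (\<lambda>j. snd (snd (projr (\<Psi> j)))) (fam x c) (nodes (representative C))
      \<and> rtree_iso (branch x c) (representative C)"
    if c: "\<Psi> c = Inr (C, i, root (representative C))" and C: "C \<in> small_classes k" for c C i
  proof -
    note R = rooted_treeD[OF representative(1)[OF C]]
    have 1: "\<exists>z\<in>nodes (representative C). \<Psi> j = Inr (C, i, z)" if "j \<in> fam x c" for j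
      using that
    proof (induction j rule: less_induct)
      case (less j)
      show ?case
      proof (cases "j = c")
        case False
        note p = fam_parent[OF less.prems False]
        obtain z where z: "z \<in> nodes (representative C)" "\<Psi> (x j) = Inr (C, i, z)"
          using less.IH[OF parent_funD[OF x p(1)] p(2)] by blast
        have e: "(\<Psi> j, Inr (C, i, z)) \<in> edges ?G" using up[OF p(1)] z by simp
        show ?thesis
        proof (cases "\<Psi> j")
          case (Inr r)
          obtain C' i' z' where "r = (C', i', z')" by (cases r)
          then show ?thesis using e Inr R(2) by (auto simp: Glue_edges)
        qed (use e in \<open>simp add: Glue_edges\<close>)
      qed (use c R(1) in auto)
    qed
    have 2: "\<exists>j\<in>fam x c. \<Psi> j = Inr (C, i, z)" if "z \<in> nodes (representative C)" for z
      using R(5)[OF that]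
    proof (induction rule: converse_rtrancl_induct)
      case base
      then show ?case using c fam_self by blast
    next
      case (step y z)
      obtain j where j: "j \<in> fam x c" "\<Psi> j = Inr (C, i, z)" using step.IH by blast
      have "Inr (C, i, y) \<in> range \<Psi>" using R(2)[OF step.hyps(1)] C surj by (simp add: Glue_nodes)
      then obtain j' where j': "\<Psi> j' = Inr (C, i, y)" by (metis imageE)
      then have "(\<Psi> j', \<Psi> j) \<in> edges ?G" using j step.hyps(1) C by (simp add: Glue_edges)
      then have "0 < j'" "x j' = j" using edge[of j' j] by auto
      then show ?case using fam_child[OF x, of j' c] j j' by auto
    qed
    let ?\<psi> = "\<lambda>j. snd (snd (projr (\<Psi> j)))"
    have \<psi>: "\<Psi> j = Inr (C, i, ?\<psi> j)" "?\<psi> j \<in> nodes (representative C)" if "j \<in> fam x c" for j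
      using 1[OF that] by auto
    have b: "bij_betw ?\<psi> (fam x c) (nodes (representative C))"
    proof (rule bij_betwI')
      show "?\<psi> a = ?\<psi> b \<longleftrightarrow> a = b" if "a \<in> fam x c" "b \<in> fam x c" for a b
        using \<psi>(1)[OF that(1)] \<psi>(1)[OF that(2)] inj by (metis injD)
      show "\<exists>j\<in>fam x c. z = ?\<psi> j" if z: "z \<in> nodes (representative C)" for z
        using 2[OF z] by force
    qed (rule \<psi>(2))
    have "is_iso ?\<psi> (branch x c) (representative C)"
    proof (rule iso_by_edges)
      show "bij_betw ?\<psi> (nodes (branch x c)) (nodes (representative C))" using b by simp
      show "?\<psi> (root (branch x c)) = root (representative C)" using c by simp
      fix a b assume "(a, b) \<in> edges (branch x c)"
      then have a: "a \<in> fam x c" "a \<noteq> c" "b = x a" by auto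
      note p = fam_parent[OF a(1,2)]
      have "(Inr (C, i, ?\<psi> a), Inr (C, i, ?\<psi> (x a))) \<in> edges ?G"
        using up[OF p(1)] \<psi>(1)[OF a(1)] \<psi>(1)[OF p(2)] by metis
      then show "(?\<psi> a, ?\<psi> b) \<in> edges (representative C)" using a(3) by (simp add: Glue_edges)
    next
      fix a assume "a \<in> nodes (branch x c)" "a \<noteq> root (branch x c)"
      then show "\<exists>b\<in>nodes (branch x c). (a, b) \<in> edges (branch x c)" using fam_parent(2) by simp
    qed (use R in auto)
    then show ?thesis using b by (auto simp: rtree_iso_iff)
  qed
  have "core x k u F"
    unfolding core_def
  proof (intro conjI allI impI finF F0 u(1))
    fix j assume j: "j > 0" "j \<notin> F" "x j \<in> F"
    obtain C i z where "\<Psi> j = Inr (C, i, z)" using notF[OF j(2)] by blast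
    then show "x j = u" using entry[OF j(1) _ j(3)] by blast
  next
    fix j assume j: "j \<notin> F" "x j = u"
    then have "0 < j" using F0 by (cases j) auto
    obtain C i z where C: "\<Psi> j = Inr (C, i, z)" "C \<in> small_classes k" using notF[OF j(1)] by blast
    have "x j \<in> F" using j(2) u(1) by simp
    from entry[OF \<open>0 < j\<close> C(1) this] have "\<Psi> j = Inr (C, i, root (representative C))" ..
    then have b: "bij_betw (\<lambda>j. snd (snd (projr (\<Psi> j)))) (fam x j) (nodes (representative C))"
      using comp C(2) by blast
    have "finite (fam x j)" using bij_betw_finite[OF b] representative(2)[OF C(2)] by simp
    moreover have "card (fam x j) \<le> k" using bij_betw_same_card[OF b] representative(3)[OF C(2)] by simp
    ultimately show "\<not> big k x j" by (simp add: big_iff)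
  qed (rule F_parent)
  moreover have "rich x k u F"
    unfolding rich_def
  proof (intro allI impI)
    fix ds assume ds: "code ds \<and> length ds < k"
    let ?R = "code_tree ds"
    have fR: "finite_rooted_tree ?R" using rooted_code_tree ds by blast
    define C where "C = iso_class ?R"
    have C: "C \<in> small_classes k"
      unfolding small_classes_def C_def using fR ds by (intro CollectI exI[of _ ?R]) auto
    have "representative C \<in> C"
      using iso_class_self[OF representative(1)[OF C]] unfolding representative(4)[OF C] .
    then have "representative C \<in> iso_class ?R" by (simp only: C_def[symmetric])
    then have rep: "rtree_iso (representative C) ?R" by (simp add: iso_class_def)
    have "Inr (C, i, root (representative C)) \<in> range \<Psi>" for i
      using rooted_treeD(1)[OF representative(1)[OF C]] C surj by (simp add: Glue_nodes)
    then have "\<exists>c. \<Psi> c = Inr (C, i, root (representative C))" for i by (metis imageE)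
    then obtain h where h: "\<And>i. \<Psi> (h i) = Inr (C, i, root (representative C))" by metis
    have "inj h"
    proof (rule injI)
      fix i i' assume "h i = h i'"
      then have "\<Psi> (h i) = \<Psi> (h i')" by simp
      then show "i = i'" by (simp add: h)
    qed
    then have "infinite (range h)" by (simp add: finite_image_iff)
    moreover have "range h \<subseteq> {c. c \<notin> F \<and> x c = u \<and> rtree_iso (branch x c) ?R}"
      using kid[OF h C] comp[OF h C] rtree_iso_trans[OF _ rep] by blast
    ultimately show "infinite {c. c \<notin> F \<and> x c = u \<and> rtree_iso (branch x c) ?R}"
      using finite_subset by blast
  qed
  moreover have "is_iso \<phi> (sub_tree x F) S"
  proof (rule iso_by_edges)
    show "bij_betw \<phi> (nodes (sub_tree x F)) (nodes S)" using \<phi>bij by simp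
    show "\<phi> (root (sub_tree x F)) = root S" using root by (simp add: \<phi>_def)
    fix a b assume "(a, b) \<in> edges (sub_tree x F)"
    then have a: "a \<in> F" "0 < a" "b = x a" by auto
    have "(Inl (\<phi> a), Inl (\<phi> (x a))) \<in> edges ?G"
      using up[OF a(2)] \<phi>[OF a(1)] \<phi>[OF F_parent[OF a(2,1)]] by metis
    then show "(\<phi> a, \<phi> b) \<in> edges S" using a(3) by (simp add: Glue_edges)
  next
    fix a assume "a \<in> nodes (sub_tree x F)" "a \<noteq> root (sub_tree x F)"
    then show "\<exists>b\<in>nodes (sub_tree x F). (a, b) \<in> edges (sub_tree x F)" using F_parent by simp
  qed (use rooted_treeD[OF rS] in auto)
  ultimately show ?thesis using u(2) by blast
qed

section \<open>Probabilities of the limit trees\<close>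

text \<open>A finite approximation determined at time \<open>n\<close>. For a branch that is not big
  it is eventually constant, so its isomorphism type becomes a limit of measurable events.\<close>

definition branch_upto :: "(nat \<Rightarrow> nat) \<Rightarrow> nat \<Rightarrow> nat \<Rightarrow> nat rtree" where
  "branch_upto x c n = \<lparr> nodes = set (family x c n),
     edges = {(j, x j) | j. j \<in> set (family x c n) \<and> j \<noteq> c}, root = c \<rparr>"

lemma determined_branch_upto: "determined n (\<lambda>x. branch_upto x c n)"
proof (rule determinedI)
  fix x y :: "nat \<Rightarrow> nat" assume eq: "\<And>j. 1 \<le> j \<Longrightarrow> j \<le> n \<Longrightarrow> x j = y j"
  have fam: "family x c n = family y c n" by (rule determinedD[OF determined_family]) (use eq in auto)
  have "x j = y j" if "j \<in> set (family y c n)" "j \<noteq> c" for j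
    using family_range[of y c n] that by (intro eq) auto
  then show "branch_upto x c n = branch_upto y c n" unfolding branch_upto_def fam by auto
qed

lemma branch_upto_eventually:
  assumes "\<not> big k x c"
  shows "rtree_iso (branch x c) R \<longleftrightarrow> (\<exists>n0. \<forall>n\<ge>n0. rtree_iso (branch_upto x c n) R)"
proof -
  obtain n0 where "\<And>n. n0 \<le> n \<Longrightarrow> fam x c = set (family x c n)" using not_big_card(3)[OF assms] by blast
  then have "branch_upto x c n = branch x c" if "n0 \<le> n" for n
    using that by (simp add: branch_upto_def branch_def)
  then show ?thesis by (metis max.cobounded1 max.cobounded2)
qed

lemma determined_sub_tree:
  assumes "\<And>j. j \<in> F \<Longrightarrow> j \<le> m"
  shows "determined m (\<lambda>x. sub_tree x F)"
  by (rule determinedI) (use assms in \<open>auto simp: sub_tree_def\<close>)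

lemma rooted_sub_tree:
  assumes x: "parent_fun x" and core: "core x k u F"
  shows "finite_rooted_tree (sub_tree x F)"
proof -
  have F: "finite F" "0 \<in> F" "\<And>j. 0 < j \<Longrightarrow> j \<in> F \<Longrightarrow> x j \<in> F" using core by (auto simp: core_def)
  have "(j, 0) \<in> (edges (sub_tree x F))\<^sup>*" if "j \<in> F" for j
    using that
  proof (induction j rule: less_induct)
    case (less j)
    show ?case
    proof (cases "j = 0")
      case False
      then have "(j, x j) \<in> edges (sub_tree x F)" using less.prems by simp
      moreover have "(x j, 0) \<in> (edges (sub_tree x F))\<^sup>*"
        using False less.prems by (intro less.IH parent_funD[OF x] F(3)) auto
      ultimately show ?thesis by (rule converse_rtrancl_into_rtrancl)
    qed simp
  qed
  then show ?thesis using F by (auto simp: finite_rooted_tree_def rooted_tree_def)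
qed

lemma settled_rich:
  assumes x: "parent_fun x" and core: "core x k u F"
    and settled: "\<And>ds. code ds \<Longrightarrow> length ds < k \<Longrightarrow> infinite {v. x v = u \<and> settled x v ds}"
  shows "rich x k u F"
  unfolding rich_def
proof (intro allI impI)
  fix ds assume ds: "code ds \<and> length ds < k"
  have "{v. x v = u \<and> settled x v ds} - F \<subseteq> {c. c \<notin> F \<and> x c = u \<and> rtree_iso (branch x c) (code_tree ds)}"
    using settled_branch[OF x] ds by blast
  moreover have "infinite ({v. x v = u \<and> settled x v ds} - F)"
    using settled[of ds] ds core by (intro Diff_infinite_finite) (auto simp: core_def)
  ultimately show "infinite {c. c \<notin> F \<and> x c = u \<and> rtree_iso (branch x c) (code_tree ds)}"
    using finite_subset by blast
qed

context superlinear_GN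
begin

text \<open>The finite set \<open>F\<close> is represented by a list and infinity by arbitrarily
  large children, so that all quantifiers range over countable types.\<close>

lemma Glue_measurable:
  assumes S: "finite_rooted_tree S" and v: "v \<in> nodes S"
  shows "{\<omega>\<in>space M. rtree_iso (full_tree (X \<omega>)) (Glue S v k)} \<in> sets M"
proof -
  define B where "B c n ds x \<longleftrightarrow> rtree_iso (branch_upto x c n) (code_tree ds)" for c n ds x
  define Q where "Q u L x \<longleftrightarrow> (\<exists>\<phi>. is_iso \<phi> (sub_tree x (set L)) S \<and> \<phi> u = v)" for u L x
  define R where "R u L x \<longleftrightarrow> (\<forall>ds. code ds \<and> length ds < k \<longrightarrow>
     (\<forall>N. \<exists>c>N. c \<notin> set L \<and> x c = u \<and> (\<exists>n0. \<forall>n\<ge>n0. B c n ds x)))" for u L x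
  have [measurable]: "Measurable.pred M (\<lambda>\<omega>. B c n ds (X \<omega>))" for c n ds
    unfolding pred_def B_def
    by (rule determined_sets[OF determined_comp[OF determined_branch_upto, where F = "\<lambda>T. rtree_iso T (code_tree ds)"]])
  have [measurable]: "Measurable.pred M (\<lambda>\<omega>. Q u L (X \<omega>))" for u L
    unfolding pred_def Q_def
    by (rule determined_sets[OF determined_comp[OF determined_sub_tree[of "set L" "Max (set L)"],
          where F = "\<lambda>T. \<exists>\<phi>. is_iso \<phi> T S \<and> \<phi> u = v"]]) auto
  have [measurable]: "Measurable.pred M (\<lambda>\<omega>. R u L (X \<omega>))" for u L
    unfolding R_def by measurable
  have [measurable]: "Measurable.pred M (\<lambda>\<omega>. core (X \<omega>) k u F)" for u F
    unfolding core_def by measurable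
  have R_rich: "R u L x \<longleftrightarrow> rich x k u (set L)" if "core x k u (set L)" for u L x
  proof -
    have nb: "\<not> big k x c" if "c \<notin> set L" "x c = u" for c
      using that \<open>core x k u (set L)\<close> by (simp add: core_def)
    have "{c. c \<notin> set L \<and> x c = u \<and> rtree_iso (branch x c) (code_tree ds)}
      = {c. c \<notin> set L \<and> x c = u \<and> (\<exists>n0. \<forall>n\<ge>n0. B c n ds x)}" for ds
      unfolding B_def using branch_upto_eventually[OF nb] by (intro Collect_cong) blast
    then show ?thesis unfolding R_def rich_def infinite_nat_iff_unbounded by auto
  qed
  have eq: "rtree_iso (full_tree (X \<omega>)) (Glue S v k) \<longleftrightarrow> (\<exists>u L. core (X \<omega>) k u (set L) \<and> R u L (X \<omega>) \<and> Q u L (X \<omega>))"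
    if \<omega>: "\<omega> \<in> space M" for \<omega>
  proof
    assume "rtree_iso (full_tree (X \<omega>)) (Glue S v k)"
    then obtain u F \<phi> where F: "core (X \<omega>) k u F" "rich (X \<omega>) k u F" "is_iso \<phi> (sub_tree (X \<omega>) F) S" "\<phi> u = v"
      using Glue_iso_full_tree[OF parent_fun_X[OF \<omega>] _ S v] by blast
    then have "finite F" by (simp add: core_def)
    then obtain L where L: "F = set L" by (metis finite_list)
    show "\<exists>u L. core (X \<omega>) k u (set L) \<and> R u L (X \<omega>) \<and> Q u L (X \<omega>)"
      using F R_rich[of "X \<omega>" u L] unfolding L Q_def by blast
  next
    assume "\<exists>u L. core (X \<omega>) k u (set L) \<and> R u L (X \<omega>) \<and> Q u L (X \<omega>)"
    then obtain u L \<phi> where F: "core (X \<omega>) k u (set L)" "rich (X \<omega>) k u (set L)"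
        "is_iso \<phi> (sub_tree (X \<omega>) (set L)) S" "\<phi> u = v"
      unfolding Q_def using R_rich by blast
    have "rooted_tree S" using S by (simp add: finite_rooted_tree_def)
    then show "rtree_iso (full_tree (X \<omega>)) (Glue S v k)"
      by (rule full_tree_iso_Glue[OF parent_fun_X[OF \<omega>] F(1,2) _ F(3,4)])
  qed
  have "{\<omega>\<in>space M. rtree_iso (full_tree (X \<omega>)) (Glue S v k)}
    = {\<omega>\<in>space M. \<exists>u L. core (X \<omega>) k u (set L) \<and> R u L (X \<omega>) \<and> Q u L (X \<omega>)}"
    using eq by auto
  also have "\<dots> \<in> sets M" by measurable
  finally show ?thesis .
qed

lemma AE_rich:
  assumes k: "\<And>l. l < k \<Longrightarrow> (p - 1) * real l \<le> 1"
  shows "AE \<omega> in M. \<forall>u F. core (X \<omega>) k u F \<longrightarrow> rich (X \<omega>) k u F"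
proof -
  have "AE \<omega> in M. code ds \<and> length ds < k \<longrightarrow>
      (\<forall>C u. lin C (X \<omega>) u \<longrightarrow> infinite {v. X \<omega> v = u \<and> settled (X \<omega>) v ds})" for ds
    using AE_infinite_settled[of ds] k[of "length ds"] by (cases "code ds \<and> length ds < k") auto
  then have "AE \<omega> in M. \<forall>ds. code ds \<and> length ds < k \<longrightarrow>
      (\<forall>C u. lin C (X \<omega>) u \<longrightarrow> infinite {v. X \<omega> v = u \<and> settled (X \<omega>) v ds})"
    by (subst AE_all_countable) simp
  then show ?thesis using AE_space
  proof eventually_elim
    case (elim \<omega>)
    note x = parent_fun_X[OF elim(2)]
    show ?case
    proof (intro allI impI)
      fix u F assume core: "core (X \<omega>) k u F"
      obtain C where "lin C (X \<omega>) u" using core_lin[OF x core] by blast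
      then show "rich (X \<omega>) k u F" using elim(1) by (intro settled_rich[OF x core]) blast
    qed
  qed
qed

lemma AE_Glue:
  assumes k: "1 < (p - 1) * real k" "\<And>l. l < k \<Longrightarrow> (p - 1) * real l \<le> 1"
  shows "AE \<omega> in M. \<exists>S v. finite_rooted_tree S \<and> v \<in> nodes S \<and> rtree_iso (full_tree (X \<omega>)) (Glue (S :: nat rtree) v k)"
proof -
  have "AE \<omega> in M. \<forall>u F. core (X \<omega>) k u F \<longrightarrow> rich (X \<omega>) k u F" by (rule AE_rich) (rule k(2))
  then show ?thesis using AE_core[OF k(1)] AE_space
  proof eventually_elim
    case (elim \<omega>)
    note x = parent_fun_X[OF elim(3)]
    obtain u F where core: "core (X \<omega>) k u F" using elim(2) by blast
    have S: "finite_rooted_tree (sub_tree (X \<omega>) F)" by (rule rooted_sub_tree[OF x core])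
    have "rtree_iso (full_tree (X \<omega>)) (Glue (sub_tree (X \<omega>) F) u k)"
      using elim(1) core S is_iso_id by (intro full_tree_iso_Glue[OF x core, where \<phi> = id]) (auto simp: finite_rooted_tree_def)
    moreover have "u \<in> nodes (sub_tree (X \<omega>) F)" using core by (simp add: core_def)
    ultimately show ?case using S by blast
  qed
qed

lemma prob_hist_pos:
  assumes h: "parent_fun h" shows "0 < prob (hist m h)"
proof (induction m)
  case 0
  have "hist 0 h = space M" by (auto simp: hist_def)
  then show ?case by (simp add: prob_space)
next
  case (Suc m)
  have "prob (hist (Suc m) (h(Suc m := h (Suc m)))) = prob (hist m h) * pr h m (h (Suc m))"
    using h by (intro prob_hist_Suc) (simp add: parent_fun_def)
  moreover have "0 < pr h m (h (Suc m))" unfolding pr_def using wt_pos kernel_pos by (intro divide_pos_pos)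
  ultimately show ?case using Suc by simp
qed

text \<open>A fixed history of positive probability builds the coded tree and then \<open>L\<close>
  children of \<open>u\<close> in a row. All failure bounds are relative to the probability of this
  history, however small it is, so it suffices that their sum \<open>bound L\<close> is below
  1.\<close>

lemma prob_core_pos:
  assumes k: "1 < (p - 1) * real k" and ds: "code ds" and u: "u \<le> length ds"
  shows "\<exists>E\<in>sets M. 0 < prob E \<and> (\<forall>\<omega>\<in>E. core (X \<omega>) k u {..length ds} \<and> sub_tree (X \<omega>) {..length ds} = code_tree ds)"
proof -
  define l where "l = length ds"
  define h where "h j = (if j = 0 then 0 else if j \<le> l then ds ! (j - 1) else u)" for j
  have h: "parent_fun h"
    using ds u by (auto simp: parent_fun_def h_def code_def l_def)
  define R where "R = real (Suc l) powr (p + 1)"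
  define Rk where "Rk = real (Suc k) powr (p + 1)"
  have R0: "0 \<le> R" by (simp add: R_def)
  \<comment> \<open>The three terms belong to: a coded node other than \<open>u\<close> receiving a
    further child, one of the \<open>L\<close> planted children becoming big, and a later child of
    \<open>u\<close> becoming big.\<close>
  define bound where "bound L = R * g L + real L * (Rk * g L) ^ k + (\<Sum>i. (Rk * g (i + L)) ^ k)" for L
  have "bound \<longlonglongrightarrow> 0"
  proof -
    have "filterlim (\<lambda>L. real L + 1) at_top sequentially" by real_asymp
    then have "g \<longlonglongrightarrow> 0" unfolding g_def using p
      by (intro tendsto_mult_right_zero tendsto_neg_powr) auto
    then have 1: "(\<lambda>L. R * g L) \<longlonglongrightarrow> 0" by (rule tendsto_mult_right_zero)
    \<comment> \<open>There are \<open>L\<close> planted children, each failing with probability of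
      order \<open>L powr (- ((p - 1) * k))\<close>; the strict inequality for \<open>k\<close>
      beats the factor \<open>L\<close>.\<close>
    have 2: "(\<lambda>L. real L * (Rk * g L) ^ k) \<longlonglongrightarrow> 0"
    proof -
      let ?c = "(Rk * (2 powr p / (p - 1))) ^ k"
      define e where "e = (p - 1) * real k - 1"
      have "filterlim (\<lambda>L. real L + 1) at_top sequentially" by real_asymp
      then have lim: "(\<lambda>L. ?c * (real L + 1) powr (- e)) \<longlonglongrightarrow> 0"
        using k by (intro tendsto_mult_right_zero tendsto_neg_powr) (auto simp: e_def)
      have le: "real L * (Rk * g L) ^ k \<le> ?c * (real L + 1) powr (- e)" for L
      proof -
        have c: "0 \<le> ?c" using p by (simp add: Rk_def)
        have "real L * (Rk * g L) ^ k = ?c * (real L * (real L + 1) powr (- ((p - 1) * real k)))"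
          unfolding g_power by simp
        also have "\<dots> \<le> ?c * ((real L + 1) powr 1 * (real L + 1) powr (- ((p - 1) * real k)))"
          by (intro mult_left_mono mult_right_mono c) auto
        also have "\<dots> = ?c * (real L + 1) powr (- e)" unfolding powr_add[symmetric] by (simp add: e_def)
        finally show ?thesis .
      qed
      show ?thesis
      proof (rule tendsto_sandwich[OF _ _ tendsto_const lim])
        show "eventually (\<lambda>L. 0 \<le> real L * (Rk * g L) ^ k) sequentially"
          using g_pos by (intro always_eventually allI) (simp add: Rk_def less_imp_le)
      qed (intro always_eventually allI le)
    qed
    have 3: "(\<lambda>L. \<Sum>i. (Rk * g (i + L)) ^ k) \<longlonglongrightarrow> 0"
    proof -
      have sm: "summable (\<lambda>i. (Rk * g i) ^ k)" by (rule summable_g_power[OF k])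
      have "(\<lambda>L. (\<Sum>i. (Rk * g i) ^ k) - (\<Sum>i<L. (Rk * g i) ^ k)) \<longlonglongrightarrow> (\<Sum>i. (Rk * g i) ^ k) - (\<Sum>i. (Rk * g i) ^ k)"
        by (intro tendsto_diff tendsto_const summable_LIMSEQ sm)
      then show ?thesis using suminf_minus_initial_segment[OF sm] by simp
    qed
    from tendsto_add[OF tendsto_add[OF 1 2] 3] show ?thesis by (simp add: bound_def[abs_def])
  qed
  then have "eventually (\<lambda>L. bound L < 1) sequentially" by (rule order_tendstoD) simp
  then obtain L where L: "bound L < 1" by (auto simp: eventually_sequentially)
  define m where "m = l + L"
  define H where "H x \<longleftrightarrow> (\<forall>j\<in>{1..m}. x j = h j)" for x
  have detH: "determined m H" unfolding H_def by (rule determinedI) auto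
  have HH: "{\<omega>\<in>space M. H (X \<omega>)} = hist m h" by (auto simp: H_def hist_def)
  have same: "G x = G h" if "determined m G" "H x" for G :: "(nat \<Rightarrow> nat) \<Rightarrow> 'c" and x
    by (rule determinedD[OF that(1)]) (use that(2) in \<open>auto simp: H_def\<close>)
  have deg_h: "deg h (l + n) q = deg h l q + (if q = u then n else 0)" for n q
    by (induction n) (auto simp: deg_Suc h_def)
  have deg_u: "L \<le> deg x m u" if "H x" for x
    using same[OF determined_deg that] deg_h[of L u] by (simp add: m_def)
  have g_mx: "g (mx x m) \<le> g L" if "parent_fun x" "H x" for x
    using deg_u[OF that(2)] deg_le_mx[OF that(1), of m u] by (intro g_antimono) linarith
  define Q where "Q = {..l} - {u}"
  \<comment> \<open>The history attaches nothing to \<open>Q\<close> after time \<open>l\<close>, so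
    the total degree there is at most \<open>l\<close>; as long as it stays equal to
    \<open>s0\<close>, the weight of \<open>Q\<close> is bounded independently of
    \<open>L\<close>.\<close>
  define s0 where "s0 = (\<Sum>q\<in>Q. deg h m q)"
  have s0: "s0 \<le> l"
  proof -
    have "s0 = (\<Sum>q\<in>Q. deg h l q)" unfolding s0_def m_def by (intro sum.cong) (auto simp: deg_h Q_def)
    also have "\<dots> \<le> (\<Sum>q\<le>l. deg h l q)" by (intro sum_mono2) (auto simp: Q_def)
    finally show ?thesis using sum_deg[OF h] by simp
  qed
  let ?c = "\<lambda>n x. (\<Sum>q\<in>Q. deg x n q) - s0"
  let ?B1 = "{\<omega>\<in>space M. H (X \<omega>) \<and> (\<exists>n\<ge>m. 1 \<le> ?c n (X \<omega>))}"
  let ?B2 = "\<lambda>t. {\<omega>\<in>space M. H (X \<omega>) \<and> (\<exists>n\<ge>m. 1 + k \<le> length (family (X \<omega>) t n))}"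
  let ?B3 = "\<lambda>i. {\<omega>\<in>space M. H (X \<omega>) \<and> (\<exists>t. m < t \<and> X \<omega> t = u \<and> deg (X \<omega>) (t - 1) u = i + L \<and> big k (X \<omega>) t)}"
  have [measurable]: "Measurable.pred M (\<lambda>\<omega>. H (X \<omega>))" unfolding H_def by measurable
  let ?P = "prob (hist m h)"
  have B1: "prob ?B1 \<le> ?P * (R * g L)"
  proof -
    have "prob ?B1 \<le> prob {\<omega>\<in>space M. H (X \<omega>)} * (R * g L) ^ 1"
    proof (rule counter_bound[where B = "\<lambda>_ _. Q"])
      fix n x
      show "determined n (?c n)"
        by (rule determined_comp[OF determined_deg, where F = "\<lambda>d. (\<Sum>q\<in>Q. d q) - s0"])
      fix y
      have s: "(\<Sum>q\<in>Q. deg (x(Suc n := y)) (Suc n) q) = (\<Sum>q\<in>Q. deg x n q) + of_bool (y \<in> Q)"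
        unfolding deg_upd sum.distrib by (simp add: Q_def)
      show "?c n x \<le> ?c (Suc n) (x(Suc n := y))" "?c (Suc n) (x(Suc n := y)) \<le> ?c n x + of_bool (y \<in> Q)"
        unfolding s by auto
    next
      fix n x assume "?c n x < 1"
      then have sl: "(\<Sum>q\<in>Q. deg x n q) \<le> l" using s0 by linarith
      have "f (deg x n q) \<le> real (Suc l) powr p" if "q \<in> Q" for q
      proof -
        have "deg x n q \<le> l" using member_le_sum[of q Q "deg x n"] that sl by (simp add: Q_def)
        then show ?thesis using p by (intro powr_mono2) auto
      qed
      then have "(\<Sum>q\<in>{..n} \<inter> Q. f (deg x n q)) \<le> (\<Sum>q\<in>{..n} \<inter> Q. real (Suc l) powr p)" by (intro sum_mono) auto
      also have "\<dots> \<le> real (Suc l) * real (Suc l) powr p"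
      proof -
        have "card ({..n} \<inter> Q) \<le> card {..l}" by (rule card_mono) (auto simp: Q_def)
        then show ?thesis by (simp add: mult_right_mono del: of_nat_Suc)
      qed
      also have "\<dots> = R" by (simp add: R_def powr_add del: of_nat_Suc)
      finally show "(\<Sum>q\<in>{..n} \<inter> Q. f (deg x n q)) \<le> R" .
    next
      fix x assume x: "parent_fun x" "H x"
      show "?c m x = 0 \<and> g (mx x m) \<le> g L"
        using same[OF determined_deg x(2)] g_mx[OF x] by (simp add: s0_def)
    qed (use R0 detH in auto)
    then show ?thesis by (simp add: HH)
  qed
  have B2: "prob (?B2 t) \<le> ?P * (Rk * g L) ^ k" if t: "t \<in> {l<..m}" for t
  proof -
    have fam: "family h t n = [t]" if "t \<le> n" for n
      using that
    proof (induction n rule: dec_induct)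
      case (step n)
      have "h (Suc n) \<le> l" using h u t step(1) by (auto simp: h_def l_def)
      then show ?case using step t by simp
    qed (rule family_birth)
    have "prob (?B2 t) \<le> prob {\<omega>\<in>space M. H (X \<omega>)} * (real (1 + k) powr (p + 1) * g L) ^ k"
    proof (rule family_bound[OF _ detH])
      fix x assume x: "parent_fun x" "H x"
      show "length (family x t m) \<le> 1 \<and> g (mx x m) \<le> g L"
        using same[OF determined_family x(2)] fam[of m] t g_mx[OF x] by simp
    qed (use t in auto)
    then show ?thesis by (simp add: HH Rk_def)
  qed
  have B3: "prob (?B3 i) \<le> ?P * (Rk * g (i + L)) ^ k" for i
    using big_child_bound[OF detH, of u "i + L" k] by (simp add: HH Rk_def)
  define E where "E = hist m h - (?B1 \<union> (\<Union>t\<in>{l<..m}. ?B2 t) \<union> (\<Union>i. ?B3 i))"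
  have sB: "?B1 \<in> sets M" "?B2 t \<in> sets M" "?B3 i \<in> sets M" for t i
  proof -
    have [measurable]: "(\<lambda>\<omega>. ?c n (X \<omega>)) \<in> measurable M (count_space UNIV)" for n
      by (rule determined_measurable[OF determined_comp[OF determined_deg, where F = "\<lambda>d. (\<Sum>q\<in>Q. d q) - s0"]])
    show "?B1 \<in> sets M" "?B2 t \<in> sets M" "?B3 i \<in> sets M" by measurable
  qed
  have sU: "(\<Union>t\<in>{l<..m}. ?B2 t) \<in> sets M" "(\<Union>i. ?B3 i) \<in> sets M"
    using sB by (auto intro!: sets.finite_UN sets.countable_UN)
  have sE: "E \<in> sets M" unfolding E_def using sB sU by auto
  have U2: "prob (\<Union>t\<in>{l<..m}. ?B2 t) \<le> ?P * (real L * (Rk * g L) ^ k)"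
  proof -
    have "prob (\<Union>t\<in>{l<..m}. ?B2 t) \<le> (\<Sum>t\<in>{l<..m}. prob (?B2 t))"
      by (intro finite_measure_subadditive_finite) (use sB(2) in auto)
    also have "\<dots> \<le> (\<Sum>t\<in>{l<..m}. ?P * (Rk * g L) ^ k)" by (intro sum_mono B2)
    finally show ?thesis by (simp add: m_def algebra_simps)
  qed
  have U3: "prob (\<Union>i. ?B3 i) \<le> ?P * (\<Sum>i. (Rk * g (i + L)) ^ k)"
  proof -
    have sm: "summable (\<lambda>i. ?P * (Rk * g (i + L)) ^ k)"
      by (intro summable_mult summable_ignore_initial_segment[OF summable_g_power[OF k]])
    have sm': "summable (\<lambda>i. prob (?B3 i))"
      by (rule summable_comparison_test'[OF sm, of 0]) (use B3 in simp)
    have "prob (\<Union>i. ?B3 i) \<le> (\<Sum>i. prob (?B3 i))"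
      by (intro finite_measure_subadditive_countably sm') (use sB(3) in auto)
    also have "\<dots> \<le> (\<Sum>i. ?P * (Rk * g (i + L)) ^ k)" by (rule suminf_le[OF B3 sm' sm])
    also have "\<dots> = ?P * (\<Sum>i. (Rk * g (i + L)) ^ k)"
      by (intro suminf_mult summable_ignore_initial_segment[OF summable_g_power[OF k]])
    finally show ?thesis .
  qed
  have "prob (?B1 \<union> (\<Union>t\<in>{l<..m}. ?B2 t) \<union> (\<Union>i. ?B3 i)) \<le> prob ?B1 + prob (\<Union>t\<in>{l<..m}. ?B2 t) + prob (\<Union>i. ?B3 i)"
    using measure_Un_le[of "?B1 \<union> (\<Union>t\<in>{l<..m}. ?B2 t)" M "\<Union>i. ?B3 i"] measure_Un_le[OF sB(1) sU(1)] sB(1) sU by simp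
  also have "\<dots> \<le> ?P * bound L" unfolding bound_def ring_distribs using B1 U2 U3 by linarith
  also have "\<dots> < ?P * 1" using L prob_hist_pos[OF h, of m] by (intro mult_strict_left_mono)
  finally have lt: "prob (?B1 \<union> (\<Union>t\<in>{l<..m}. ?B2 t) \<union> (\<Union>i. ?B3 i)) < ?P" by simp
  have "?P \<le> prob (E \<union> (?B1 \<union> (\<Union>t\<in>{l<..m}. ?B2 t) \<union> (\<Union>i. ?B3 i)))"
    by (rule finite_measure_mono) (use sE sB sU in \<open>auto simp: E_def\<close>)
  also have "\<dots> \<le> prob E + prob (?B1 \<union> (\<Union>t\<in>{l<..m}. ?B2 t) \<union> (\<Union>i. ?B3 i))"
    by (rule measure_Un_le) (use sE sB sU in auto)
  finally have "0 < prob E" using lt by linarith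
  moreover have "core (X \<omega>) k u {..length ds} \<and> sub_tree (X \<omega>) {..length ds} = code_tree ds" if \<omega>: "\<omega> \<in> E" for \<omega>
  proof -
    have sp: "\<omega> \<in> space M" and HX: "H (X \<omega>)" and n1: "\<omega> \<notin> ?B1" and n2: "\<And>t. t \<in> {l<..m} \<Longrightarrow> \<omega> \<notin> ?B2 t"
      and n3: "\<And>i. \<omega> \<notin> ?B3 i"
      using \<omega> HH by (auto simp: E_def)
    let ?x = "X \<omega>"
    note x = parent_fun_X[OF sp]
    have xh: "?x j = h j" if "0 < j" "j \<le> m" for j using HX that by (auto simp: H_def)
    have lm: "l \<le> m" by (simp add: m_def)
    have "core ?x k u {..l}"
      unfolding core_def
    proof (intro conjI allI impI)
      fix j assume j: "0 < j" "j \<in> {..l}"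
      then show "?x j \<in> {..l}" using parent_funD[OF x j(1)] by auto
    next
      fix j assume j: "0 < j" "j \<notin> {..l}" "?x j \<in> {..l}"
      show "?x j = u"
      proof (cases "j \<le> m")
        case True
        then show ?thesis using xh[OF j(1)] j by (auto simp: h_def)
      next
        case False
        show ?thesis
        proof (rule ccontr)
          assume "?x j \<noteq> u"
          then have q: "?x j \<in> Q" using j(3) by (simp add: Q_def)
          have "deg h m (?x j) < deg ?x j (?x j)"
          proof -
            have "deg h m (?x j) = deg ?x m (?x j)" using same[OF determined_deg HX] by simp
            also have "\<dots> \<le> deg ?x (j - 1) (?x j)" using False by (intro deg_mono) auto
            also have "\<dots> < deg ?x j (?x j)" using j(1) by (cases j) (auto simp: deg_Suc)
            finally show ?thesis .
          qed
          moreover have "deg h m q' \<le> deg ?x j q'" for q'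
            using same[OF determined_deg HX] deg_mono[of m j ?x q'] False by simp
          ultimately have "s0 < (\<Sum>q\<in>Q. deg ?x j q)"
            unfolding s0_def using q by (intro sum_strict_mono_ex1) (auto simp: Q_def)
          then have "1 \<le> ?c j ?x" by simp
          then show False using n1 HX sp False by (auto intro!: exI[of _ j])
        qed
      qed
    next
      fix j assume j: "j \<notin> {..l}" "?x j = u"
      show "\<not> big k ?x j"
      proof
        assume b: "big k ?x j"
        then obtain n where n: "k < length (family ?x j n)" by (auto simp: big_def)
        show False
        proof (cases "j \<le> m")
          case True
          have "1 + k \<le> length (family ?x j (max m n))"
            using n length_family_mono[of n "max m n" ?x j] by simp
          then show False using n2[of j] True j(1) HX sp by (auto intro!: exI[of _ "max m n"])
        next
          case False
          then have "m \<le> j - 1" by linarith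
          then have "L \<le> deg ?x (j - 1) u" using deg_u[OF HX] deg_mono[of m "j - 1" ?x u] by linarith
          then obtain i where "deg ?x (j - 1) u = i + L" by (metis le_add_diff_inverse2)
          then show False using n3[of i] False b j(2) HX sp by auto
        qed
      qed
    qed (use u in \<open>auto simp: l_def\<close>)
    moreover have "sub_tree ?x {..l} = code_tree ds"
    proof -
      have "{(j, ?x j) | j. j \<in> {..l} \<and> 0 < j} = {(Suc i, ds ! i) | i. i < length ds}" (is "?A = ?B")
      proof (intro equalityI subsetI)
        fix e assume "e \<in> ?A"
        then obtain j where j: "e = (j, ?x j)" "j \<le> l" "0 < j" by auto
        then obtain i where "j = Suc i" by (cases j) auto
        then show "e \<in> ?B" using j xh[of j] lm by (auto simp: h_def l_def)
      next
        fix e assume "e \<in> ?B"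
        then obtain i where i: "e = (Suc i, ds ! i)" "i < length ds" by auto
        then show "e \<in> ?A" using xh[of "Suc i"] lm by (auto simp: h_def l_def)
      qed
      then show ?thesis by (simp add: sub_tree_def code_tree_def l_def)
    qed
    ultimately show ?thesis by (simp add: l_def)
  qed
  ultimately show ?thesis using sE by blast
qed

lemma prob_Glue_pos:
  assumes k: "1 < (p - 1) * real k" "\<And>l. l < k \<Longrightarrow> (p - 1) * real l \<le> 1"
    and S: "finite_rooted_tree S" and v: "v \<in> nodes S"
  shows "0 < prob {\<omega>\<in>space M. rtree_iso (full_tree (X \<omega>)) (Glue S v k)}"
proof -
  obtain ds \<phi> where ds: "code ds" and \<phi>: "is_iso \<phi> (code_tree ds) S" using code_exists[OF S] by blast
  have "v \<in> \<phi> ` {..length ds}" using \<phi> v by (simp add: is_iso_def bij_betw_def)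
  then obtain u where u: "u \<le> length ds" "\<phi> u = v" by (metis imageE atMost_iff)
  obtain E where E: "E \<in> sets M" "0 < prob E"
    "\<And>\<omega>. \<omega> \<in> E \<Longrightarrow> core (X \<omega>) k u {..length ds} \<and> sub_tree (X \<omega>) {..length ds} = code_tree ds"
    using prob_core_pos[OF k(1) ds u(1)] by blast
  have rich: "AE \<omega> in M. \<forall>u F. core (X \<omega>) k u F \<longrightarrow> rich (X \<omega>) k u F" by (rule AE_rich) (rule k(2))
  have "prob E \<le> prob {\<omega>\<in>space M. rtree_iso (full_tree (X \<omega>)) (Glue S v k)}"
  proof (rule finite_measure_mono_AE)
    show "{\<omega>\<in>space M. rtree_iso (full_tree (X \<omega>)) (Glue S v k)} \<in> sets M" by (rule Glue_measurable[OF S v])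
    show "AE \<omega> in M. \<omega> \<in> E \<longrightarrow> \<omega> \<in> {\<omega>\<in>space M. rtree_iso (full_tree (X \<omega>)) (Glue S v k)}"
      using rich AE_space
    proof eventually_elim
      case (elim \<omega>)
      show ?case
      proof
        assume "\<omega> \<in> E"
        from E(3)[OF this] have c: "core (X \<omega>) k u {..length ds}" "sub_tree (X \<omega>) {..length ds} = code_tree ds" by auto
        have "rtree_iso (full_tree (X \<omega>)) (Glue S v k)"
          using elim c \<phi> u(2) S
          by (intro full_tree_iso_Glue[OF parent_fun_X[OF elim(2)] c(1), where \<phi> = \<phi>]) (auto simp: finite_rooted_tree_def)
        then show "\<omega> \<in> {\<omega>\<in>space M. rtree_iso (full_tree (X \<omega>)) (Glue S v k)}" using elim(2) by simp
      qed
    qed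
  qed
  then show ?thesis using E(2) by linarith
qed

end

theorem theorem1p2:
  fixes M :: "'w measure"
    and w :: "nat \<Rightarrow> 'w \<Rightarrow> nat"
    and T :: "nat \<Rightarrow> 'w \<Rightarrow> nat rtree"
    and p :: real
    and k :: nat
  assumes "p > 1"
    and "GN_process M (\<lambda>x. (real x + 1) powr p) w T"
    and "k = (LEAST j::nat. 0 < j \<and> p > 1 + 1 / real j)"
  shows "{C \<in> iso_classes. \<P>(\<omega> in M. limit_tree (\<lambda>m. T m \<omega>) \<in> C) > 0}
           = {iso_class (Glue S v k) | (S :: nat rtree) v. finite_rooted_tree S \<and> v \<in> nodes S}"
proof -
  interpret superlinear_GN M w T p
    using assms(1,2) by (intro superlinear_GN.intro GN_parents.intro superlinear_GN_axioms.intro)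
  have "\<exists>j::nat. 0 < j \<and> p > 1 + 1 / real j"
  proof -
    obtain j :: nat where j: "1 / (p - 1) < real j" using reals_Archimedean2 by blast
    moreover have "0 < 1 / (p - 1)" using p by simp
    ultimately have "0 < real j" by linarith
    moreover from this have "1 / real j < p - 1" using j p by (simp add: divide_less_eq mult.commute)
    ultimately have "0 < j \<and> p > 1 + 1 / real j" by auto
    then show ?thesis ..
  qed
  then have "0 < k \<and> p > 1 + 1 / real k" unfolding assms(3) by (rule LeastI_ex)
  then have "0 < k" "1 / real k < p - 1" by auto
  then have k: "1 < (p - 1) * real k" by (simp add: divide_less_eq)
  have less_k: "(p - 1) * real l \<le> 1" if l: "l < k" for l
  proof (cases "l = 0")
    case False
    then have "\<not> p > 1 + 1 / real l" using not_less_Least[OF l[unfolded assms(3)]] by simp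
    then have "p - 1 \<le> 1 / real l" by simp
    then show ?thesis using False by (simp add: pos_le_divide_eq)
  qed simp
  have limit: "limit_tree (\<lambda>m. T m \<omega>) = full_tree (X \<omega>)" if "\<omega> \<in> space M" for \<omega>
    using limit_tree_X[OF that] by (simp add: full_tree_def)
  show ?thesis
  proof (intro equalityI subsetI)
    fix C assume "C \<in> {C \<in> iso_classes. \<P>(\<omega> in M. limit_tree (\<lambda>m. T m \<omega>) \<in> C) > 0}"
    then obtain R :: "nat rtree" where C: "C = iso_class R"
      and pos: "\<P>(\<omega> in M. limit_tree (\<lambda>m. T m \<omega>) \<in> C) > 0" by (auto simp: iso_classes_def)
    \<comment> \<open>A non-measurable set has measure 0, so positive probability already yields
      measurability of the event for an arbitrary class.\<close>
    have sets: "{\<omega>\<in>space M. limit_tree (\<lambda>m. T m \<omega>) \<in> C} \<in> sets M"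
      using pos measure_notin_sets by fastforce
    have "\<exists>\<omega>\<in>space M. limit_tree (\<lambda>m. T m \<omega>) \<in> C \<and>
      (\<exists>S v. finite_rooted_tree S \<and> v \<in> nodes S \<and> rtree_iso (full_tree (X \<omega>)) (Glue (S :: nat rtree) v k))"
    proof (rule ccontr)
      assume none: "\<not> ?thesis"
      have "AE \<omega> in M. \<exists>S v. finite_rooted_tree S \<and> v \<in> nodes S \<and>
          rtree_iso (full_tree (X \<omega>)) (Glue (S :: nat rtree) v k)"
        by (rule AE_Glue[OF k]) (rule less_k)
      then have "AE \<omega> in M. \<omega> \<notin> {\<omega>\<in>space M. limit_tree (\<lambda>m. T m \<omega>) \<in> C}"
        using AE_space by eventually_elim (use none in blast)
      then show False using pos prob_eq_0[OF sets] by simp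
    qed
    then obtain \<omega> S v where \<omega>: "\<omega> \<in> space M" "limit_tree (\<lambda>m. T m \<omega>) \<in> C"
      and S: "finite_rooted_tree S" "v \<in> nodes S" "rtree_iso (full_tree (X \<omega>)) (Glue (S :: nat rtree) v k)"
      by blast
    have "iso_class (full_tree (X \<omega>)) = C"
      unfolding C by (rule iso_class_eq) (use \<omega> in \<open>simp_all add: C iso_class_def limit\<close>)
    moreover have "iso_class (full_tree (X \<omega>)) = iso_class (Glue S v k)"
      by (rule iso_class_eq[OF S(3)]) simp
    ultimately show "C \<in> {iso_class (Glue S v k) | (S :: nat rtree) v. finite_rooted_tree S \<and> v \<in> nodes S}"
      using S by auto
  next
    fix C assume "C \<in> {iso_class (Glue S v k) | (S :: nat rtree) v. finite_rooted_tree S \<and> v \<in> nodes S}"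
    then obtain S v where C: "C = iso_class (Glue (S :: nat rtree) v k)"
      and S: "finite_rooted_tree S" "v \<in> nodes S" by blast
    have "{\<omega>\<in>space M. limit_tree (\<lambda>m. T m \<omega>) \<in> C} = {\<omega>\<in>space M. rtree_iso (full_tree (X \<omega>)) (Glue S v k)}"
      unfolding C using rooted_full_tree[OF parent_fun_X] by (auto simp: iso_class_def limit)
    then have pos: "\<P>(\<omega> in M. limit_tree (\<lambda>m. T m \<omega>) \<in> C) > 0"
      using prob_Glue_pos[OF k _ S] less_k by simp
    \<comment> \<open>That \<open>C\<close> is the class of some rooted tree on the naturals is seen
      from an actual realisation of the limit tree, which exists because the event is not
      empty.\<close>
    then have "{\<omega>\<in>space M. limit_tree (\<lambda>m. T m \<omega>) \<in> C} \<noteq> {}" by (metis measure_empty less_irrefl)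
    then obtain \<omega> where \<omega>: "\<omega> \<in> space M" "limit_tree (\<lambda>m. T m \<omega>) \<in> C" by blast
    have "rtree_iso (full_tree (X \<omega>)) (Glue S v k)"
      using \<omega> by (simp add: C iso_class_def limit)
    then have "iso_class (full_tree (X \<omega>)) = C"
      unfolding C by (rule iso_class_eq) simp
    then have "C \<in> iso_classes"
      unfolding iso_classes_def using rooted_full_tree[OF parent_fun_X[OF \<omega>(1)]] by blast
    then show "C \<in> {C \<in> iso_classes. \<P>(\<omega> in M. limit_tree (\<lambda>m. T m \<omega>) \<in> C) > 0}"
      using pos by simp
  qed
qed

end
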